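(* Let $N\in\{1,2,3\}$, $d\ge2$, $\lambda_1,\dots,\lambda_d>0$, $0<\mu_1\le\mu_2\le\dots\le\mu_d$ and $b>0$, and consider the system $$-\Delta u_i+\lambda_i u_i=\mu_i u_i^3+u_i\sum_{j\ne i}b\,u_j^2,\qquad u_i\in H^1(\mathbb{R}^N;\mathbb{R}),\quad i=1,\ldots,d$$ (that is, $b_{ij}=b$ for all $i\neq j$). If $$b<2^{1-\frac d2}\sqrt{\mu_1\mu_d},$$ then $G^*=\emptyset$.
   Context: Let $1\le N\le 3$, $\lambda_i,\mu_i>0$ for $i=1,\dots,d$, and $b_{ij}=b_{ji}>0$ for $i\neq j$. Consider the system $-\Delta u_i+\lambda_i u_i=\mu_i u_i^3+u_i\sum_{j\neq i}b_{ij}u_j^2$ in $\mathbb{R}^N$, $u_i\in H^1(\mathbb{R}^N;\mathbb{R})$, $i=1,\dots,d$. Its solutions are the critical points of the $C^2$ functional $I_d:(H^1(\mathbb{R}^N))^d\to\mathbb{R}$, $$I_d(\mathbf{u})=\frac12\sum_{i=1}^d\int(|\nabla u_i|^2+\lambda_i u_i^2)-\frac14\sum_{i=1}^d\mu_i\int u_i^4-\frac12\sum_{i<j}b_{ij}\int u_i^2u_j^2 .$$ The ground state level is $c=\inf\{I_d(\mathbf{u}):\mathbf{u}\ne\mathbf{0},\ I_d'(\mathbf{u})=0\}$, and a ground state is an element of $G=\{\mathbf{u}:\mathbf{u}\neq\mathbf{0},\ I_d'(\mathbf{u})=0,\ I_d(\mathbf{u})=c\}$. $G^*=\{\mathbf{u}\in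 G: u_i\not\equiv0\text{ for every } i=1,\dots,d\}$ is the set of fully nontrivial ground states. *)

theory Defs
  imports "HOL-Analysis.Analysis"
begin

section \<open>Test functions\<close>

primrec Ck :: "nat \<Rightarrow> ('a::euclidean_space \<Rightarrow> real) \<Rightarrow> bool" where
  "Ck 0 f \<longleftrightarrow> continuous_on UNIV f"
| "Ck (Suc k) f \<longleftrightarrow> (\<forall>x. f differentiable at x) \<and>
     (\<forall>e\<in>Basis. Ck k (\<lambda>x. frechet_derivative f (at x) e))"

definition test_function :: "('a::euclidean_space \<Rightarrow> real) \<Rightarrow> bool" where
  "test_function \<phi> \<longleftrightarrow> (\<forall>k. Ck k \<phi>) \<and> compact (closure {x. \<phi> x \<noteq> 0})"

lemma Ck_Suc_D: "Ck (Suc k) f \<Longrightarrow> Ck k f"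
proof (induction k arbitrary: f)
  case 0
  then show ?case
    by (auto intro!: differentiable_imp_continuous_on simp: differentiable_on_def)
next
  case (Suc k)
  then show ?case by (metis Ck.simps(2))
qed

lemma Ck_const: "Ck k (\<lambda>x. c)"
  by (induction k arbitrary: c) auto

lemma Ck_add:
  assumes "Ck k f" "Ck k g" shows "Ck k (\<lambda>x. f x + g x)"
  using assms
proof (induction k arbitrary: f g)
  case 0
  then show ?case by (auto intro: continuous_intros)
next
  case (Suc k)
  have d: "((\<lambda>x. f x + g x) has_derivative
     (\<lambda>e. frechet_derivative f (at x) e + frechet_derivative g (at x) e)) (at x)" for x
    using Suc.prems by (auto intro!: has_derivative_add simp: frechet_derivative_works[symmetric])
  have eq: "frechet_derivative (\<lambda>x. f x + g x) (at x) e =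
     frechet_derivative f (at x) e + frechet_derivative g (at x) e" for x e
    using frechet_derivative_at[OF d[of x]] by metis
  show ?case
    using Suc d by (auto simp: eq differentiable_def)
qed

lemma Ck_mult:
  assumes "Ck k f" "Ck k g" shows "Ck k (\<lambda>x. f x * g x)"
  using assms
proof (induction k arbitrary: f g)
  case 0
  then show ?case by (auto intro: continuous_intros)
next
  case (Suc k)
  have d: "((\<lambda>x. f x * g x) has_derivative
     (\<lambda>e. f x * frechet_derivative g (at x) e + frechet_derivative f (at x) e * g x)) (at x)" for x
    using Suc.prems by (auto intro!: has_derivative_mult simp: frechet_derivative_works[symmetric])
  have eq: "frechet_derivative (\<lambda>x. f x * g x) (at x) e =
     f x * frechet_derivative g (at x) e + frechet_derivative f (at x) e * g x" for x e
    using frechet_derivative_at[OF d[of x]] by metis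
  have "Ck k f" "Ck k g" using Suc.prems Ck_Suc_D by blast+
  then show ?case
    using Suc d by (auto simp: eq differentiable_def intro!: Ck_add)
qed

lemma Ck_prod:
  assumes "finite A" "\<And>i. i \<in> A \<Longrightarrow> Ck k (f i)" shows "Ck k (\<lambda>x. \<Prod>i\<in>A. f i x)"
  using assms by (induction A rule: finite_induct) (auto intro: Ck_mult Ck_const)

definition flat_exp :: "nat \<Rightarrow> real \<Rightarrow> real" where
  "flat_exp n t = (if t > 0 then exp (- (1/t)) / t ^ n else 0)"

lemma flat_exp_tendsto_0: "(flat_exp n \<longlongrightarrow> 0) (at 0)"
proof -
  have "((\<lambda>t. (inverse t) ^ n / exp (inverse t)) \<longlongrightarrow> 0) (at_right (0::real))"
    using filterlim_compose[OF tendsto_power_div_exp_0 filterlim_inverse_at_top_right] by simp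
  then have "(flat_exp n \<longlongrightarrow> 0) (at_right 0)"
    by (rule Lim_transform_eventually)
      (auto simp: flat_exp_def eventually_at_filter exp_minus divide_simps)
  moreover have "(flat_exp n \<longlongrightarrow> 0) (at_left 0)"
    by (rule Lim_transform_eventually[of "\<lambda>_. 0"])
      (auto simp: flat_exp_def eventually_at_filter)
  ultimately show ?thesis by (simp add: filterlim_split_at)
qed

lemma flat_exp_deriv:
  "(flat_exp n has_real_derivative (flat_exp (n + 2) t - real n * flat_exp (n + 1) t)) (at t)"
proof (cases t "0::real" rule: linorder_cases)
  case less
  have "((\<lambda>_. 0) has_real_derivative 0) (at t)" by simp
  then have "(flat_exp n has_real_derivative 0) (at t)"
    by (rule has_field_derivative_transform_within_open[of _ _ _ "{..<0}"])
      (use less in \<open>auto simp: flat_exp_def\<close>)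
  then show ?thesis using less by (simp add: flat_exp_def)
next
  case equal
  have "((\<lambda>h. (flat_exp n (0 + h) - flat_exp n 0) / h) \<longlongrightarrow> 0) (at 0)"
    by (rule Lim_transform_eventually[OF flat_exp_tendsto_0[of "n + 1"]])
      (auto simp: flat_exp_def eventually_at_filter)
  then show ?thesis using equal by (simp add: DERIV_def flat_exp_def)
next
  case greater
  have p: "t ^ n > 0" using greater by simp
  have "((\<lambda>t. exp (- (1/t)) / t ^ n) has_real_derivative
      (exp (- (1/t)) * (1 / t^2) * t ^ n - exp (- (1/t)) * (real n * t ^ (n - 1))) / (t ^ n * t ^ n)) (at t)"
    using greater by (auto intro!: derivative_eq_intros simp: power2_eq_square)
  also have "(exp (- (1/t)) * (1 / t^2) * t ^ n - exp (- (1/t)) * (real n * t ^ (n - 1))) / (t ^ n * t ^ n)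
     = flat_exp (n + 2) t - real n * flat_exp (n + 1) t"
    using greater p by (cases n) (simp_all add: flat_exp_def power2_eq_square field_simps)
  finally show ?thesis
    by (rule has_field_derivative_transform_within_open[of _ _ _ "{0<..}"])
      (use greater in \<open>auto simp: flat_exp_def\<close>)
qed

lemma Ck_flat_exp: "Ck k (\<lambda>x::'a::euclidean_space. flat_exp n (c * (x \<bullet> i) + a))"
proof (induction k arbitrary: n)
  case 0
  have "isCont (flat_exp n) t" for t using flat_exp_deriv DERIV_isCont by blast
  then have "continuous_on UNIV (flat_exp n)" by (simp add: continuous_on_eq_continuous_at)
  then show ?case
    by (auto intro!: continuous_on_compose2[of UNIV "flat_exp n"] continuous_intros)
next
  case (Suc k)
  have d: "((\<lambda>x::'a. flat_exp n (c * (x \<bullet> i) + a)) has_derivative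
      (\<lambda>e. (flat_exp (n + 2) (c * (x \<bullet> i) + a) - real n * flat_exp (n + 1) (c * (x \<bullet> i) + a)) * (c * (e \<bullet> i))))
      (at x)" for x
  proof -
    have "((\<lambda>x::'a. c * (x \<bullet> i) + a) has_derivative (\<lambda>e. c * (e \<bullet> i))) (at x)"
      by (auto intro!: derivative_eq_intros)
    from has_derivative_compose[OF this flat_exp_deriv[unfolded has_field_derivative_def]]
    show ?thesis by (simp add: mult.commute)
  qed
  have eq: "frechet_derivative (\<lambda>x::'a. flat_exp n (c * (x \<bullet> i) + a)) (at x) e =
     flat_exp (n + 2) (c * (x \<bullet> i) + a) * (c * (e \<bullet> i)) +
       (- real n * (c * (e \<bullet> i))) * flat_exp (n + 1) (c * (x \<bullet> i) + a)" for x e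
    by (subst frechet_derivative_at[OF d[of x], symmetric]) (simp add: algebra_simps)
  show ?case
    using d unfolding Ck.simps eq
    by (intro conjI allI ballI Ck_add Ck_mult Ck_const Suc.IH) (auto simp: differentiable_def)
qed

text \<open>Smooth approximations from below of the indicator function of an open box.\<close>

definition box_bump :: "'a::euclidean_space \<Rightarrow> 'a \<Rightarrow> nat \<Rightarrow> 'a \<Rightarrow> real" where
  "box_bump a b k x = (\<Prod>i\<in>Basis. flat_exp 0 (Suc k * (x \<bullet> i - a \<bullet> i)) *
     flat_exp 0 (Suc k * (b \<bullet> i - x \<bullet> i)))"

lemma box_bump_outside: "x \<notin> box a b \<Longrightarrow> box_bump a b k x = 0"
proof -
  assume "x \<notin> box a b"
  then obtain i where i: "i \<in> Basis" "x \<bullet> i \<le> a \<bullet> i \<or> b \<bullet> i \<le> x \<bullet> i"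
    by (auto simp: mem_box not_less)
  then have "real (Suc k) * (x \<bullet> i - a \<bullet> i) \<le> 0 \<or> real (Suc k) * (b \<bullet> i - x \<bullet> i) \<le> 0"
    by (auto simp: mult_le_0_iff)
  then show ?thesis
    unfolding box_bump_def using i(1)
    by (intro prod_zero) (auto simp: flat_exp_def not_less intro!: bexI[of _ i])
qed

lemma test_function_box_bump: "test_function (box_bump a b k)"
proof -
  have "closure {x. box_bump a b k x \<noteq> 0} \<subseteq> cbox a b"
    by (rule closure_minimal) (use box_bump_outside box_subset_cbox in fastforce)+
  then have "compact (closure {x. box_bump a b k x \<noteq> 0})"
    using compact_cbox bounded_subset compact_imp_bounded compact_eq_bounded_closed closed_closure
    by metis
  moreover have "Ck m (box_bump a b k)" for m
  proof -
    have "Ck m (\<lambda>x. \<Prod>i\<in>Basis.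
        flat_exp 0 (real (Suc k) * (x \<bullet> i) + - (real (Suc k) * (a \<bullet> i))) *
        flat_exp 0 (- real (Suc k) * (x \<bullet> i) + real (Suc k) * (b \<bullet> i)))"
      by (intro Ck_prod Ck_mult Ck_flat_exp) auto
    also have "\<dots> = box_bump a b k"
      unfolding box_bump_def fun_eq_iff
      by (intro allI prod.cong refl arg_cong2[where f = "(*)"] arg_cong[where f = "flat_exp 0"])
        (simp_all add: algebra_simps)
    finally show ?thesis .
  qed
  ultimately show ?thesis by (simp add: test_function_def)
qed

lemma flat_exp_0_bounds: "0 \<le> flat_exp 0 t" "flat_exp 0 t \<le> 1"
  by (auto simp: flat_exp_def)

lemma box_bump_bounds: "0 \<le> box_bump a b k x" "box_bump a b k x \<le> 1"
  unfolding box_bump_def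
  by (auto intro!: prod_nonneg prod_le_1 mult_nonneg_nonneg mult_le_one flat_exp_0_bounds)

lemma box_bump_tendsto: "(\<lambda>k. box_bump a b k x) \<longlonglongrightarrow> indicator (box a b) x"
proof (cases "x \<in> box a b")
  case False
  then show ?thesis by (simp add: box_bump_outside)
next
  case True
  have lim: "(\<lambda>k. flat_exp 0 (Suc k * s)) \<longlonglongrightarrow> 1" if "s > 0" for s :: real
  proof -
    have "(\<lambda>k. exp (- ((1/s) * (1 / real (Suc k))))) \<longlonglongrightarrow> exp (- ((1/s) * 0))"
      by (intro tendsto_intros LIMSEQ_Suc[OF lim_1_over_n])
    then show ?thesis using that by (simp add: flat_exp_def mult.commute)
  qed
  have "(\<lambda>k. box_bump a b k x) \<longlonglongrightarrow> (\<Prod>i\<in>(Basis::'a set). 1 * 1)"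
  proof (unfold box_bump_def, intro tendsto_prod tendsto_mult)
    fix i :: 'a assume i: "i \<in> Basis"
    show "(\<lambda>k. flat_exp 0 (Suc k * (x \<bullet> i - a \<bullet> i))) \<longlonglongrightarrow> 1"
      using True i by (intro lim) (simp add: mem_box)
    show "(\<lambda>k. flat_exp 0 (Suc k * (b \<bullet> i - x \<bullet> i))) \<longlonglongrightarrow> 1"
      using True i by (intro lim) (simp add: mem_box)
  qed
  then show ?thesis using True by simp
qed

section \<open>Square integrable functions and weak gradients\<close>

definition square_integrable :: "('a::euclidean_space \<Rightarrow> 'b::euclidean_space) \<Rightarrow> bool" where
  "square_integrable f \<longleftrightarrow> f \<in> borel_measurable lborel \<and> integrable lborel (\<lambda>x. (norm (f x))\<^sup>2)"

definition weak_gradient :: "('a::euclidean_space \<Rightarrow> real) \<Rightarrow> ('a \<Rightarrow> 'a) \<Rightarrow> bool" where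
  "weak_gradient u g \<longleftrightarrow> (\<forall>\<phi>. test_function \<phi> \<longrightarrow> (\<forall>e\<in>Basis.
     (LINT x|lborel. u x * frechet_derivative \<phi> (at x) e) = - (LINT x|lborel. (g x \<bullet> e) * \<phi> x)))"

lemma square_integrable_measurable [measurable_dest]:
  "square_integrable f \<Longrightarrow> f \<in> borel_measurable borel"
  by (simp add: square_integrable_def)

lemma square_integrable_inner:
  fixes f g :: "'a::euclidean_space \<Rightarrow> 'b::euclidean_space"
  assumes [measurable]: "square_integrable f" "square_integrable g"
  shows "integrable lborel (\<lambda>x. f x \<bullet> g x)"
proof (rule Bochner_Integration.integrable_bound)
  show "integrable lborel (\<lambda>x. (norm (f x))\<^sup>2 + (norm (g x))\<^sup>2)"
    using assms by (auto simp: square_integrable_def)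
  show "AE x in lborel. norm (f x \<bullet> g x) \<le> norm ((norm (f x))\<^sup>2 + (norm (g x))\<^sup>2)"
  proof (rule AE_I2)
    fix x
    have "\<bar>f x \<bullet> g x\<bar> \<le> norm (f x) * norm (g x)" by (rule Cauchy_Schwarz_ineq2)
    also have "2 * \<dots> \<le> (norm (f x))\<^sup>2 + (norm (g x))\<^sup>2"
      using sum_squares_bound[of "norm (f x)" "norm (g x)"] by simp
    finally show "norm (f x \<bullet> g x) \<le> norm ((norm (f x))\<^sup>2 + (norm (g x))\<^sup>2)"
      by (smt (verit) abs_ge_zero mult_nonneg_nonneg norm_ge_zero real_norm_def)
  qed
qed measurable

lemma square_integrable_mult:
  fixes f g :: "'a::euclidean_space \<Rightarrow> real"
  assumes "square_integrable f" "square_integrable g"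
  shows "integrable lborel (\<lambda>x. f x * g x)"
  using square_integrable_inner[OF assms] by (simp add: inner_real_def)

lemma square_integrable_add:
  fixes f g :: "'a::euclidean_space \<Rightarrow> 'b::euclidean_space"
  assumes [measurable]: "square_integrable f" "square_integrable g"
  shows "square_integrable (\<lambda>x. f x + g x)"
proof -
  have "integrable lborel (\<lambda>x. f x \<bullet> f x + 2 * (f x \<bullet> g x) + g x \<bullet> g x)"
    by (intro Bochner_Integration.integrable_add integrable_mult_right square_integrable_inner assms)
  also have "(\<lambda>x. f x \<bullet> f x + 2 * (f x \<bullet> g x) + g x \<bullet> g x) = (\<lambda>x. (norm (f x + g x))\<^sup>2)"
    by (simp add: fun_eq_iff power2_norm_eq_inner inner_add inner_commute)
  finally show ?thesis
    by (auto simp: square_integrable_def)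
qed

lemma square_integrable_scaleR:
  fixes f :: "'a::euclidean_space \<Rightarrow> 'b::euclidean_space"
  assumes "square_integrable f" shows "square_integrable (\<lambda>x. c *\<^sub>R f x)"
  using assms by (auto simp: square_integrable_def power_mult_distrib)

lemma square_integrable_zero: "square_integrable (\<lambda>x. 0)"
  by (simp add: square_integrable_def)

lemma square_integrable_component:
  fixes f :: "'a::euclidean_space \<Rightarrow> 'b::euclidean_space"
  assumes "square_integrable f" "e \<in> Basis" shows "square_integrable (\<lambda>x. f x \<bullet> e)"
  unfolding square_integrable_def
proof
  note [measurable] = assms(1)
  show "(\<lambda>x. f x \<bullet> e) \<in> borel_measurable lborel" by measurable
  show "integrable lborel (\<lambda>x. (norm (f x \<bullet> e))\<^sup>2)"
  proof (rule Bochner_Integration.integrable_bound)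
    show "integrable lborel (\<lambda>x. (norm (f x))\<^sup>2)"
      using assms by (simp add: square_integrable_def)
    show "AE x in lborel. norm ((norm (f x \<bullet> e))\<^sup>2) \<le> norm ((norm (f x))\<^sup>2)"
      using assms(2) by (auto intro!: AE_I2 simp: abs_le_square_iff[symmetric] Basis_le_norm)
  qed measurable
qed

lemma square_integrable_continuous:
  fixes f :: "'a::euclidean_space \<Rightarrow> real"
  assumes "continuous_on UNIV f" "compact S" "\<And>x. x \<notin> S \<Longrightarrow> f x = 0"
  shows "square_integrable f"
proof -
  have "continuous_on S (\<lambda>x. (norm (f x))\<^sup>2)"
    using assms(1) by (intro continuous_intros) (auto intro: continuous_on_subset)
  from borel_integrable_compact[OF assms(2) this]
  have "integrable lborel (\<lambda>x. indicator S x *\<^sub>R (norm (f x))\<^sup>2)" .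
  also have "(\<lambda>x. indicator S x *\<^sub>R (norm (f x))\<^sup>2) = (\<lambda>x. (norm (f x))\<^sup>2)"
    using assms(3) by (auto simp: fun_eq_iff indicator_def)
  finally show ?thesis
    using assms(1) by (simp add: square_integrable_def borel_measurable_continuous_onI)
qed

lemma test_function_square_integrable:
  assumes "test_function \<phi>" shows "square_integrable \<phi>"
proof (rule square_integrable_continuous)
  show "continuous_on UNIV \<phi>"
    using assms Ck.simps(1) test_function_def by blast
  show "compact (closure {x. \<phi> x \<noteq> 0})" using assms by (simp add: test_function_def)
  show "\<phi> x = 0" if "x \<notin> closure {x. \<phi> x \<noteq> 0}" for x
    using that closure_subset[of "{x. \<phi> x \<noteq> 0}"] by auto
qed

lemma test_function_derivative_square_integrable:
  assumes "test_function \<phi>" "e \<in> Basis"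
  shows "square_integrable (\<lambda>x. frechet_derivative \<phi> (at x) e)"
proof (rule square_integrable_continuous)
  have "Ck (Suc 0) \<phi>" using assms(1) test_function_def by blast
  then show "continuous_on UNIV (\<lambda>x. frechet_derivative \<phi> (at x) e)" using assms(2) by simp
  show "compact (closure {x. \<phi> x \<noteq> 0})" using assms(1) by (simp add: test_function_def)
  show "frechet_derivative \<phi> (at x) e = 0" if "x \<notin> closure {x. \<phi> x \<noteq> 0}" for x
  proof -
    have "frechet_derivative (\<lambda>x. 0 :: real) (at x) = frechet_derivative \<phi> (at x)"
    proof (rule frechet_derivative_transform_within_open)
      show "open (- closure {x. \<phi> x \<noteq> 0})" by (rule open_Compl[OF closed_closure])
      show "0 = \<phi> y" if "y \<in> - closure {x. \<phi> x \<noteq> 0}" for y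
        using that closure_subset[of "{x. \<phi> x \<noteq> 0}"] by auto
    qed (use that in auto)
    then show ?thesis by (metis frechet_derivative_const)
  qed
qed

lemma weak_gradient_add:
  assumes "square_integrable u" "square_integrable v" "square_integrable g" "square_integrable h"
    and "weak_gradient u g" "weak_gradient v h"
  shows "weak_gradient (\<lambda>x. u x + v x) (\<lambda>x. g x + h x)"
  unfolding weak_gradient_def
proof (intro allI impI ballI)
  fix \<phi> :: "'a \<Rightarrow> real" and e :: 'a
  assume \<phi>: "test_function \<phi>" and e: "e \<in> Basis"
  note d = test_function_derivative_square_integrable[OF \<phi> e]
  note s = test_function_square_integrable[OF \<phi>]
  have i: "integrable lborel (\<lambda>x. u x * frechet_derivative \<phi> (at x) e)"
    "integrable lborel (\<lambda>x. v x * frechet_derivative \<phi> (at x) e)"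
    "integrable lborel (\<lambda>x. (g x \<bullet> e) * \<phi> x)" "integrable lborel (\<lambda>x. (h x \<bullet> e) * \<phi> x)"
    by (intro square_integrable_mult square_integrable_component assms d s e)+
  show "(LINT x|lborel. (u x + v x) * frechet_derivative \<phi> (at x) e) =
     - (LINT x|lborel. ((g x + h x) \<bullet> e) * \<phi> x)"
    using assms(5,6) \<phi> e i by (simp add: weak_gradient_def inner_add_left distrib_right)
qed

lemma weak_gradient_scaleR:
  assumes "weak_gradient u g"
  shows "weak_gradient (\<lambda>x. c * u x) (\<lambda>x. c *\<^sub>R g x)"
  using assms by (simp add: weak_gradient_def mult.assoc)

lemma weak_gradient_zero: "weak_gradient (\<lambda>x. 0) (\<lambda>x. 0)"
  by (simp add: weak_gradient_def)

lemma weak_gradient_cong_AE: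
  assumes "AE x in lborel. u x = v x" "u \<in> borel_measurable lborel" "v \<in> borel_measurable lborel"
    and "weak_gradient u g"
  shows "weak_gradient v g"
  unfolding weak_gradient_def
proof (intro allI impI ballI)
  fix \<phi> :: "'a \<Rightarrow> real" and e :: 'a
  assume \<phi>: "test_function \<phi>" and e: "e \<in> Basis"
  note [measurable] = assms(2,3) test_function_derivative_square_integrable[OF \<phi> e]
  have "(LINT x|lborel. u x * frechet_derivative \<phi> (at x) e) =
    (LINT x|lborel. v x * frechet_derivative \<phi> (at x) e)"
    by (rule integral_cong_AE) (use assms(1) in \<open>auto\<close>)
  then show "(LINT x|lborel. v x * frechet_derivative \<phi> (at x) e) = - (LINT x|lborel. (g x \<bullet> e) * \<phi> x)"
    using assms(4) \<phi> e by (simp add: weak_gradient_def)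
qed

text \<open>The fundamental lemma of the calculus of variations, which makes weak gradients unique.\<close>

lemma square_integrable_box:
  fixes g :: "'a::euclidean_space \<Rightarrow> real"
  assumes "square_integrable g"
  shows "integrable lborel (\<lambda>x. indicator (box a b) x * g x)"
proof -
  have "square_integrable (indicator (box a b) :: 'a \<Rightarrow> real)"
    by (auto simp: square_integrable_def power2_eq_square emeasure_lborel_box_eq
        simp flip: indicator_inter_arith intro!: integrable_real_indicator)
  then show ?thesis using square_integrable_mult assms by blast
qed

lemma fundamental_lemma:
  fixes g :: "'a::euclidean_space \<Rightarrow> real"
  assumes g: "square_integrable g"
    and z: "\<And>\<phi>. test_function \<phi> \<Longrightarrow> (LINT x|lborel. g x * \<phi> x) = 0"
  shows "AE x in lborel. g x = 0"
proof -
  note [measurable] = g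
  have box0: "(LINT x|lborel. indicator (box a b) x * g x) = 0" for a b
  proof -
    have "(\<lambda>k. LINT x|lborel. g x * box_bump a b k x) \<longlonglongrightarrow> (LINT x|lborel. indicator (box a b) x * g x)"
    proof (rule integral_dominated_convergence)
      show "integrable lborel (\<lambda>x. \<bar>indicator (box a b) x * g x\<bar>)"
        using square_integrable_box[OF g] by (intro integrable_abs)
      show "AE x in lborel. (\<lambda>k. g x * box_bump a b k x) \<longlonglongrightarrow> indicator (box a b) x * g x"
        by (subst mult.commute[of "indicator _ _"])
          (intro AE_I2 tendsto_mult tendsto_const box_bump_tendsto)
      show "AE x in lborel. norm (g x * box_bump a b k x) \<le> \<bar>indicator (box a b) x * g x\<bar>" for k
      proof (rule AE_I2)
        fix x show "norm (g x * box_bump a b k x) \<le> \<bar>indicator (box a b) x * g x\<bar>"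
          using box_bump_bounds[of a b k x] mult_left_mono[of "box_bump a b k x" 1 "\<bar>g x\<bar>"]
          by (cases "x \<in> box a b") (auto simp: box_bump_outside abs_mult)
      qed
      have "square_integrable (box_bump a b k)" for k
        by (intro test_function_square_integrable test_function_box_bump)
      then show "(\<lambda>x. g x * box_bump a b k x) \<in> borel_measurable lborel" for k by measurable
    qed measurable
    then show ?thesis
      using z[OF test_function_box_bump] by (simp add: LIMSEQ_const_iff)
  qed
  define B where "B n = box (- real n *\<^sub>R (One::'a)) (real n *\<^sub>R One)" for n :: nat
  have "AE x in lborel. indicator (B n) x * g x = 0" for n
  proof (rule density_unique_real)
    show int: "integrable lborel (\<lambda>x. indicator (B n) x * g x)"
      unfolding B_def by (rule square_integrable_box[OF g])
    show "integrable lborel (\<lambda>x. 0 :: real)" by simp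
    fix A :: "'a set" assume "A \<in> sets lborel"
    then have A: "A \<in> sigma_sets UNIV (range (\<lambda>(a, b). box a b))"
      by (simp add: borel_eq_box)
    have sub: "range (\<lambda>(a, b). box a b :: 'a set) \<subseteq> Pow UNIV" by simp
    have "Int_stable (range (\<lambda>(a, b). box a b :: 'a set))"
      by (auto simp: Int_stable_def box_Int_box)
    then have "(LINT x:A|lborel. indicator (B n) x * g x) = 0"
      using sub A
    proof (induction rule: sigma_sets_induct_disjoint)
      case (basic A)
      then obtain a b where A: "A = box a b" by auto
      obtain c d where cd: "A \<inter> B n = box c d" unfolding A B_def box_Int_box by blast
      have "(LINT x:A|lborel. indicator (B n) x * g x) = (LINT x|lborel. indicator (A \<inter> B n) x * g x)"
        by (simp add: set_lebesgue_integral_def indicator_inter_arith mult.assoc)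
      then show ?case using box0 cd by simp
    next
      case empty then show ?case by (simp add: set_lebesgue_integral_def)
    next
      case (compl A)
      then have [measurable]: "A \<in> sets borel" by (simp add: borel_eq_box)
      have si: "set_integrable lborel A' (\<lambda>x. indicator (B n) x * g x)" if "A' \<in> sets borel" for A'
        unfolding set_integrable_def using that int by (intro integrable_mult_indicator) auto
      have "(LINT x:A \<union> (UNIV - A)|lborel. indicator (B n) x * g x) =
        (LINT x:A|lborel. indicator (B n) x * g x) + (LINT x:UNIV - A|lborel. indicator (B n) x * g x)"
        by (intro set_integral_Un si) auto
      moreover have "(LINT x:A \<union> (UNIV - A)|lborel. indicator (B n) x * g x) = 0"
        using box0 by (simp add: B_def set_lebesgue_integral_def)
      ultimately show ?case using compl by simp
    next
      case (union F)
      then have F [measurable]: "F i \<in> sets borel" for i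
        by (auto simp: borel_eq_box)
      have "(LINT x:(\<Union>i. F i)|lborel. indicator (B n) x * g x) =
        (\<Sum>i. LINT x:F i|lborel. indicator (B n) x * g x)"
      proof (rule lebesgue_integral_countable_add)
        show "set_integrable lborel (\<Union>i. F i) (\<lambda>x. indicator (B n) x * g x)"
          unfolding set_integrable_def using int by (intro integrable_mult_indicator) auto
      qed (use union in \<open>auto simp: disjoint_family_on_def\<close>)
      then show ?case using union by simp
    qed
    then show "(LINT x:A|lborel. indicator (B n) x * g x) = (LINT x:A|lborel. 0)"
      by (simp add: set_lebesgue_integral_def)
  qed
  then have "AE x in lborel. \<forall>n. indicator (B n) x * g x = 0"
    unfolding AE_all_countable by blast
  then show ?thesis
  proof (rule AE_mp, intro AE_I2 impI)
    fix x assume *: "\<forall>n. indicator (B n) x * g x = 0"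
    obtain n where n: "norm x < real n" using reals_Archimedean2 by blast
    have "x \<in> B n"
      unfolding B_def mem_box
    proof (intro ballI)
      fix i :: 'a assume "i \<in> Basis"
      then show "(- real n *\<^sub>R One) \<bullet> i < x \<bullet> i \<and> x \<bullet> i < (real n *\<^sub>R One) \<bullet> i"
        using Basis_le_norm[of i x] n by (simp add: abs_le_iff)
    qed
    then show "g x = 0" using *[rule_format, of n] by simp
  qed
qed

lemma weak_gradient_unique:
  fixes g h :: "'a::euclidean_space \<Rightarrow> 'a"
  assumes "weak_gradient u g" "weak_gradient u h" "square_integrable g" "square_integrable h"
  shows "AE x in lborel. g x = h x"
proof -
  have "AE x in lborel. g x \<bullet> e + - 1 *\<^sub>R (h x \<bullet> e) = 0" if e: "e \<in> Basis" for e
  proof (rule fundamental_lemma)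
    show "square_integrable (\<lambda>x. g x \<bullet> e + - 1 *\<^sub>R (h x \<bullet> e))"
      by (intro square_integrable_add square_integrable_scaleR square_integrable_component assms e)
    fix \<phi> :: "'a \<Rightarrow> real" assume \<phi>: "test_function \<phi>"
    note s = test_function_square_integrable[OF \<phi>]
    have i: "integrable lborel (\<lambda>x. (g x \<bullet> e) * \<phi> x)" "integrable lborel (\<lambda>x. (h x \<bullet> e) * \<phi> x)"
      by (intro square_integrable_mult square_integrable_component assms s e)+
    have "(LINT x|lborel. (g x \<bullet> e) * \<phi> x) = (LINT x|lborel. (h x \<bullet> e) * \<phi> x)"
      using assms(1,2) \<phi> e unfolding weak_gradient_def by force
    then show "(LINT x|lborel. (g x \<bullet> e + - 1 *\<^sub>R (h x \<bullet> e)) * \<phi> x) = 0"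
      using i by (simp add: left_diff_distrib)
  qed
  then have "AE x in lborel. \<forall>e\<in>Basis. g x \<bullet> e + - 1 *\<^sub>R (h x \<bullet> e) = 0"
    by (intro AE_finite_allI) auto
  then show ?thesis
  proof eventually_elim
    fix x assume "\<forall>e\<in>Basis. g x \<bullet> e + - 1 *\<^sub>R (h x \<bullet> e) = 0"
    then show "g x = h x" by (intro euclidean_eqI[of "g x"]) simp
  qed
qed

section \<open>The Sobolev space H1\<close>

definition H1_function :: "('a::euclidean_space \<Rightarrow> real) \<Rightarrow> bool" where
  "H1_function u \<longleftrightarrow> square_integrable u \<and> (\<exists>g. square_integrable g \<and> weak_gradient u g)"

definition H1_rel :: "('a::euclidean_space \<Rightarrow> real) \<Rightarrow> ('a \<Rightarrow> real) \<Rightarrow> bool" where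
  "H1_rel u v \<longleftrightarrow> H1_function u \<and> H1_function v \<and> (AE x in lborel. u x = v x)"

lemma H1_function_zero: "H1_function (\<lambda>x. 0)"
  unfolding H1_function_def
  by (intro conjI exI[of _ "\<lambda>x. 0"] square_integrable_zero weak_gradient_zero)

lemma H1_function_add: "H1_function u \<Longrightarrow> H1_function v \<Longrightarrow> H1_function (\<lambda>x. u x + v x)"
proof -
  assume "H1_function u" "H1_function v"
  then obtain g h where "square_integrable u" "square_integrable g" "weak_gradient u g"
      "square_integrable v" "square_integrable h" "weak_gradient v h"
    by (auto simp: H1_function_def)
  then show "H1_function (\<lambda>x. u x + v x)"
    unfolding H1_function_def
    by (intro conjI exI[of _ "\<lambda>x. g x + h x"] square_integrable_add weak_gradient_add)
qed

lemma H1_function_scaleR: "H1_function u \<Longrightarrow> H1_function (\<lambda>x. c * u x)"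
proof -
  assume "H1_function u"
  then obtain g where g: "square_integrable u" "square_integrable g" "weak_gradient u g"
    by (auto simp: H1_function_def)
  have "square_integrable (\<lambda>x. c * u x)"
    using square_integrable_scaleR[OF g(1), of c] by simp
  then show "H1_function (\<lambda>x. c * u x)"
    unfolding H1_function_def
    using square_integrable_scaleR[OF g(2)] weak_gradient_scaleR[OF g(3)] by blast
qed

lemma part_equivp_H1_rel: "part_equivp (H1_rel :: ('a::euclidean_space \<Rightarrow> real) \<Rightarrow> _)"
proof (rule part_equivpI)
  show "\<exists>u :: 'a \<Rightarrow> real. H1_rel u u"
    using H1_function_zero unfolding H1_rel_def by (intro exI[of _ "\<lambda>x. 0"]) simp
  show "symp (H1_rel :: ('a \<Rightarrow> real) \<Rightarrow> _)" by (auto simp: symp_def H1_rel_def eq_commute)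
  show "transp (H1_rel :: ('a \<Rightarrow> real) \<Rightarrow> _)"
  proof (rule transpI)
    fix u v w :: "'a \<Rightarrow> real"
    assume *: "H1_rel u v" "H1_rel v w"
    then have "AE x in lborel. u x = v x" "AE x in lborel. v x = w x"
      by (auto simp: H1_rel_def)
    then have "AE x in lborel. u x = w x" by eventually_elim simp
    with * show "H1_rel u w" by (simp add: H1_rel_def)
  qed
qed

quotient_type (overloaded) 'a H1 = "'a::euclidean_space \<Rightarrow> real" / partial: H1_rel
  morphisms fun_of_H1 H1_of_fun
  by (rule part_equivp_H1_rel)

lemma H1_function_fun_of_H1: "H1_function (fun_of_H1 u)"
  using Quotient3_rep_reflp[OF Quotient3_H1] by (auto simp: H1_rel_def)

lemma H1_eq_iff: "u = v \<longleftrightarrow> (AE x in lborel. fun_of_H1 u x = fun_of_H1 v x)"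
  using Quotient3_rel_rep[OF Quotient3_H1, of u v] H1_function_fun_of_H1
  by (auto simp: H1_rel_def)

lemma fun_of_H1_of_fun:
  "H1_function u \<Longrightarrow> AE x in lborel. fun_of_H1 (H1_of_fun u) x = u x"
  using Quotient3_rep_abs[OF Quotient3_H1, of u] by (auto simp: H1_rel_def)

text \<open>Weak gradients are unique only up to null sets; this picks a representative.\<close>

definition grad_H1 :: "'a::euclidean_space H1 \<Rightarrow> 'a \<Rightarrow> 'a" where
  "grad_H1 u = (SOME g. square_integrable g \<and> weak_gradient (fun_of_H1 u) g)"

lemma square_integrable_fun_of_H1: "square_integrable (fun_of_H1 u)"
  using H1_function_fun_of_H1 by (auto simp: H1_function_def)

lemma grad_H1: "square_integrable (grad_H1 u)" "weak_gradient (fun_of_H1 u) (grad_H1 u)"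
  using someI_ex[of "\<lambda>g. square_integrable g \<and> weak_gradient (fun_of_H1 u) g"]
    H1_function_fun_of_H1[of u]
  by (auto simp: H1_function_def grad_H1_def)

lemma grad_H1_unique:
  assumes "AE x in lborel. fun_of_H1 u x = v x" "square_integrable v" "square_integrable g"
    and "weak_gradient v g"
  shows "AE x in lborel. grad_H1 u x = g x"
proof (rule weak_gradient_unique)
  show "weak_gradient v (grad_H1 u)"
  proof (rule weak_gradient_cong_AE[OF assms(1)])
    show "fun_of_H1 u \<in> borel_measurable lborel"
      using square_integrable_fun_of_H1[of u] by (simp add: square_integrable_def)
    show "v \<in> borel_measurable lborel" using assms(2) by (simp add: square_integrable_def)
  qed (rule grad_H1(2))
qed (rule assms grad_H1(1))+

instantiation H1 :: (euclidean_space) real_vector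
begin

definition zero_H1 :: "'a H1" where "zero_H1 = H1_of_fun (\<lambda>x. 0)"

definition plus_H1 :: "'a H1 \<Rightarrow> 'a H1 \<Rightarrow> 'a H1" where
  "plus_H1 u v = H1_of_fun (\<lambda>x. fun_of_H1 u x + fun_of_H1 v x)"

definition scaleR_H1 :: "real \<Rightarrow> 'a H1 \<Rightarrow> 'a H1" where
  "scaleR_H1 c u = H1_of_fun (\<lambda>x. c * fun_of_H1 u x)"

definition uminus_H1 :: "'a H1 \<Rightarrow> 'a H1" where "uminus_H1 u = (- 1) *\<^sub>R u"

definition minus_H1 :: "'a H1 \<Rightarrow> 'a H1 \<Rightarrow> 'a H1" where "minus_H1 u v = u + (- v)"

lemma fun_of_H1_zero: "AE x in lborel. fun_of_H1 (0 :: 'a H1) x = 0"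
  unfolding zero_H1_def by (rule fun_of_H1_of_fun[OF H1_function_zero])

lemma fun_of_H1_add:
  "AE x in lborel. fun_of_H1 (u + v :: 'a H1) x = fun_of_H1 u x + fun_of_H1 v x"
  unfolding plus_H1_def
  by (intro fun_of_H1_of_fun H1_function_add H1_function_fun_of_H1)

lemma fun_of_H1_scaleR: "AE x in lborel. fun_of_H1 (c *\<^sub>R u :: 'a H1) x = c * fun_of_H1 u x"
  unfolding scaleR_H1_def
  by (intro fun_of_H1_of_fun H1_function_scaleR H1_function_fun_of_H1)

instance
proof
  fix u v w :: "'a H1" and c d :: real
  show "u + v + w = u + (v + w)"
    unfolding H1_eq_iff using fun_of_H1_add[of "u + v" w] fun_of_H1_add[of u v]
      fun_of_H1_add[of u "v + w"] fun_of_H1_add[of v w]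
    by eventually_elim simp
  show "u + v = v + u"
    unfolding H1_eq_iff using fun_of_H1_add[of u v] fun_of_H1_add[of v u]
    by eventually_elim simp
  show "0 + u = u"
    unfolding H1_eq_iff using fun_of_H1_add[of 0 u] fun_of_H1_zero
    by eventually_elim simp
  show "- u + u = 0"
    unfolding H1_eq_iff uminus_H1_def
    using fun_of_H1_add[of "(- 1) *\<^sub>R u" u] fun_of_H1_scaleR[of "- 1" u] fun_of_H1_zero
    by eventually_elim simp
  show "u - v = u + - v" by (simp add: minus_H1_def)
  show "c *\<^sub>R (u + v) = c *\<^sub>R u + c *\<^sub>R v"
    unfolding H1_eq_iff using fun_of_H1_add[of "c *\<^sub>R u" "c *\<^sub>R v"] fun_of_H1_add[of u v]
      fun_of_H1_scaleR[of c u] fun_of_H1_scaleR[of c v] fun_of_H1_scaleR[of c "u + v"]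
    by eventually_elim (simp add: distrib_left)
  show "(c + d) *\<^sub>R u = c *\<^sub>R u + d *\<^sub>R u"
    unfolding H1_eq_iff using fun_of_H1_add[of "c *\<^sub>R u" "d *\<^sub>R u"]
      fun_of_H1_scaleR[of c u] fun_of_H1_scaleR[of d u] fun_of_H1_scaleR[of "c + d" u]
    by eventually_elim (simp add: distrib_right)
  show "c *\<^sub>R d *\<^sub>R u = (c * d) *\<^sub>R u"
    unfolding H1_eq_iff using fun_of_H1_scaleR[of c "d *\<^sub>R u"]
      fun_of_H1_scaleR[of d u] fun_of_H1_scaleR[of "c * d" u]
    by eventually_elim simp
  show "1 *\<^sub>R u = u"
    unfolding H1_eq_iff using fun_of_H1_scaleR[of 1 u]
    by eventually_elim simp
qed

end

lemma grad_H1_zero: "AE x in lborel. grad_H1 0 x = 0"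
  by (rule grad_H1_unique[OF fun_of_H1_zero square_integrable_zero square_integrable_zero
        weak_gradient_zero])

lemma grad_H1_add: "AE x in lborel. grad_H1 (u + v) x = grad_H1 u x + grad_H1 v x"
  by (rule grad_H1_unique[OF fun_of_H1_add])
    (intro square_integrable_add weak_gradient_add grad_H1 square_integrable_fun_of_H1)+

lemma grad_H1_scaleR: "AE x in lborel. grad_H1 (c *\<^sub>R u) x = c *\<^sub>R grad_H1 u x"
proof (rule grad_H1_unique[OF fun_of_H1_scaleR])
  show "square_integrable (\<lambda>x. c * fun_of_H1 u x)"
    using square_integrable_scaleR[OF square_integrable_fun_of_H1] by simp
qed (intro square_integrable_scaleR weak_gradient_scaleR grad_H1)+

instantiation H1 :: (euclidean_space) real_inner
begin

definition inner_H1 :: "'a H1 \<Rightarrow> 'a H1 \<Rightarrow> real" where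
  "inner_H1 u v = (LINT x|lborel. grad_H1 u x \<bullet> grad_H1 v x + fun_of_H1 u x * fun_of_H1 v x)"

definition norm_H1 :: "'a H1 \<Rightarrow> real" where "norm_H1 u = sqrt (u \<bullet> u)"

definition sgn_H1 :: "'a H1 \<Rightarrow> 'a H1" where "sgn_H1 u = u /\<^sub>R norm u"

definition dist_H1 :: "'a H1 \<Rightarrow> 'a H1 \<Rightarrow> real" where "dist_H1 u v = norm (u - v)"

definition uniformity_H1 :: "('a H1 \<times> 'a H1) filter" where
  "uniformity_H1 = (INF e\<in>{0 <..}. principal {(x, y). dist x y < e})"

definition open_H1 :: "'a H1 set \<Rightarrow> bool" where
  "open_H1 U \<longleftrightarrow> (\<forall>x\<in>U. eventually (\<lambda>(x', y). x' = x \<longrightarrow> y \<in> U) uniformity)"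

instance
proof
  fix u v w :: "'a H1" and c :: real and U :: "'a H1 set"
  have int: "integrable lborel (\<lambda>x. grad_H1 u x \<bullet> grad_H1 v x + fun_of_H1 u x * fun_of_H1 v x)"
    for u v :: "'a H1"
    by (intro Bochner_Integration.integrable_add square_integrable_inner square_integrable_mult
        grad_H1 square_integrable_fun_of_H1)
  have [measurable]: "fun_of_H1 u \<in> borel_measurable borel" "grad_H1 u \<in> borel_measurable borel"
    for u :: "'a H1"
    using grad_H1(1) square_integrable_fun_of_H1 square_integrable_measurable by blast+
  show "dist u v = norm (u - v)" by (rule dist_H1_def)
  show "sgn u = u /\<^sub>R norm u" by (rule sgn_H1_def)
  show "(uniformity :: ('a H1 \<times> 'a H1) filter) = (INF e\<in>{0 <..}. principal {(x, y). dist x y < e})"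
    by (rule uniformity_H1_def)
  show "open U \<longleftrightarrow> (\<forall>x\<in>U. eventually (\<lambda>(x', y). x' = x \<longrightarrow> y \<in> U) uniformity)"
    by (rule open_H1_def)
  show "u \<bullet> v = v \<bullet> u" by (simp add: inner_H1_def inner_commute mult.commute)
  show "(u + v) \<bullet> w = u \<bullet> w + v \<bullet> w"
  proof -
    have "(u + v) \<bullet> w = (LINT x|lborel.
        (grad_H1 u x \<bullet> grad_H1 w x + fun_of_H1 u x * fun_of_H1 w x) +
        (grad_H1 v x \<bullet> grad_H1 w x + fun_of_H1 v x * fun_of_H1 w x))"
      unfolding inner_H1_def
    proof (rule integral_cong_AE)
      show "AE x in lborel. grad_H1 (u + v) x \<bullet> grad_H1 w x + fun_of_H1 (u + v) x * fun_of_H1 w x =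
         (grad_H1 u x \<bullet> grad_H1 w x + fun_of_H1 u x * fun_of_H1 w x) +
         (grad_H1 v x \<bullet> grad_H1 w x + fun_of_H1 v x * fun_of_H1 w x)"
        using grad_H1_add[of u v] fun_of_H1_add[of u v]
        by eventually_elim (simp add: inner_add_left algebra_simps)
    qed measurable
    also have "\<dots> = u \<bullet> w + v \<bullet> w"
      unfolding inner_H1_def by (rule Bochner_Integration.integral_add[OF int int])
    finally show ?thesis .
  qed
  show "(c *\<^sub>R u) \<bullet> v = c * (u \<bullet> v)"
  proof -
    have "(c *\<^sub>R u) \<bullet> v =
      (LINT x|lborel. c * (grad_H1 u x \<bullet> grad_H1 v x + fun_of_H1 u x * fun_of_H1 v x))"
      unfolding inner_H1_def
    proof (rule integral_cong_AE)
      show "AE x in lborel. grad_H1 (c *\<^sub>R u) x \<bullet> grad_H1 v x + fun_of_H1 (c *\<^sub>R u) x * fun_of_H1 v x =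
         c * (grad_H1 u x \<bullet> grad_H1 v x + fun_of_H1 u x * fun_of_H1 v x)"
        using grad_H1_scaleR[of c u] fun_of_H1_scaleR[of c u]
        by eventually_elim (simp add: algebra_simps)
    qed measurable
    then show ?thesis by (simp add: inner_H1_def)
  qed
  show nonneg: "0 \<le> u \<bullet> u"
    unfolding inner_H1_def by (intro integral_nonneg_AE AE_I2) simp
  show "u \<bullet> u = 0 \<longleftrightarrow> u = 0"
  proof
    assume "u \<bullet> u = 0"
    then have "AE x in lborel. grad_H1 u x \<bullet> grad_H1 u x + fun_of_H1 u x * fun_of_H1 u x = 0"
      using integral_nonneg_eq_0_iff_AE[OF int[of u u]] by (simp add: inner_H1_def)
    then have "AE x in lborel. fun_of_H1 u x = fun_of_H1 0 x"
      using fun_of_H1_zero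
    proof eventually_elim
      fix x assume *: "grad_H1 u x \<bullet> grad_H1 u x + fun_of_H1 u x * fun_of_H1 u x = 0"
        "fun_of_H1 (0 :: 'a H1) x = 0"
      then show "fun_of_H1 u x = fun_of_H1 0 x"
        using inner_ge_zero[of "grad_H1 u x"] zero_le_square[of "fun_of_H1 u x"]
        by (smt (verit) mult_eq_0_iff)
    qed
    then show "u = 0" by (simp add: H1_eq_iff)
  next
    assume u: "u = 0"
    have "u \<bullet> u = (LINT x|(lborel :: 'a measure). 0)"
      unfolding inner_H1_def u
    proof (rule integral_cong_AE)
      show "AE x in lborel. grad_H1 (0 :: 'a H1) x \<bullet> grad_H1 0 x + fun_of_H1 0 x * fun_of_H1 0 x = 0"
        using grad_H1_zero fun_of_H1_zero by eventually_elim simp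
    qed measurable
    then show "u \<bullet> u = 0" by simp
  qed
  show "norm u = sqrt (u \<bullet> u)" by (rule norm_H1_def)
qed

end

section \<open>The Schroedinger system\<close>

text \<open>
  The components of a vector state are indexed by a finite linear order \<open>'d\<close>, which plays the role
  of the index set \<open>{1, \<dots>, d}\<close>. The diagonal of the coupling matrix \<open>b\<close> is irrelevant.
  In dimension at most 3 the Sobolev embedding into \<open>L\<^sup>4\<close> makes all integrals in \<open>energy\<close> finite,
  so the default value 0 of the Bochner integral does not occur.
\<close>

definition energy ::
  "('d \<Rightarrow> real) \<Rightarrow> ('d \<Rightarrow> real) \<Rightarrow> ('d \<Rightarrow> 'd \<Rightarrow> real) \<Rightarrow>
    ('a::euclidean_space H1, 'd::{finite,linorder}) vec \<Rightarrow> real" where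
  "energy lam \<mu> b u =
     1/2 * (\<Sum>i\<in>UNIV. LINT x|lborel. (norm (grad_H1 (u $ i) x))\<^sup>2 + lam i * (fun_of_H1 (u $ i) x)\<^sup>2)
   - 1/4 * (\<Sum>i\<in>UNIV. \<mu> i * (LINT x|lborel. (fun_of_H1 (u $ i) x) ^ 4))
   - 1/2 * (\<Sum>i\<in>UNIV. \<Sum>j\<in>{i<..}. b i j *
       (LINT x|lborel. (fun_of_H1 (u $ i) x)\<^sup>2 * (fun_of_H1 (u $ j) x)\<^sup>2))"

text \<open>Nonzero critical points: the Frechet derivative of the energy vanishes.\<close>

definition nontrivial_solutions ::
  "('d \<Rightarrow> real) \<Rightarrow> ('d \<Rightarrow> real) \<Rightarrow> ('d \<Rightarrow> 'd \<Rightarrow> real) \<Rightarrow>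
    ('a::euclidean_space H1, 'd::{finite,linorder}) vec set" where
  "nontrivial_solutions lam \<mu> b =
     {u. u \<noteq> 0 \<and> (energy lam \<mu> b has_derivative (\<lambda>h. 0)) (at u)}"

text \<open>
  By the critical point equation the energy of a solution is a quarter of its quadratic part, so
  the infimum is over a set bounded below by 0. For an empty set of solutions the value of
  \<open>ground_state_level\<close> is unspecified, but then \<open>ground_states\<close> is empty as well.
\<close>

definition ground_state_level ::
  "('a::euclidean_space) itself \<Rightarrow> ('d::{finite,linorder} \<Rightarrow> real) \<Rightarrow> ('d \<Rightarrow> real) \<Rightarrow>
    ('d \<Rightarrow> 'd \<Rightarrow> real) \<Rightarrow> real" where
  "ground_state_level _ lam \<mu> b =
     Inf (energy lam \<mu> b ` (nontrivial_solutions lam \<mu> b :: ('a H1, 'd) vec set))"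

definition ground_states ::
  "('d \<Rightarrow> real) \<Rightarrow> ('d \<Rightarrow> real) \<Rightarrow> ('d \<Rightarrow> 'd \<Rightarrow> real) \<Rightarrow>
    ('a::euclidean_space H1, 'd::{finite,linorder}) vec set" where
  "ground_states lam \<mu> b =
     {u \<in> nontrivial_solutions lam \<mu> b. energy lam \<mu> b u = ground_state_level TYPE('a) lam \<mu> b}"

definition fully_nontrivial_ground_states ::
  "('d \<Rightarrow> real) \<Rightarrow> ('d \<Rightarrow> real) \<Rightarrow> ('d \<Rightarrow> 'd \<Rightarrow> real) \<Rightarrow>
    ('a::euclidean_space H1, 'd::{finite,linorder}) vec set" where
  "fully_nontrivial_ground_states lam \<mu> b = {u \<in> ground_states lam \<mu> b. \<forall>i. u $ i \<noteq> 0}"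

end

theory Submission
  imports Defs "HOL-Library.Diagonal_Subsequence"
begin

text \<open>
  Write \<open>B u\<close> and \<open>Q u\<close> for the quadratic and the quartic part of the energy, so that the energy is
  \<open>B/2 - Q/4\<close> and solutions satisfy \<open>B u = Q u\<close>. Let \<open>S\<close> be the supremum of \<open>Q\<close> on \<open>B = 1\<close>. There is a
  nonzero solution of energy at most \<open>1/(4 S)\<close>: a maximizing sequence is almost critical, it can be
  translated so that it does not vanish in the limit, and its weak limit, suitably scaled, is such a
  solution. Hence a ground state maximizes \<open>Q\<close> among the states with the same \<open>B\<close>. But if the components
  \<open>p\<close> and \<open>q\<close> of \<open>u\<close> are nonzero and \<open>b < sqrt (\<mu> p * \<mu> q)\<close>, then transferring mass between these two
  components changes \<open>Q\<close> in a strictly convex way, so \<open>u\<close> is not a maximizer. With \<open>p\<close> and \<open>q\<close> the first and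
  the last index, this covers the assumption on \<open>b\<close>, because the factor \<open>2 powr (1 - d/2)\<close> is at most 1.

  The Sobolev embedding and the compactness are obtained from averages over cubes of side \<open>l\<close>. The
  \<open>L2\<close> error of the average is of order \<open>l\<close> times the norm of the gradient, the supremum of the average of
  \<open>f\<close> is at most \<open>l powr (- N/2)\<close> times the \<open>L2\<close> norm of \<open>f\<close>, and summing the differences of the averages at the
  scales \<open>l / 16 ^ n\<close> gives an \<open>L4\<close> error of order \<open>l powr (1 - N/4)\<close>.
\<close>

text \<open>The obstacle is the translation invariance of the whole space: a maximizing sequence may
  still lose part of its mass at infinity after it has been translated, so strong convergence is not
  at hand. The equation contains the sequence only through \<open>M v v v h\<close> with a fixed
  \<open>h\<close>. Averages over a cube are bounded linear functionals, so they converge pointwise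
  along a weakly convergent sequence, and the fixed \<open>h\<close> supplies the decay at infinity;
  hence the equation passes to the weak limit. The energy of a solution is a quarter of its
  quadratic part, which can only drop in the limit, so the energy bound passes too.

  The number \<open>1/(4 S)\<close> is the least energy that a nonzero solution can have:
  \<open>B u = Q u\<close> and \<open>Q u \<le> S * (B u)^2\<close> give
  \<open>B u \<ge> 1/S\<close>. The strictly convex transfer of mass contradicts the equality case
  of this estimate.

  The scales differ by the factor 16 because each addition of fourth powers costs a factor 8, which
  the gain of \<open>l\<close> in the increments has to outweigh.\<close>

section \<open>Changes of variables, averages and L2 bounds for Lebesgue integrals\<close>

lemma nn_integral_lborel_translate:
  fixes f :: "'a::euclidean_space \<Rightarrow> ennreal"
  assumes [measurable]: "f \<in> borel_measurable borel"
  shows "(\<integral>\<^sup>+x. f (x + y) \<partial>lborel) = (\<integral>\<^sup>+x. f x \<partial>lborel)"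
proof -
  have "(\<integral>\<^sup>+x. f x \<partial>lborel) = (\<integral>\<^sup>+x. f x \<partial>distr lborel borel ((+) y))"
    by (simp only: lborel_distr_plus)
  also have "\<dots> = (\<integral>\<^sup>+x. f (y + x) \<partial>lborel)"
    by (rule nn_integral_distr) simp_all
  finally show ?thesis by (simp add: add.commute)
qed

lemma integral_lborel_translate:
  fixes f :: "'a::euclidean_space \<Rightarrow> real"
  assumes [measurable]: "f \<in> borel_measurable borel"
  shows "(LINT x|lborel. f (x + y)) = (LINT x|lborel. f x)"
proof -
  have "(LINT x|lborel. f x) = (LINT x|distr lborel borel ((+) y). f x)"
    by (simp only: lborel_distr_plus)
  also have "\<dots> = (LINT x|lborel. f (y + x))"
    by (rule integral_distr) simp_all
  finally show ?thesis by (simp add: add.commute)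
qed

lemma nn_integral_lborel_scale:
  fixes f :: "'a::euclidean_space \<Rightarrow> ennreal"
  assumes [measurable]: "f \<in> borel_measurable borel" and "l > 0"
  shows "(\<integral>\<^sup>+x. f (y + l *\<^sub>R x) \<partial>lborel) = ennreal (1 / l ^ DIM('a)) * (\<integral>\<^sup>+x. f x \<partial>lborel)"
proof -
  have "(\<integral>\<^sup>+x. f x \<partial>lborel) =
      (\<integral>\<^sup>+x. f x \<partial>density (distr lborel borel (\<lambda>x. y + l *\<^sub>R x)) (\<lambda>_. \<bar>l\<bar> ^ DIM('a)))"
    using lborel_affine[of l y] assms(2) by simp
  also have "\<dots> = ennreal (l ^ DIM('a)) * (\<integral>\<^sup>+x. f (y + l *\<^sub>R x) \<partial>lborel)"
    using assms(2) by (simp add: nn_integral_density nn_integral_distr nn_integral_cmult ennreal_power)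
  finally show ?thesis
    using assms(2)
    by (simp add: mult.assoc[symmetric] ennreal_mult'[symmetric])
qed

text \<open>The variance is nonnegative; if the right-hand side is infinite, there is nothing to
  show.\<close>

lemma (in finite_measure) jensen_square:
  fixes f :: "'a \<Rightarrow> real"
  assumes [measurable]: "f \<in> borel_measurable M" and M1: "emeasure M (space M) = 1"
  shows "ennreal ((LINT x|M. f x)\<^sup>2) \<le> (\<integral>\<^sup>+x. ennreal ((f x)\<^sup>2) \<partial>M)"
proof (cases "(\<integral>\<^sup>+x. ennreal ((f x)\<^sup>2) \<partial>M) < \<infinity>")
  case False
  then show ?thesis by (simp add: less_top[symmetric])
next
  case True
  then have i2: "integrable M (\<lambda>x. (f x)\<^sup>2)" by (intro integrableI_bounded) auto
  have i1: "integrable M f" by (rule square_integrable_imp_integrable[OF _ i2]) simp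
  define m where "m = (LINT x|M. f x)"
  have "0 \<le> (LINT x|M. (f x - m)\<^sup>2)" by simp
  also have "\<dots> = (LINT x|M. (f x)\<^sup>2 - 2 * m * f x + m\<^sup>2)"
    by (simp add: power2_diff algebra_simps)
  also have "\<dots> = (LINT x|M. (f x)\<^sup>2) - 2 * m * m + m\<^sup>2 * measure M (space M)"
    using i1 i2 by (simp add: m_def)
  also have "measure M (space M) = 1" using M1 by (simp add: measure_def)
  finally have "m\<^sup>2 \<le> (LINT x|M. (f x)\<^sup>2)" by (simp add: power2_eq_square)
  then have "ennreal (m\<^sup>2) \<le> ennreal (LINT x|M. (f x)\<^sup>2)" by (rule ennreal_leI)
  also have "\<dots> = (\<integral>\<^sup>+x. ennreal ((f x)\<^sup>2) \<partial>M)"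
    using i2 by (simp add: nn_integral_eq_integral)
  finally show ?thesis by (simp add: m_def)
qed

text \<open>Jensen for each \<open>x\<close>, then Tonelli: an average of functions is no larger in
  L2 than the functions themselves. All L2 bounds for averages over segments and cubes come from
  here.\<close>

lemma nn_integral_square_average_le:
  fixes F :: "'a::euclidean_space \<Rightarrow> 'b \<Rightarrow> real"
  assumes "finite_measure M" and M1: "emeasure M (space M) = 1"
    and [measurable]: "case_prod F \<in> borel_measurable (borel \<Otimes>\<^sub>M M)"
    and K: "AE h in M. (\<integral>\<^sup>+x. ennreal ((F x h)\<^sup>2) \<partial>lborel) \<le> K"
  shows "(\<integral>\<^sup>+x. ennreal ((LINT h|M. F x h)\<^sup>2) \<partial>lborel) \<le> K"
proof -
  interpret M: finite_measure M by fact
  interpret P: pair_sigma_finite "lborel :: 'a measure" M ..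
  have m [measurable]: "case_prod F \<in> borel_measurable (lborel \<Otimes>\<^sub>M M)"
    using assms(3) by (simp cong: measurable_cong_sets sets_pair_measure_cong)
  have "(\<integral>\<^sup>+x. ennreal ((LINT h|M. F x h)\<^sup>2) \<partial>lborel) \<le> (\<integral>\<^sup>+x. (\<integral>\<^sup>+h. ennreal ((F x h)\<^sup>2) \<partial>M) \<partial>lborel)"
    by (intro nn_integral_mono M.jensen_square M1) measurable
  also have "\<dots> = (\<integral>\<^sup>+h. (\<integral>\<^sup>+x. ennreal ((F x h)\<^sup>2) \<partial>lborel) \<partial>M)"
    by (rule P.Fubini'[symmetric]) measurable
  also have "\<dots> \<le> (\<integral>\<^sup>+h. K \<partial>M)" by (rule nn_integral_mono_AE[OF K])
  also have "\<dots> = K" using M1 by simp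
  finally show ?thesis .
qed

text \<open>Fubini asks for joint integrability. As \<open>M\<close> is finite, a bound of the
  slices that is uniform in \<open>h\<close> suffices.\<close>

lemma integrable_pair_bounded:
  fixes F :: "'a \<Rightarrow> 'b \<Rightarrow> real"
  assumes "sigma_finite_measure L" and "finite_measure M"
    and m [measurable]: "case_prod F \<in> borel_measurable (L \<Otimes>\<^sub>M M)"
    and K: "AE h in M. (\<integral>\<^sup>+x. ennreal \<bar>F x h\<bar> \<partial>L) \<le> ennreal K"
  shows "integrable (L \<Otimes>\<^sub>M M) (case_prod F)"
proof (rule integrableI_bounded)
  interpret M: finite_measure M by fact
  interpret L: sigma_finite_measure L by fact
  interpret P: pair_sigma_finite L M ..
  have "(\<integral>\<^sup>+z. ennreal (norm (case_prod F z)) \<partial>(L \<Otimes>\<^sub>M M)) =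
    (\<integral>\<^sup>+h. (\<integral>\<^sup>+x. ennreal \<bar>F x h\<bar> \<partial>L) \<partial>M)"
    by (subst P.nn_integral_snd[symmetric]) (auto simp: split_beta' intro!: measurable_compose[OF m])
  also have "\<dots> \<le> (\<integral>\<^sup>+h. ennreal K \<partial>M)" by (rule nn_integral_mono_AE[OF K])
  also have "\<dots> < \<infinity>" by (simp add: ennreal_mult_less_top M.emeasure_eq_measure)
  finally show "(\<integral>\<^sup>+z. ennreal (norm (case_prod F z)) \<partial>(L \<Otimes>\<^sub>M M)) < \<infinity>" .
qed fact

abbreviation L2_bound :: "'a measure \<Rightarrow> ('a \<Rightarrow> real) \<Rightarrow> real \<Rightarrow> bool" where
  "L2_bound M f K \<equiv> (\<integral>\<^sup>+x. ennreal ((f x)\<^sup>2) \<partial>M) \<le> ennreal K"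

text \<open>Summing the squares under the integral turns fast L2 convergence into convergence almost
  everywhere, to which Fatou's lemma can then be applied.\<close>

lemma AE_summable_square:
  fixes f :: "nat \<Rightarrow> 'a \<Rightarrow> real"
  assumes [measurable]: "\<And>n. f n \<in> borel_measurable M"
    and K: "\<And>n. L2_bound M (f n) (K n)" "\<And>n. 0 \<le> K n" "summable K"
  shows "AE x in M. summable (\<lambda>n. (f n x)\<^sup>2)"
proof -
  have "(\<integral>\<^sup>+x. (\<Sum>n. ennreal ((f n x)\<^sup>2)) \<partial>M) = (\<Sum>n. \<integral>\<^sup>+x. ennreal ((f n x)\<^sup>2) \<partial>M)"
    by (rule nn_integral_suminf) measurable
  also have "\<dots> \<le> (\<Sum>n. ennreal (K n))" by (intro suminf_le K(1)) auto
  also have "\<dots> < \<infinity>" using K(2,3) by (simp add: suminf_ennreal2)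
  finally have "AE x in M. (\<Sum>n. ennreal ((f n x)\<^sup>2)) \<noteq> \<infinity>"
    by (intro nn_integral_noteq_infinite) auto
  then show ?thesis
    by eventually_elim (auto intro: summable_suminf_not_top)
qed

lemma nn_integral_square:
  fixes f :: "'a::euclidean_space \<Rightarrow> 'b::euclidean_space"
  assumes "square_integrable f"
  shows "(\<integral>\<^sup>+x. ennreal ((norm (f x))\<^sup>2) \<partial>lborel) = ennreal (LINT x|lborel. (norm (f x))\<^sup>2)"
  using assms by (intro nn_integral_eq_integral) (auto simp: square_integrable_def)

lemma nn_integral_square_real:
  fixes f :: "'a::euclidean_space \<Rightarrow> real"
  assumes "square_integrable f"
  shows "(\<integral>\<^sup>+x. ennreal ((f x)\<^sup>2) \<partial>lborel) = ennreal (LINT x|lborel. (f x)\<^sup>2)"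
  using nn_integral_square[OF assms] by simp

abbreviation L2sq :: "('a::euclidean_space \<Rightarrow> 'b::euclidean_space) \<Rightarrow> real" where
  "L2sq f \<equiv> LINT x|lborel. (norm (f x))\<^sup>2"

lemma square_integrableI_nn:
  fixes f :: "'a::euclidean_space \<Rightarrow> 'b::euclidean_space"
  assumes [measurable]: "f \<in> borel_measurable borel"
    and "L2_bound lborel (\<lambda>x. norm (f x)) K"
  shows "square_integrable f"
proof -
  have "integrable lborel (\<lambda>x. (norm (f x))\<^sup>2)"
    by (rule integrableI_bounded) (use assms(2) in \<open>auto intro: le_less_trans\<close>)
  then show ?thesis by (simp add: square_integrable_def)
qed

lemma L2sq_le:
  fixes f :: "'a::euclidean_space \<Rightarrow> 'b::euclidean_space"
  assumes f: "f \<in> borel_measurable borel"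
    and K: "L2_bound lborel (\<lambda>x. norm (f x)) K" "0 \<le> K"
  shows "L2sq f \<le> K"
  using nn_integral_square[OF square_integrableI_nn[OF f K(1)]] K by simp

text \<open>Fatou's lemma. It carries uniform L2 and L4 bounds to limits.\<close>

lemma nn_integral_le_of_AE_tendsto:
  fixes f :: "nat \<Rightarrow> 'a \<Rightarrow> real"
  assumes [measurable]: "\<And>n. f n \<in> borel_measurable M"
    and lim: "AE x in M. (\<lambda>n. f n x) \<longlonglongrightarrow> g x"
    and K: "\<And>n. (\<integral>\<^sup>+x. ennreal (f n x) \<partial>M) \<le> K"
  shows "(\<integral>\<^sup>+x. ennreal (g x) \<partial>M) \<le> K"
proof -
  have "(\<integral>\<^sup>+x. ennreal (g x) \<partial>M) = (\<integral>\<^sup>+x. liminf (\<lambda>n. ennreal (f n x)) \<partial>M)"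
  proof (rule nn_integral_cong_AE)
    show "AE x in M. ennreal (g x) = liminf (\<lambda>n. ennreal (f n x))"
      using lim by eventually_elim (auto intro!: lim_imp_Liminf[symmetric] tendsto_ennrealI)
  qed
  also have "\<dots> \<le> liminf (\<lambda>n. \<integral>\<^sup>+x. ennreal (f n x) \<partial>M)"
    by (rule nn_integral_liminf) measurable
  also have "\<dots> \<le> liminf (\<lambda>n. K)"
    using K by (intro Liminf_mono always_eventually allI)
  also have "\<dots> = K" by (simp add: Liminf_const)
  finally show ?thesis .
qed

lemma square_integrable_translate:
  fixes f :: "'a::euclidean_space \<Rightarrow> 'b::euclidean_space"
  assumes f: "square_integrable f"
  shows "square_integrable (\<lambda>x. f (x + y))"
proof -
  note [measurable] = square_integrable_measurable[OF f]
  show ?thesis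
    by (rule square_integrableI_nn[where K = "LINT x|lborel. (norm (f x))\<^sup>2"])
      (simp_all add: nn_integral_lborel_translate[where f = "\<lambda>x. ennreal ((norm (f x))\<^sup>2)"] nn_integral_square f)
qed

lemma square_integrable_diff:
  fixes f g :: "'a::euclidean_space \<Rightarrow> 'b::euclidean_space"
  assumes "square_integrable f" "square_integrable g"
  shows "square_integrable (\<lambda>x. f x - g x)"
  using square_integrable_add[OF assms(1) square_integrable_scaleR[OF assms(2), of "-1"]] by simp

section \<open>The uniform distribution on the unit cube\<close>

text \<open>Being polymorphic in the space, it serves both as the uniform distribution on the unit
  interval, for integrals along segments, and as the weight of averages over cubes. Total mass 1 is
  what Jensen's inequality asks for.\<close>

definition unit_cube :: "'a::euclidean_space measure" where
  "unit_cube = density lborel (\<lambda>x. ennreal (indicator (cbox 0 One) x))"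

lemma sets_unit_cube [simp, measurable_cong]: "sets unit_cube = sets borel"
  by (simp add: unit_cube_def)

lemma space_unit_cube [simp]: "space unit_cube = UNIV"
  by (simp add: unit_cube_def)

lemma emeasure_unit_cube: "emeasure (unit_cube :: 'a::euclidean_space measure) UNIV = 1"
proof -
  have "emeasure (unit_cube :: 'a measure) UNIV = emeasure lborel (cbox 0 One :: 'a set)"
    by (simp add: unit_cube_def emeasure_density ennreal_indicator)
  also have "\<dots> = 1"
  proof -
    have "(One :: 'a) \<bullet> b = 1" if "b \<in> Basis" for b
      using that by (simp add: inner_sum_left inner_Basis)
    then show ?thesis by (subst emeasure_lborel_cbox) auto
  qed
  finally show ?thesis .
qed

interpretation unit_cube: finite_measure unit_cube
  by (rule finite_measureI) (simp add: emeasure_unit_cube)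

lemma AE_unit_cube: "AE h in unit_cube. h \<in> cbox 0 One"
  unfolding unit_cube_def by (subst AE_density) (auto simp: indicator_def)

lemma nn_integral_unit_cube_le:
  assumes [measurable]: "f \<in> borel_measurable borel"
  shows "(\<integral>\<^sup>+h. f h \<partial>unit_cube) \<le> (\<integral>\<^sup>+h. f h \<partial>lborel)"
  unfolding unit_cube_def
  by (subst nn_integral_density) (auto intro!: nn_integral_mono simp: indicator_def)

lemma integral_unit_cube_real:
  fixes f :: "real \<Rightarrow> real"
  assumes [measurable]: "f \<in> borel_measurable borel"
  shows "(LINT t|unit_cube. f t) = (LINT t|lborel. f t * indicator {0..1} t)"
proof -
  have "(LINT t|unit_cube. f t) = (LINT t|lborel. indicator (cbox 0 One) t *\<^sub>R f t)"
    unfolding unit_cube_def by (rule integral_density) auto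
  then show ?thesis by (simp add: mult.commute)
qed

section \<open>Translations of functions with a weak gradient\<close>

lemma has_derivative_translate:
  assumes "(f has_derivative f') (at (x + y))"
  shows "((\<lambda>x. f (x + y)) has_derivative f') (at x)"
  by (rule has_derivative_compose[where f = "\<lambda>x. x + y" and f' = "\<lambda>h. h", OF _ assms])
    (auto intro!: derivative_eq_intros)

lemma frechet_derivative_translate:
  assumes "f differentiable at (x + y)"
  shows "frechet_derivative (\<lambda>x. f (x + y)) (at x) = frechet_derivative f (at (x + y))"
  using has_derivative_translate assms frechet_derivative_works frechet_derivative_at by metis

lemma Ck_translate: "Ck k f \<Longrightarrow> Ck k (\<lambda>x. f (x + y))"
proof (induction k arbitrary: f)
  case 0
  then show ?case by (auto intro!: continuous_on_compose2[of UNIV f] continuous_intros)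
next
  case (Suc k)
  then have "f differentiable at x" for x by simp
  then have "(\<lambda>x. f (x + y)) differentiable at x" for x
    using has_derivative_translate unfolding differentiable_def by metis
  moreover have "Ck k (\<lambda>x. frechet_derivative f (at (x + y)) e)" if "e \<in> Basis" for e
    using Suc.IH[of "\<lambda>x. frechet_derivative f (at x) e"] Suc.prems that by simp
  ultimately show ?case using Suc.prems by (simp add: frechet_derivative_translate)
qed

lemma test_function_translate: "test_function \<phi> \<Longrightarrow> test_function (\<lambda>x. \<phi> (x + y))"
proof -
  assume \<phi>: "test_function \<phi>"
  have "{x. \<phi> (x + y) \<noteq> 0} = (\<lambda>x. - y + x) ` {x. \<phi> x \<noteq> 0}"
    by (force simp: image_iff intro: exI[of _ "_ + y"])
  then have "bounded {x. \<phi> (x + y) \<noteq> 0}"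
    using \<phi> bounded_translation[of "{x. \<phi> x \<noteq> 0}" "- y"] by (simp only: test_function_def compact_closure)
  then show ?thesis using \<phi> by (simp add: test_function_def Ck_translate compact_closure)
qed

lemma test_function_differentiable: "test_function \<phi> \<Longrightarrow> \<phi> differentiable at x"
proof -
  assume "test_function \<phi>"
  then have "Ck (Suc 0) \<phi>" unfolding test_function_def by blast
  then show ?thesis by simp
qed

lemma test_function_derivative_expand:
  assumes "test_function \<phi>"
  shows "frechet_derivative \<phi> (at x) y = (\<Sum>e\<in>Basis. (y \<bullet> e) * frechet_derivative \<phi> (at x) e)"
proof -
  have l: "linear (frechet_derivative \<phi> (at x))"
    by (rule linear_frechet_derivative[OF test_function_differentiable[OF assms]])
  have "frechet_derivative \<phi> (at x) y = frechet_derivative \<phi> (at x) (\<Sum>e\<in>Basis. (y \<bullet> e) *\<^sub>R e)"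
    by (simp add: euclidean_representation)
  also have "\<dots> = (\<Sum>e\<in>Basis. (y \<bullet> e) * frechet_derivative \<phi> (at x) e)"
    using l by (simp add: linear_sum linear_cmul)
  finally show ?thesis .
qed

lemma test_function_derivative_continuous:
  assumes "test_function \<phi>"
  shows "continuous_on UNIV (\<lambda>x. frechet_derivative \<phi> (at x) y)"
proof -
  have "Ck (Suc 0) \<phi>" using assms unfolding test_function_def by blast
  then have "continuous_on UNIV (\<lambda>x. frechet_derivative \<phi> (at x) e)" if "e \<in> Basis" for e
    using that by simp
  then show ?thesis
    unfolding test_function_derivative_expand[OF assms, of _ y] by (intro continuous_intros)
qed

lemma square_integrable_sum:
  fixes f :: "'i \<Rightarrow> 'a::euclidean_space \<Rightarrow> 'b::euclidean_space"
  assumes "\<And>i. i \<in> A \<Longrightarrow> square_integrable (f i)"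
  shows "square_integrable (\<lambda>x. \<Sum>i\<in>A. f i x)"
  using assms
  by (induction A rule: infinite_finite_induct) (auto intro: square_integrable_add square_integrable_zero)

lemma test_function_derivative_square_integrable':
  assumes "test_function \<phi>"
  shows "square_integrable (\<lambda>x. frechet_derivative \<phi> (at x) y)"
  unfolding test_function_derivative_expand[OF assms, of _ y]
  by (intro square_integrable_sum square_integrable_scaleR[where 'b = real, simplified]
      test_function_derivative_square_integrable assms)

text \<open>The definition of \<open>weak_gradient\<close> tests only basis directions; both sides
  are linear in the direction.\<close>

lemma weak_gradient_direction:
  assumes u: "square_integrable u" and g: "square_integrable g" and w: "weak_gradient u g"
    and \<phi>: "test_function \<phi>"
  shows "(LINT x|lborel. u x * frechet_derivative \<phi> (at x) y) = - (LINT x|lborel. (g x \<bullet> y) * \<phi> x)"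
proof -
  note d = test_function_derivative_square_integrable[OF \<phi>]
  have i: "integrable lborel (\<lambda>x. u x * frechet_derivative \<phi> (at x) e)"
     "integrable lborel (\<lambda>x. (g x \<bullet> e) * \<phi> x)" if "e \<in> Basis" for e
    by (intro square_integrable_mult square_integrable_component u g d that
        test_function_square_integrable[OF \<phi>])+
  have "(LINT x|lborel. u x * frechet_derivative \<phi> (at x) y) =
     (LINT x|lborel. (\<Sum>e\<in>Basis. (y \<bullet> e) * (u x * frechet_derivative \<phi> (at x) e)))"
    unfolding test_function_derivative_expand[OF \<phi>, of _ y] by (simp add: sum_distrib_left mult.left_commute)
  also have "\<dots> = (\<Sum>e\<in>Basis. (y \<bullet> e) * (LINT x|lborel. u x * frechet_derivative \<phi> (at x) e))"
    using i by (subst Bochner_Integration.integral_sum) auto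
  also have "\<dots> = (\<Sum>e\<in>Basis. (y \<bullet> e) * - (LINT x|lborel. (g x \<bullet> e) * \<phi> x))"
    using w \<phi> by (intro sum.cong refl) (simp add: weak_gradient_def)
  also have "\<dots> = - (LINT x|lborel. (\<Sum>e\<in>Basis. (y \<bullet> e) * ((g x \<bullet> e) * \<phi> x)))"
    using i by (subst Bochner_Integration.integral_sum) (auto simp: sum_negf)
  also have "\<dots> = - (LINT x|lborel. (g x \<bullet> y) * \<phi> x)"
    by (subst euclidean_inner[of "g _" y]) (simp add: sum_distrib_left sum_distrib_right mult_ac)
  finally show ?thesis .
qed

lemma square_integrable_inner_const:
  fixes g :: "'a::euclidean_space \<Rightarrow> 'b::euclidean_space"
  assumes g: "square_integrable g" shows "square_integrable (\<lambda>x. g x \<bullet> y)"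
proof -
  have "square_integrable (\<lambda>x. \<Sum>e\<in>Basis. (y \<bullet> e) *\<^sub>R (g x \<bullet> e))"
    by (intro square_integrable_sum square_integrable_scaleR square_integrable_component g)
  then show ?thesis by (subst euclidean_inner) (simp add: mult.commute)
qed

text \<open>Bounds take the place of norms, so that integrability is a consequence and never has to
  be checked first.\<close>

lemma nn_integral_abs_mult_le_CS:
  fixes f g :: "'a \<Rightarrow> real"
  assumes [measurable]: "f \<in> borel_measurable M" "g \<in> borel_measurable M"
    and f: "L2_bound M f (A\<^sup>2)"
    and g: "L2_bound M g (B\<^sup>2)"
    and AB: "0 \<le> A" "0 \<le> B"
  shows "(\<integral>\<^sup>+x. ennreal \<bar>f x * g x\<bar> \<partial>M) \<le> ennreal (A * B)"
proof -
  have "(\<integral>\<^sup>+x. ennreal \<bar>f x * g x\<bar> \<partial>M)\<^sup>2 = (\<integral>\<^sup>+x. ennreal \<bar>f x\<bar> * ennreal \<bar>g x\<bar> \<partial>M)\<^sup>2"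
    by (simp add: abs_mult ennreal_mult)
  also have "\<dots> \<le> (\<integral>\<^sup>+x. ennreal \<bar>f x\<bar> ^ 2 \<partial>M) * (\<integral>\<^sup>+x. ennreal \<bar>g x\<bar> ^ 2 \<partial>M)"
    by (rule Cauchy_Schwarz_nn_integral) measurable
  also have "\<dots> \<le> ennreal (A\<^sup>2) * ennreal (B\<^sup>2)"
    using f g by (intro mult_mono) (simp_all add: ennreal_power)
  also have "\<dots> = ennreal ((A * B)\<^sup>2)" by (simp add: ennreal_mult power_mult_distrib)
  finally have *: "(\<integral>\<^sup>+x. ennreal \<bar>f x * g x\<bar> \<partial>M)\<^sup>2 \<le> ennreal ((A * B)\<^sup>2)" .
  show ?thesis
  proof (cases "\<integral>\<^sup>+x. ennreal \<bar>f x * g x\<bar> \<partial>M")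
    case (real r)
    then have "r\<^sup>2 \<le> (A * B)\<^sup>2" using * by (simp add: ennreal_power)
    then have "r \<le> A * B" by (rule power2_le_imp_le) (use AB in simp)
    then show ?thesis using real by (simp add: ennreal_leI)
  next
    case top
    then show ?thesis using * by (simp add: top_unique)
  qed
qed

lemma integrable_of_nn_integral_abs_le:
  fixes f :: "'a \<Rightarrow> real"
  assumes m: "f \<in> borel_measurable M" and f: "(\<integral>\<^sup>+x. ennreal \<bar>f x\<bar> \<partial>M) \<le> ennreal A" and A: "0 \<le> A"
  shows "integrable M f" "\<bar>LINT x|M. f x\<bar> \<le> A"
proof -
  show i: "integrable M f"
    by (rule integrableI_bounded[OF m]) (use f in \<open>auto intro: le_less_trans\<close>)
  have "ennreal (LINT x|M. \<bar>f x\<bar>) = (\<integral>\<^sup>+x. ennreal \<bar>f x\<bar> \<partial>M)"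
    using i by (intro nn_integral_eq_integral[symmetric]) auto
  also note f
  finally have "(LINT x|M. \<bar>f x\<bar>) \<le> A" using A by simp
  moreover have "\<bar>LINT x|M. f x\<bar> \<le> (LINT x|M. \<bar>f x\<bar>)" by (rule integral_abs_bound)
  ultimately show "\<bar>LINT x|M. f x\<bar> \<le> A" by linarith
qed

lemma nn_integral_abs_mult_le:
  fixes f g :: "'a::euclidean_space \<Rightarrow> real"
  assumes f: "square_integrable f" and g: "square_integrable g"
  shows "(\<integral>\<^sup>+x. ennreal \<bar>f x * g x\<bar> \<partial>lborel) \<le> ennreal (sqrt (L2sq f) * sqrt (L2sq g))"
proof -
  note [measurable] = square_integrable_measurable[OF f] square_integrable_measurable[OF g]
  show ?thesis
    by (rule nn_integral_abs_mult_le_CS) (simp_all add: nn_integral_square_real f g)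
qed

lemma integral_square_translate:
  fixes f :: "'a::euclidean_space \<Rightarrow> real"
  assumes "square_integrable f"
  shows "(LINT x|lborel. (f (x + y))\<^sup>2) = (LINT x|lborel. (f x)\<^sup>2)"
  using integral_lborel_translate[of "\<lambda>x. (f x)\<^sup>2" y] square_integrable_measurable[OF assms] by measurable

text \<open>For smooth \<open>u\<close> this is the fundamental theorem of calculus on the segment
  from \<open>x\<close> to \<open>x + y\<close>. In the weak setting it is applied to the test
  function instead: translation and derivative are moved to \<open>\<phi>\<close>, and the
  fundamental lemma removes \<open>\<phi>\<close> at the end.\<close>

lemma translate_eq_integral_gradient:
  fixes u :: "'a::euclidean_space \<Rightarrow> real" and y :: 'a
  assumes u: "square_integrable u" and g: "square_integrable g" and w: "weak_gradient u g"
  defines "v \<equiv> (\<lambda>x. LINT t|unit_cube. g (x + (t :: real) *\<^sub>R y) \<bullet> y)"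
  shows "square_integrable v" "AE x in lborel. u (x + y) - u x = v x"
    "L2_bound lborel v ((norm y)\<^sup>2 * L2sq g)"
proof -
  interpret P: pair_sigma_finite "lborel :: 'a measure" "unit_cube :: real measure" ..
  note [measurable] = square_integrable_measurable[OF u] square_integrable_measurable[OF g]
  have gm [measurable]: "(\<lambda>(x, t). g (x + t *\<^sub>R y) \<bullet> y) \<in> borel_measurable (borel \<Otimes>\<^sub>M (unit_cube :: real measure))"
    by measurable
  have vm [measurable]: "v \<in> borel_measurable borel"
    unfolding v_def by (rule unit_cube.borel_measurable_lebesgue_integral) measurable
  show vn: "L2_bound lborel v ((norm y)\<^sup>2 * L2sq g)"
    unfolding v_def
  proof (rule nn_integral_square_average_le[OF unit_cube.finite_measure_axioms])
    show "emeasure (unit_cube :: real measure) (space unit_cube) = 1" by (simp add: emeasure_unit_cube)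
    show "(\<lambda>(x, t). g (x + t *\<^sub>R y) \<bullet> y) \<in> borel_measurable (borel \<Otimes>\<^sub>M (unit_cube :: real measure))" by (rule gm)
    show "AE h in unit_cube. L2_bound lborel (\<lambda>x. g (x + h *\<^sub>R y) \<bullet> y) ((norm y)\<^sup>2 * L2sq g)"
    proof (rule AE_I2)
      fix h :: real
      have "(\<integral>\<^sup>+x. ennreal ((g (x + h *\<^sub>R y) \<bullet> y)\<^sup>2) \<partial>lborel)
         \<le> (\<integral>\<^sup>+x. ennreal ((norm y)\<^sup>2) * ennreal ((norm (g (x + h *\<^sub>R y)))\<^sup>2) \<partial>lborel)"
      proof (rule nn_integral_mono)
        fix x
        have "\<bar>g (x + h *\<^sub>R y) \<bullet> y\<bar> \<le> norm y * norm (g (x + h *\<^sub>R y))"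
          using Cauchy_Schwarz_ineq2[of "g (x + h *\<^sub>R y)" y] by (simp add: mult.commute)
        then have "(g (x + h *\<^sub>R y) \<bullet> y)\<^sup>2 \<le> (norm y)\<^sup>2 * (norm (g (x + h *\<^sub>R y)))\<^sup>2"
          by (metis abs_ge_zero power2_abs power_mono power_mult_distrib)
        then show "ennreal ((g (x + h *\<^sub>R y) \<bullet> y)\<^sup>2) \<le> ennreal ((norm y)\<^sup>2) * ennreal ((norm (g (x + h *\<^sub>R y)))\<^sup>2)"
          by (simp add: ennreal_mult[symmetric])
      qed
      also have "\<dots> = ennreal ((norm y)\<^sup>2) * (\<integral>\<^sup>+x. ennreal ((norm (g x))\<^sup>2) \<partial>lborel)"
        using nn_integral_lborel_translate[of "\<lambda>x. ennreal ((norm (g x))\<^sup>2)" "h *\<^sub>R y"]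
        by (subst nn_integral_cmult) simp_all
      also have "\<dots> = ennreal ((norm y)\<^sup>2 * L2sq g)"
        by (simp add: nn_integral_square g ennreal_mult)
      finally show "L2_bound lborel (\<lambda>x. g (x + h *\<^sub>R y) \<bullet> y) ((norm y)\<^sup>2 * L2sq g)" .
    qed
  qed
  show vs: "square_integrable v" by (rule square_integrableI_nn[OF vm]) (use vn in simp)
  have "AE x in lborel. u (x + y) - u x - v x = 0"
  proof (rule fundamental_lemma)
    show "square_integrable (\<lambda>x. u (x + y) - u x - v x)"
      by (intro square_integrable_diff square_integrable_translate u vs)
    fix \<phi> :: "'a \<Rightarrow> real" assume \<phi>: "test_function \<phi>"
    define d where "d x = frechet_derivative \<phi> (at x) y" for x
    have dc: "continuous_on UNIV d"
      unfolding d_def by (rule test_function_derivative_continuous[OF \<phi>])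
    have ds: "square_integrable d"
      unfolding d_def by (rule test_function_derivative_square_integrable'[OF \<phi>])
    note \<phi>s = test_function_square_integrable[OF \<phi>]
    note [measurable] = square_integrable_measurable[OF ds] square_integrable_measurable[OF \<phi>s]
    \<comment> \<open>Shifting \<open>u\<close> by \<open>y\<close> amounts to shifting
      \<open>\<phi>\<close> by \<open>- y\<close>, hence the segment runs backwards.\<close>
    have ftc: "\<phi> (x - y) - \<phi> x = (LINT t|unit_cube. - d (x - t *\<^sub>R y))" for x
    proof -
      have D: "((\<lambda>t. \<phi> (x - t *\<^sub>R y)) has_real_derivative - d (x - t *\<^sub>R y)) (at t)" for t
      proof -
        have 1: "(\<phi> has_derivative frechet_derivative \<phi> (at (x - t *\<^sub>R y))) (at (x - t *\<^sub>R y))"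
          using test_function_differentiable[OF \<phi>] frechet_derivative_works by blast
        have "((\<lambda>t. x - t *\<^sub>R y) has_derivative (\<lambda>s. - (s *\<^sub>R y))) (at t)"
          by (auto intro!: derivative_eq_intros)
        from has_derivative_compose[OF this 1]
        have "((\<lambda>t. \<phi> (x - t *\<^sub>R y)) has_derivative
           (\<lambda>s. frechet_derivative \<phi> (at (x - t *\<^sub>R y)) (- (s *\<^sub>R y)))) (at t)" .
        moreover have "frechet_derivative \<phi> (at (x - t *\<^sub>R y)) (- (s *\<^sub>R y)) = - d (x - t *\<^sub>R y) * s" for s
          unfolding d_def
          by (subst (1 2) test_function_derivative_expand[OF \<phi>])
            (simp add: sum_distrib_left sum_negf mult_ac)
        ultimately show ?thesis by (intro has_derivative_imp_has_field_derivative) (auto simp: mult.commute)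
      qed
      have "continuous_on UNIV (\<lambda>t. d (x - t *\<^sub>R y))"
        by (rule continuous_on_compose2[OF dc]) (auto intro!: continuous_intros)
      then have "isCont (\<lambda>t. - d (x - t *\<^sub>R y)) t" for t
        by (intro isCont_minus) (simp add: continuous_on_eq_continuous_at)
      then have "(LINT t|lborel. - d (x - t *\<^sub>R y) * indicator {0..1} t) =
          \<phi> (x - 1 *\<^sub>R y) - \<phi> (x - 0 *\<^sub>R y)"
        using D by (intro integral_FTC_Icc_real) auto
      then show ?thesis by (subst integral_unit_cube_real) auto
    qed
    have i1: "integrable (lborel \<Otimes>\<^sub>M unit_cube) (\<lambda>(x, t). u x * - d (x + (- t) *\<^sub>R y))"
    proof (rule integrable_pair_bounded[OF sigma_finite_lborel unit_cube.finite_measure_axioms])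
      show "AE t in unit_cube. (\<integral>\<^sup>+x. ennreal \<bar>u x * - d (x + (- t) *\<^sub>R y)\<bar> \<partial>lborel)
          \<le> ennreal (sqrt (L2sq u) * sqrt (L2sq d))"
      proof (rule AE_I2)
        fix t :: real
        have s: "square_integrable (\<lambda>x. d (x + (- t) *\<^sub>R y))"
          by (rule square_integrable_translate[OF ds])
        show "(\<integral>\<^sup>+x. ennreal \<bar>u x * - d (x + (- t) *\<^sub>R y)\<bar> \<partial>lborel)
          \<le> ennreal (sqrt (L2sq u) * sqrt (L2sq d))"
          using nn_integral_abs_mult_le[OF u s] integral_square_translate[OF ds, of "(- t) *\<^sub>R y"] by simp
      qed
    qed measurable
    have i2: "integrable (lborel \<Otimes>\<^sub>M unit_cube) (\<lambda>(x, t). (g (x + t *\<^sub>R y) \<bullet> y) * \<phi> x)"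
    proof (rule integrable_pair_bounded[OF sigma_finite_lborel unit_cube.finite_measure_axioms])
      note gs = square_integrable_inner_const[OF g, of y]
      show "AE t in unit_cube. (\<integral>\<^sup>+x. ennreal \<bar>(g (x + t *\<^sub>R y) \<bullet> y) * \<phi> x\<bar> \<partial>lborel)
          \<le> ennreal (sqrt (L2sq (\<lambda>x. g x \<bullet> y)) * sqrt (L2sq \<phi>))"
      proof (rule AE_I2)
        fix t :: real
        have s: "square_integrable (\<lambda>x. g (x + t *\<^sub>R y) \<bullet> y)"
          by (rule square_integrable_translate[OF gs])
        show "(\<integral>\<^sup>+x. ennreal \<bar>(g (x + t *\<^sub>R y) \<bullet> y) * \<phi> x\<bar> \<partial>lborel)
          \<le> ennreal (sqrt (L2sq (\<lambda>x. g x \<bullet> y)) * sqrt (L2sq \<phi>))"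
          using nn_integral_abs_mult_le[OF s \<phi>s] integral_square_translate[OF gs, of "t *\<^sub>R y"] by simp
      qed
    qed measurable
    \<comment> \<open>The weak gradient is tested with the translated function; a shift of the
      integration variable then puts the translation on \<open>g\<close>.\<close>
    have step: "(LINT x|lborel. u x * - d (x + (- t) *\<^sub>R y)) = (LINT x|lborel. (g (x + t *\<^sub>R y) \<bullet> y) * \<phi> x)" for t
    proof -
      have "(LINT x|lborel. u x * frechet_derivative (\<lambda>x. \<phi> (x + (- t) *\<^sub>R y)) (at x) y) =
          - (LINT x|lborel. (g x \<bullet> y) * \<phi> (x + (- t) *\<^sub>R y))"
        by (rule weak_gradient_direction[OF u g w test_function_translate[OF \<phi>]])
      moreover have "frechet_derivative (\<lambda>x. \<phi> (x + (- t) *\<^sub>R y)) (at x) y = d (x + (- t) *\<^sub>R y)" for x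
        unfolding d_def by (subst frechet_derivative_translate) (auto intro: test_function_differentiable[OF \<phi>])
      ultimately have "(LINT x|lborel. u x * - d (x + (- t) *\<^sub>R y)) = (LINT x|lborel. (g x \<bullet> y) * \<phi> (x + (- t) *\<^sub>R y))"
        by simp
      also have "\<dots> = (LINT x|lborel. (g (x + t *\<^sub>R y) \<bullet> y) * \<phi> (x + t *\<^sub>R y + (- t) *\<^sub>R y))"
        by (rule integral_lborel_translate[symmetric]) measurable
      finally show ?thesis by simp
    qed
    have *: "u x * \<phi> (x + - y) - u x * \<phi> x = (LINT t|unit_cube. u x * - d (x + (- t) *\<^sub>R y))" for x
    proof -
      have "u x * \<phi> (x + - y) - u x * \<phi> x = u x * (\<phi> (x - y) - \<phi> x)" by (simp add: right_diff_distrib)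
      also have "\<dots> = u x * (LINT t|unit_cube. - d (x - t *\<^sub>R y))" by (simp only: ftc)
      also have "\<dots> = (LINT t|unit_cube. u x * - d (x - t *\<^sub>R y))"
        by (rule integral_mult_right_zero[symmetric])
      finally show ?thesis by simp
    qed
    have int: "integrable lborel (\<lambda>x. u (x + y) * \<phi> x)" "integrable lborel (\<lambda>x. u x * \<phi> x)"
       "integrable lborel (\<lambda>x. v x * \<phi> x)" "integrable lborel (\<lambda>x. u x * \<phi> (x + - y))"
      by (intro square_integrable_mult square_integrable_translate u vs \<phi>s)+
    have "(LINT x|lborel. u (x + y) * \<phi> x) = (LINT x|lborel. u (x + y) * \<phi> (x + y + - y))" by simp
    also have "\<dots> = (LINT x|lborel. u x * \<phi> (x + - y))"
      by (rule integral_lborel_translate) measurable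
    finally have "(LINT x|lborel. u (x + y) * \<phi> x) - (LINT x|lborel. u x * \<phi> x) =
        (LINT x|lborel. u x * \<phi> (x + - y)) - (LINT x|lborel. u x * \<phi> x)" by simp
    also have "\<dots> = (LINT x|lborel. u x * \<phi> (x + - y) - u x * \<phi> x)"
      using int by simp
    also have "\<dots> = (LINT x|lborel. (LINT t|unit_cube. u x * - d (x + (- t) *\<^sub>R y)))"
      by (simp only: *)
    also have "\<dots> = (LINT t|unit_cube. (LINT x|lborel. u x * - d (x + (- t) *\<^sub>R y)))"
      by (rule P.Fubini_integral[OF i1, symmetric])
    also have "\<dots> = (LINT t|unit_cube. (LINT x|lborel. (g (x + t *\<^sub>R y) \<bullet> y) * \<phi> x))"
      by (simp only: step)
    also have "\<dots> = (LINT x|lborel. (LINT t|unit_cube. (g (x + t *\<^sub>R y) \<bullet> y) * \<phi> x))"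
      by (rule P.Fubini_integral[OF i2])
    also have "\<dots> = (LINT x|lborel. v x * \<phi> x)" by (simp add: v_def)
    finally show "(LINT x|lborel. (u (x + y) - u x - v x) * \<phi> x) = 0"
      using int by (simp add: left_diff_distrib)
  qed
  then show "AE x in lborel. u (x + y) - u x = v x" by eventually_elim simp
qed

lemma translation_inequality:
  fixes u :: "'a::euclidean_space \<Rightarrow> real"
  assumes "square_integrable u" "square_integrable g" "weak_gradient u g"
  shows "L2_bound lborel (\<lambda>x. u (x + y) - u x) ((norm y)\<^sup>2 * L2sq g)"
proof -
  note v = translate_eq_integral_gradient[OF assms, of y]
  have "(\<integral>\<^sup>+x. ennreal ((u (x + y) - u x)\<^sup>2) \<partial>lborel) =
     (\<integral>\<^sup>+x. ennreal ((LINT t|unit_cube. g (x + (t :: real) *\<^sub>R y) \<bullet> y)\<^sup>2) \<partial>lborel)"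
    by (rule nn_integral_cong_AE) (use v(2) in \<open>eventually_elim, simp\<close>)
  then show ?thesis using v(3) by simp
qed

section \<open>Averages over cubes and the Sobolev embedding\<close>

text \<open>Convolution with the normalized indicator of a cube, written as an expectation so that
  Jensen and Fubini apply.\<close>

definition cube_avg :: "real \<Rightarrow> ('a::euclidean_space \<Rightarrow> real) \<Rightarrow> 'a \<Rightarrow> real" where
  "cube_avg l u x = (LINT h|unit_cube. u (x + l *\<^sub>R h))"

lemma cube_avg_measurable [measurable]:
  assumes [measurable]: "u \<in> borel_measurable borel"
  shows "cube_avg l u \<in> borel_measurable (borel :: 'a::euclidean_space measure)"
proof -
  show ?thesis unfolding cube_avg_def by (rule unit_cube.borel_measurable_lebesgue_integral) measurable
qed

lemma nn_integral_cube_square_le: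
  fixes u :: "'a::euclidean_space \<Rightarrow> real"
  assumes u: "square_integrable u" and l: "l > 0"
  shows "(\<integral>\<^sup>+h. ennreal ((u (x + l *\<^sub>R h))\<^sup>2) \<partial>unit_cube) \<le> ennreal (L2sq u / l ^ DIM('a))"
proof -
  note [measurable] = square_integrable_measurable[OF u]
  have "(\<integral>\<^sup>+h. ennreal ((u (x + l *\<^sub>R h))\<^sup>2) \<partial>unit_cube) \<le> (\<integral>\<^sup>+h. ennreal ((u (x + l *\<^sub>R h))\<^sup>2) \<partial>lborel)"
    by (rule nn_integral_unit_cube_le) measurable
  also have "\<dots> = ennreal (1 / l ^ DIM('a)) * (\<integral>\<^sup>+x. ennreal ((u x)\<^sup>2) \<partial>lborel)"
    using nn_integral_lborel_scale[of "\<lambda>x. ennreal ((u x)\<^sup>2)" l x] l by simp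
  also have "\<dots> = ennreal (L2sq u / l ^ DIM('a))"
    using l by (simp add: nn_integral_square_real u ennreal_mult[symmetric])
  finally show ?thesis .
qed

lemma integrable_unit_cube:
  fixes u :: "'a::euclidean_space \<Rightarrow> real"
  assumes u: "square_integrable u" and l: "l > 0"
  shows "integrable unit_cube (\<lambda>h. u (x + l *\<^sub>R h))"
proof -
  note [measurable] = square_integrable_measurable[OF u]
  have "integrable unit_cube (\<lambda>h. (u (x + l *\<^sub>R h))\<^sup>2)"
    by (rule integrableI_bounded)
      (use nn_integral_cube_square_le[OF u l, of x] in \<open>auto intro: le_less_trans\<close>)
  then show ?thesis by (rule unit_cube.square_integrable_imp_integrable[rotated]) measurable
qed

text \<open>Jensen on the cube and a change of variables. The bound holds at every point, which
  later gives independence of the representative and continuity of the point evaluation of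
  averages.\<close>

lemma cube_avg_sup_bound:
  fixes u :: "'a::euclidean_space \<Rightarrow> real"
  assumes u: "square_integrable u" and l: "l > 0"
  shows "(cube_avg l u x)\<^sup>2 \<le> L2sq u / l ^ DIM('a)"
proof -
  note [measurable] = square_integrable_measurable[OF u]
  have "ennreal ((cube_avg l u x)\<^sup>2) \<le> (\<integral>\<^sup>+h. ennreal ((u (x + l *\<^sub>R h))\<^sup>2) \<partial>unit_cube)"
    unfolding cube_avg_def by (rule unit_cube.jensen_square) (auto simp: emeasure_unit_cube)
  also note nn_integral_cube_square_le[OF u l]
  finally show ?thesis using l by simp
qed

lemma cube_avg_diff:
  assumes "square_integrable u" "square_integrable v" "l > 0"
  shows "cube_avg l (\<lambda>x. u x - v x) x = cube_avg l u x - cube_avg l v x"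
  unfolding cube_avg_def using assms by (intro Bochner_Integration.integral_diff integrable_unit_cube)

lemma cube_avg_add:
  assumes "square_integrable u" "square_integrable v" "l > 0"
  shows "cube_avg l (\<lambda>x. u x + v x) x = cube_avg l u x + cube_avg l v x"
  unfolding cube_avg_def using assms by (intro Bochner_Integration.integral_add integrable_unit_cube)

lemma nn_integral_cube_avg_le:
  fixes u :: "'a::euclidean_space \<Rightarrow> real"
  assumes u: "square_integrable u"
  shows "L2_bound lborel (cube_avg l u) (L2sq u)"
proof -
  note [measurable] = square_integrable_measurable[OF u]
  show ?thesis
    unfolding cube_avg_def
  proof (rule nn_integral_square_average_le[OF unit_cube.finite_measure_axioms])
    show "AE h in unit_cube. L2_bound lborel (\<lambda>x. u (x + l *\<^sub>R h)) (L2sq u)"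
    proof (rule AE_I2)
      fix h :: 'a
      show "L2_bound lborel (\<lambda>x. u (x + l *\<^sub>R h)) (L2sq u)"
        using nn_integral_lborel_translate[of "\<lambda>x. ennreal ((u x)\<^sup>2)" "l *\<^sub>R h"]
        by (simp add: nn_integral_square_real u)
    qed
  qed (simp_all add: emeasure_unit_cube)
qed

lemma square_integrable_cube_avg:
  assumes u: "square_integrable u"
  shows "square_integrable (cube_avg l u)" "L2sq (cube_avg l u) \<le> L2sq u"
proof -
  note m = cube_avg_measurable[OF square_integrable_measurable[OF u], of l]
  show "square_integrable (cube_avg l u)"
    by (rule square_integrableI_nn[OF m, of "L2sq u"]) (use nn_integral_cube_avg_le[OF u] in simp)
  show "L2sq (cube_avg l u) \<le> L2sq u"
    by (rule L2sq_le[OF m]) (use nn_integral_cube_avg_le[OF u] in simp_all)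
qed

lemma norm_unit_cube_le:
  fixes h :: "'a::euclidean_space"
  assumes "h \<in> cbox 0 One" shows "norm h \<le> DIM('a)"
proof -
  have "norm h \<le> (\<Sum>i\<in>Basis. \<bar>h \<bullet> i\<bar>)" by (rule norm_le_l1)
  also have "\<dots> \<le> (\<Sum>i\<in>(Basis::'a set). 1)"
    using assms by (intro sum_mono) (auto simp: mem_box inner_sum_left inner_Basis)
  finally show ?thesis by simp
qed

text \<open>The error is the average of \<open>u x - u (x + l *\<^sub>R h)\<close>, and the
  translation inequality applies with a shift of length at most \<open>l\<close> times the
  dimension.\<close>

lemma cube_avg_error:
  fixes u :: "'a::euclidean_space \<Rightarrow> real"
  assumes u: "square_integrable u" and g: "square_integrable g" and w: "weak_gradient u g" and l: "l > 0"
  shows "square_integrable (\<lambda>x. u x - cube_avg l u x)"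
    "L2sq (\<lambda>x. u x - cube_avg l u x) \<le> (l * DIM('a))\<^sup>2 * L2sq g"
proof -
  note [measurable] = square_integrable_measurable[OF u]
  have eq: "u x - cube_avg l u x = (LINT h|unit_cube. u x - u (x + l *\<^sub>R h))" for x
  proof -
    have "measure unit_cube (UNIV :: 'a set) = 1" by (simp add: measure_def emeasure_unit_cube)
    then show ?thesis
      unfolding cube_avg_def using integrable_unit_cube[OF u l, of x] by simp
  qed
  have n: "L2_bound lborel (\<lambda>x. u x - cube_avg l u x) ((l * DIM('a))\<^sup>2 * L2sq g)"
    unfolding eq
  proof (rule nn_integral_square_average_le[OF unit_cube.finite_measure_axioms])
    show "AE h in unit_cube. L2_bound lborel (\<lambda>x. u x - u (x + l *\<^sub>R h)) ((l * DIM('a))\<^sup>2 * L2sq g)"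
      using AE_unit_cube
    proof eventually_elim
      fix h :: 'a assume h: "h \<in> cbox 0 One"
      have "L2_bound lborel (\<lambda>x. u x - u (x + l *\<^sub>R h)) ((norm (l *\<^sub>R h))\<^sup>2 * L2sq g)"
        using translation_inequality[OF u g w, of "l *\<^sub>R h"] by (simp add: power2_commute)
      also have "\<dots> \<le> ennreal ((l * DIM('a))\<^sup>2 * L2sq g)"
        using norm_unit_cube_le[OF h] l
        by (intro ennreal_leI mult_right_mono power_mono) auto
      finally show "L2_bound lborel (\<lambda>x. u x - u (x + l *\<^sub>R h)) ((l * DIM('a))\<^sup>2 * L2sq g)" .
    qed
  qed (simp_all add: emeasure_unit_cube)
  have m: "(\<lambda>x. u x - cube_avg l u x) \<in> borel_measurable borel" by measurable
  show "square_integrable (\<lambda>x. u x - cube_avg l u x)"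
    by (rule square_integrableI_nn[OF m]) (use n in simp)
  show "L2sq (\<lambda>x. u x - cube_avg l u x) \<le> (l * DIM('a))\<^sup>2 * L2sq g"
    by (rule L2sq_le[OF m]) (use n in simp_all)
qed

text \<open>Fubini: both sides are the same integral over two cubes.\<close>

lemma cube_avg_commute:
  fixes u :: "'a::euclidean_space \<Rightarrow> real"
  assumes u: "square_integrable u" and l: "l > 0" and m: "m > 0"
  shows "cube_avg l (cube_avg m u) x = cube_avg m (cube_avg l u) x"
proof -
  interpret P: pair_sigma_finite "unit_cube :: 'a measure" "unit_cube :: 'a measure" ..
  note [measurable] = square_integrable_measurable[OF u]
  have "integrable (unit_cube \<Otimes>\<^sub>M unit_cube) (\<lambda>(h, k). u (x + l *\<^sub>R k + m *\<^sub>R h))"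
  proof (rule integrable_pair_bounded[OF unit_cube.sigma_finite_measure_axioms unit_cube.finite_measure_axioms])
    show "AE k in unit_cube. (\<integral>\<^sup>+h. ennreal \<bar>u (x + l *\<^sub>R k + m *\<^sub>R h)\<bar> \<partial>unit_cube)
        \<le> ennreal (1 + L2sq u / m ^ DIM('a))"
    proof (rule AE_I2)
      fix k :: 'a
      \<comment> \<open>On a probability space this lets the L2 bound on cubes serve as the L1 bound
        that Fubini asks for.\<close>
      have *: "\<bar>t\<bar> \<le> 1 + t\<^sup>2" for t :: real
        using sum_squares_bound[of "\<bar>t\<bar>" 1] by simp
      have "(\<integral>\<^sup>+h. ennreal \<bar>u (x + l *\<^sub>R k + m *\<^sub>R h)\<bar> \<partial>unit_cube)
        \<le> (\<integral>\<^sup>+h. ennreal 1 + ennreal ((u (x + l *\<^sub>R k + m *\<^sub>R h))\<^sup>2) \<partial>unit_cube)"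
        by (rule nn_integral_mono) (simp add: ennreal_plus[symmetric] * del: ennreal_plus ennreal_1)
      also have "\<dots> = ennreal 1 + (\<integral>\<^sup>+h. ennreal ((u (x + l *\<^sub>R k + m *\<^sub>R h))\<^sup>2) \<partial>unit_cube)"
        by (subst nn_integral_add) (auto simp: emeasure_unit_cube)
      also have "\<dots> \<le> ennreal 1 + ennreal (L2sq u / m ^ DIM('a))"
        by (intro add_left_mono nn_integral_cube_square_le u m)
      also have "\<dots> = ennreal (1 + L2sq u / m ^ DIM('a))"
        using m by (intro ennreal_plus[symmetric]) auto
      finally show "(\<integral>\<^sup>+h. ennreal \<bar>u (x + l *\<^sub>R k + m *\<^sub>R h)\<bar> \<partial>unit_cube)
        \<le> ennreal (1 + L2sq u / m ^ DIM('a))" .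
    qed
  qed measurable
  from P.Fubini_integral[OF this] show ?thesis
    by (simp add: cube_avg_def add_ac)
qed

section \<open>L4 error of the averages and the Sobolev embedding\<close>

abbreviation L4_bound :: "'a measure \<Rightarrow> ('a \<Rightarrow> real) \<Rightarrow> real \<Rightarrow> bool" where
  "L4_bound M f K \<equiv> (\<integral>\<^sup>+x. ennreal ((f x) ^ 4) \<partial>M) \<le> ennreal K"

lemma power4_add_le: "(a + b :: real) ^ 4 \<le> 8 * (a ^ 4 + b ^ 4)"
proof -
  have s: "(x + y)\<^sup>2 \<le> 2 * (x\<^sup>2 + y\<^sup>2)" for x y :: real
    using sum_squares_bound[of x y] by (simp add: power2_sum)
  have "(a + b) ^ 4 = ((a + b)\<^sup>2)\<^sup>2" by simp
  also have "\<dots> \<le> (2 * (a\<^sup>2 + b\<^sup>2))\<^sup>2" by (rule power_mono[OF s]) simp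
  also have "\<dots> = 4 * (a\<^sup>2 + b\<^sup>2)\<^sup>2" by (simp only: power_mult_distrib) simp
  also have "\<dots> \<le> 4 * (2 * ((a\<^sup>2)\<^sup>2 + (b\<^sup>2)\<^sup>2))" by (intro mult_left_mono s) simp
  finally show ?thesis by simp
qed

lemma nn_integral_power4_add_le:
  fixes f g :: "'a \<Rightarrow> real"
  assumes [measurable]: "f \<in> borel_measurable M" "g \<in> borel_measurable M"
    and f: "L4_bound M f A" and g: "L4_bound M g B"
    and "0 \<le> A" "0 \<le> B"
  shows "L4_bound M (\<lambda>x. f x + g x) (8 * (A + B))"
proof -
  have "(\<integral>\<^sup>+x. ennreal ((f x + g x) ^ 4) \<partial>M) \<le> (\<integral>\<^sup>+x. ennreal 8 * (ennreal ((f x) ^ 4) + ennreal ((g x) ^ 4)) \<partial>M)"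
  proof (rule nn_integral_mono)
    fix x
    have "ennreal ((f x + g x) ^ 4) \<le> ennreal (8 * (f x ^ 4 + g x ^ 4))"
      by (rule ennreal_leI[OF power4_add_le])
    also have "\<dots> = ennreal 8 * (ennreal (f x ^ 4) + ennreal (g x ^ 4))"
      by (subst ennreal_plus[symmetric], simp, simp, rule ennreal_mult) simp_all
    finally show "ennreal ((f x + g x) ^ 4) \<le> ennreal 8 * (ennreal (f x ^ 4) + ennreal (g x ^ 4))" .
  qed
  also have "\<dots> = ennreal 8 * ((\<integral>\<^sup>+x. ennreal ((f x) ^ 4) \<partial>M) + (\<integral>\<^sup>+x. ennreal ((g x) ^ 4) \<partial>M))"
    by (subst nn_integral_cmult) (auto simp: nn_integral_add)
  also have "\<dots> \<le> ennreal 8 * (ennreal A + ennreal B)" by (intro mult_left_mono add_mono f g) simp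
  also have "\<dots> = ennreal (8 * (A + B))"
    using assms by (subst ennreal_plus[symmetric], simp, simp, subst ennreal_mult[symmetric]) simp_all
  finally show ?thesis .
qed

lemma nn_integral_power4_le_sup:
  fixes f :: "'a::euclidean_space \<Rightarrow> real"
  assumes f: "square_integrable f" and b: "\<And>x. (f x)\<^sup>2 \<le> K"
  shows "L4_bound lborel f (K * L2sq f)"
proof -
  note [measurable] = square_integrable_measurable[OF f]
  have K: "0 \<le> K" using order_trans[OF zero_le_power2 b] .
  have "(\<integral>\<^sup>+x. ennreal ((f x) ^ 4) \<partial>lborel) \<le> (\<integral>\<^sup>+x. ennreal K * ennreal ((f x)\<^sup>2) \<partial>lborel)"
  proof (rule nn_integral_mono)
    fix x
    have "(f x) ^ 4 = (f x)\<^sup>2 * (f x)\<^sup>2" by simp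
    also have "\<dots> \<le> K * (f x)\<^sup>2" using b by (intro mult_right_mono) auto
    finally show "ennreal ((f x) ^ 4) \<le> ennreal K * ennreal ((f x)\<^sup>2)"
      using K by (simp add: ennreal_mult[symmetric])
  qed
  also have "\<dots> = ennreal (K * L2sq f)"
    using K by (subst nn_integral_cmult) (auto simp: nn_integral_square_real f ennreal_mult)
  finally show ?thesis .
qed

text \<open>A factor \<open>4 * 16 ^ N\<close> comes from the sup bound of the increment between two
  scales, where the smaller cube of side \<open>l/16\<close> contributes \<open>16 ^ N\<close>. A
  further 4 comes from its L2 bound, and each of the two bounds contains
  \<open>(l * N)^2\<close>.\<close>

definition sobolev_const :: "nat \<Rightarrow> real" where
  "sobolev_const N = 16 * 16 ^ N * real N ^ 4"

text \<open>Since the averages commute, the increment equals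
  \<open>cube_avg (l/16) (u - cube_avg l u) - cube_avg l (u - cube_avg (l/16) u)\<close>, so that its supremum
  is controlled by the gradient and not merely by \<open>u\<close>.\<close>

lemma cube_avg_increment:
  fixes u :: "'a::euclidean_space \<Rightarrow> real"
  assumes u: "square_integrable u" and g: "square_integrable g" and w: "weak_gradient u g"
    and N: "DIM('a) \<le> 3" and l: "0 < l" "l \<le> 1"
  shows "L4_bound lborel (\<lambda>x. cube_avg (l/16) u x - cube_avg l u x) (sobolev_const DIM('a) * l * (L2sq g)\<^sup>2)"
proof -
  define N where "N = DIM('a)"
  define G where "G = L2sq g"
  have G: "0 \<le> G" by (simp add: G_def)
  define r where "r = (\<lambda>m x. u x - cube_avg m u x)"
  have l': "0 < l / 16" using l by simp
  have rs: "square_integrable (r m)" and rn: "L2sq (r m) \<le> (l * N)\<^sup>2 * G" if "0 < m" "m \<le> l" for m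
  proof -
    have "L2sq (r m) \<le> (m * N)\<^sup>2 * G"
      unfolding r_def N_def G_def by (rule cube_avg_error(2)[OF u g w that(1)])
    also have "\<dots> \<le> (l * N)\<^sup>2 * G"
      using that G by (intro mult_right_mono power_mono) auto
    finally show "L2sq (r m) \<le> (l * N)\<^sup>2 * G" .
    show "square_integrable (r m)" unfolding r_def by (rule cube_avg_error(1)[OF u g w that(1)])
  qed
  have le: "l / 16 \<le> l" using l by simp
  note r1 = rs[OF l(1) order_refl] rn[OF l(1) order_refl]
  note r2 = rs[OF l' le] rn[OF l' le]
  define D where "D = (\<lambda>x. cube_avg (l/16) u x - cube_avg l u x)"
  note A = square_integrable_cube_avg(1)[OF u]
  have Ds: "square_integrable D" unfolding D_def by (rule square_integrable_diff[OF A A])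
  have D1: "D x = cube_avg (l/16) (r l) x - cube_avg l (r (l/16)) x" for x
    unfolding D_def r_def
    by (simp only: cube_avg_diff[OF u A l'] cube_avg_diff[OF u A l(1)] cube_avg_commute[OF u l(1) l'])
  have D2: "D x = r l x - r (l/16) x" for x by (simp add: D_def r_def)
  have sq: "(s - t)\<^sup>2 \<le> 2 * s\<^sup>2 + 2 * t\<^sup>2" for s t :: real
    using sum_squares_bound[of s "-t"] by (simp add: power2_diff)
  have sup: "(D x)\<^sup>2 \<le> 4 * 16 ^ N * ((l * N)\<^sup>2 * G) / l ^ N" for x
  proof -
    have "(cube_avg (l/16) (r l) x)\<^sup>2 \<le> L2sq (r l) / (l/16) ^ N"
      unfolding N_def by (rule cube_avg_sup_bound[OF r1(1) l'])
    also have "\<dots> \<le> (l * N)\<^sup>2 * G / (l/16) ^ N"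
      using l by (intro divide_right_mono r1(2)) auto
    also have "\<dots> = 16 ^ N * ((l * N)\<^sup>2 * G) / l ^ N" by (simp add: power_divide)
    finally have a: "(cube_avg (l/16) (r l) x)\<^sup>2 \<le> 16 ^ N * ((l * N)\<^sup>2 * G) / l ^ N" .
    have "(cube_avg l (r (l/16)) x)\<^sup>2 \<le> L2sq (r (l/16)) / l ^ N"
      unfolding N_def by (rule cube_avg_sup_bound[OF r2(1) l(1)])
    also have "\<dots> \<le> (l * N)\<^sup>2 * G / l ^ N"
      using l by (intro divide_right_mono r2(2)) auto
    also have "\<dots> \<le> 16 ^ N * ((l * N)\<^sup>2 * G) / l ^ N"
    proof (rule divide_right_mono)
      show "(l * N)\<^sup>2 * G \<le> 16 ^ N * ((l * N)\<^sup>2 * G)"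
        using mult_right_mono[of 1 "16 ^ N" "(l * N)\<^sup>2 * G"] G by simp
    qed (use l in simp)
    finally have b: "(cube_avg l (r (l/16)) x)\<^sup>2 \<le> 16 ^ N * ((l * N)\<^sup>2 * G) / l ^ N" .
    have sq4: "(s - t)\<^sup>2 \<le> 4 * Z" if "s\<^sup>2 \<le> Z" "t\<^sup>2 \<le> Z" for s t Z :: real
      using sq[of s t] that by linarith
    show ?thesis unfolding D1 using sq4[OF a b] by (simp only: times_divide_eq_right mult.assoc)
  qed
  have "L2sq D \<le> (LINT x|lborel. 2 * (norm (r l x))\<^sup>2 + 2 * (norm (r (l/16) x))\<^sup>2)"
  proof (rule integral_mono)
    show "integrable lborel (\<lambda>x. (norm (D x))\<^sup>2)" using Ds by (simp add: square_integrable_def)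
    show "integrable lborel (\<lambda>x. 2 * (norm (r l x))\<^sup>2 + 2 * (norm (r (l/16) x))\<^sup>2)"
      using r1(1) r2(1) by (simp add: square_integrable_def)
    show "(norm (D x))\<^sup>2 \<le> 2 * (norm (r l x))\<^sup>2 + 2 * (norm (r (l/16) x))\<^sup>2" for x
      using sq[of "r l x" "r (l/16) x"] by (simp add: D2)
  qed
  also have "\<dots> = 2 * L2sq (r l) + 2 * L2sq (r (l/16))"
    using r1(1) r2(1) by (simp add: square_integrable_def)
  also have "\<dots> \<le> 4 * ((l * N)\<^sup>2 * G)" using r1(2) r2(2) by simp
  finally have L2: "L2sq D \<le> 4 * ((l * N)\<^sup>2 * G)" .
  have "L4_bound lborel D (4 * 16 ^ N * ((l * N)\<^sup>2 * G) / l ^ N * L2sq D)"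
    by (rule nn_integral_power4_le_sup[OF Ds sup])
  also have "\<dots> \<le> ennreal (sobolev_const N * l * G\<^sup>2)"
  proof (rule ennreal_leI)
    have "4 * 16 ^ N * ((l * N)\<^sup>2 * G) / l ^ N * L2sq D \<le>
       4 * 16 ^ N * ((l * N)\<^sup>2 * G) / l ^ N * (4 * ((l * N)\<^sup>2 * G))"
      using l G by (intro mult_left_mono L2) auto
    also have "\<dots> = sobolev_const N * (l ^ 4 / l ^ N) * G\<^sup>2"
    proof -
      have "((l * N)\<^sup>2 * G) * ((l * N)\<^sup>2 * G) = real N ^ 4 * l ^ 4 * G\<^sup>2"
        by (simp only: power2_eq_square power4_eq_xxxx mult_ac)
      then show ?thesis
        unfolding sobolev_const_def times_divide_eq_right times_divide_eq_left
        by (intro arg_cong[where f = "\<lambda>t. t / l ^ N"]) (simp only: mult_ac, simp)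
    qed
    also have "\<dots> \<le> sobolev_const N * l * G\<^sup>2"
    proof (intro mult_right_mono mult_left_mono)
      \<comment> \<open>The dimension bound enters here: \<open>4 - N \<ge> 1\<close> leaves a
        positive power of \<open>l\<close>, so that the increments become small at small
        scales.\<close>
      have "l ^ 4 / l ^ N = l ^ (4 - N)"
        using l assms(4) by (simp add: power_diff N_def)
      also have "\<dots> \<le> l ^ 1" using l assms(4) by (intro power_decreasing) (auto simp: N_def)
      finally show "l ^ 4 / l ^ N \<le> l" by simp
    qed (simp_all add: sobolev_const_def)
    finally show "4 * 16 ^ N * ((l * N)\<^sup>2 * G) / l ^ N * L2sq D \<le> sobolev_const N * l * G\<^sup>2" .
  qed
  finally show ?thesis unfolding D_def N_def G_def .
qed

text \<open>The factor 16 reproduces itself: the induction hypothesis at scale \<open>l/16\<close>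
  and one increment are each bounded by \<open>K * l\<close>, and the fourth power of their sum
  costs the factor 8. So the bound is uniform in \<open>n\<close>.\<close>

lemma cube_avg_telescope:
  fixes u :: "'a::euclidean_space \<Rightarrow> real"
  assumes u: "square_integrable u" and g: "square_integrable g" and w: "weak_gradient u g"
    and N: "DIM('a) \<le> 3" and l: "0 < l" "l \<le> 1"
  shows "L4_bound lborel (\<lambda>x. cube_avg (l / 16 ^ n) u x - cube_avg l u x) (16 * sobolev_const DIM('a) * l * (L2sq g)\<^sup>2)"
  using l
proof (induction n arbitrary: l)
  case 0
  then show ?case by simp
next
  case (Suc n)
  define K where "K = sobolev_const DIM('a) * (L2sq g)\<^sup>2"
  have K: "0 \<le> K" by (simp add: K_def sobolev_const_def)
  note [measurable] = square_integrable_measurable[OF u]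
  have "L4_bound lborel (\<lambda>x. (cube_avg (l / 16 / 16 ^ n) u x - cube_avg (l/16) u x) +
       (cube_avg (l/16) u x - cube_avg l u x)) (8 * (K * l + K * l))"
  proof (rule nn_integral_power4_add_le)
    show "L4_bound lborel (\<lambda>x. cube_avg (l / 16 / 16 ^ n) u x - cube_avg (l/16) u x) (K * l)"
      using Suc.IH[of "l/16"] Suc.prems by (simp add: K_def mult_ac)
    show "L4_bound lborel (\<lambda>x. cube_avg (l/16) u x - cube_avg l u x) (K * l)"
      using cube_avg_increment[OF u g w N Suc.prems] by (simp add: K_def mult_ac)
  qed (use K Suc.prems in auto)
  then show ?case by (simp add: K_def mult_ac)
qed

text \<open>The averages at the scales \<open>l / 16 ^ n\<close> tend to \<open>u\<close> almost
  everywhere, because their squared L2 errors decay geometrically. Fatou's lemma then applies to the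
  telescoped bound.\<close>

theorem cube_avg_L4_error:
  fixes u :: "'a::euclidean_space \<Rightarrow> real"
  assumes u: "square_integrable u" and g: "square_integrable g" and w: "weak_gradient u g"
    and N: "DIM('a) \<le> 3" and l: "0 < l" "l \<le> 1"
  shows "L4_bound lborel (\<lambda>x. u x - cube_avg l u x) (16 * sobolev_const DIM('a) * l * (L2sq g)\<^sup>2)"
proof (rule nn_integral_le_of_AE_tendsto)
  note [measurable] = square_integrable_measurable[OF u]
  have "AE x in lborel. summable (\<lambda>n. (u x - cube_avg (l / 16 ^ n) u x)\<^sup>2)"
  proof (rule AE_summable_square)
    show "L2_bound lborel (\<lambda>x. u x - cube_avg (l / 16 ^ n) u x) ((l * DIM('a))\<^sup>2 * L2sq g * (1/256) ^ n)" for n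
    proof -
      have l': "l / 16 ^ n > 0" using l by simp
      have "(\<integral>\<^sup>+x. ennreal ((u x - cube_avg (l / 16 ^ n) u x)\<^sup>2) \<partial>lborel)
          = ennreal (L2sq (\<lambda>x. u x - cube_avg (l / 16 ^ n) u x))"
        using nn_integral_square[OF cube_avg_error(1)[OF u g w l']] by simp
      also have "\<dots> \<le> ennreal ((l / 16 ^ n * DIM('a))\<^sup>2 * L2sq g)"
        by (intro ennreal_leI cube_avg_error(2)[OF u g w l'])
      also have "(l / 16 ^ n * DIM('a))\<^sup>2 * L2sq g = (l * DIM('a))\<^sup>2 * L2sq g * (1/256) ^ n"
      proof -
        have "((16::real) ^ n)\<^sup>2 = 256 ^ n" by (simp add: power2_eq_square flip: power_mult_distrib)
        then show ?thesis by (simp add: power_mult_distrib power_divide)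
      qed
      finally show ?thesis .
    qed
    show "summable (\<lambda>n. (l * DIM('a))\<^sup>2 * L2sq g * (1/256) ^ n)"
      by (intro summable_mult summable_geometric) simp
  qed simp_all
  then show "AE x in lborel. (\<lambda>n. (cube_avg (l / 16 ^ n) u x - cube_avg l u x) ^ 4)
       \<longlonglongrightarrow> (u x - cube_avg l u x) ^ 4"
  proof eventually_elim
    fix x assume "summable (\<lambda>n. (u x - cube_avg (l / 16 ^ n) u x)\<^sup>2)"
    then have "(\<lambda>n. (u x - cube_avg (l / 16 ^ n) u x)\<^sup>2) \<longlonglongrightarrow> 0" by (rule summable_LIMSEQ_zero)
    then have "(\<lambda>n. u x - cube_avg (l / 16 ^ n) u x) \<longlonglongrightarrow> 0"
      by (simp add: power_tendsto_0_iff)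
    then have "(\<lambda>n. u x - (u x - cube_avg (l / 16 ^ n) u x)) \<longlonglongrightarrow> u x - 0"
      by (intro tendsto_intros)
    then have "(\<lambda>n. cube_avg (l / 16 ^ n) u x) \<longlonglongrightarrow> u x" by simp
    then show "(\<lambda>n. (cube_avg (l / 16 ^ n) u x - cube_avg l u x) ^ 4) \<longlonglongrightarrow> (u x - cube_avg l u x) ^ 4"
      by (intro tendsto_intros)
  qed
  show "(\<lambda>x. (cube_avg (l / 16 ^ n) u x - cube_avg l u x) ^ 4) \<in> borel_measurable lborel" for n
    by measurable
qed (rule cube_avg_telescope[OF assms])

text \<open>The sup bound \<open>K\<close> is left open: the embedding uses the bound by the L2
  norm, the exclusion of vanishing a small one.\<close>

lemma nn_integral_cube_avg_power4_le:
  fixes u :: "'a::euclidean_space \<Rightarrow> real"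
  assumes u: "square_integrable u" and K: "\<And>x. (cube_avg l u x)\<^sup>2 \<le> K"
  shows "L4_bound lborel (cube_avg l u) (K * L2sq u)"
proof -
  have "0 \<le> K" using order_trans[OF zero_le_power2 K] .
  then have "K * L2sq (cube_avg l u) \<le> K * L2sq u"
    using square_integrable_cube_avg(2)[OF u] by (rule mult_left_mono[rotated])
  with nn_integral_power4_le_sup[OF square_integrable_cube_avg(1)[OF u] K]
  show ?thesis by (meson ennreal_leI order_trans)
qed

text \<open>Split \<open>u\<close> into its average at scale 1 and the error. At this scale the sup
  bound of the average is the L2 norm itself.\<close>

theorem sobolev_L4:
  fixes u :: "'a::euclidean_space \<Rightarrow> real"
  assumes u: "square_integrable u" and g: "square_integrable g" and w: "weak_gradient u g"
    and N: "DIM('a) \<le> 3"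
  shows "L4_bound lborel u (8 * (16 * sobolev_const DIM('a) + 1) * (L2sq g + L2sq u)\<^sup>2)"
proof -
  note [measurable] = square_integrable_measurable[OF u]
  have S: "0 \<le> sobolev_const DIM('a)" by (simp add: sobolev_const_def)
  have "L4_bound lborel (\<lambda>x. (u x - cube_avg 1 u x) + cube_avg 1 u x) (8 * (16 * sobolev_const DIM('a) * 1 * (L2sq g)\<^sup>2 + (L2sq u)\<^sup>2))"
  proof (rule nn_integral_power4_add_le)
    show "L4_bound lborel (\<lambda>x. u x - cube_avg 1 u x) (16 * sobolev_const DIM('a) * 1 * (L2sq g)\<^sup>2)"
      by (rule cube_avg_L4_error[OF assms]) auto
    have "(cube_avg 1 u x)\<^sup>2 \<le> L2sq u" for x
      using cube_avg_sup_bound[OF u, of 1 x] by simp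
    from nn_integral_cube_avg_power4_le[OF u this]
    show "L4_bound lborel (cube_avg 1 u) ((L2sq u)\<^sup>2)"
      by (simp add: power2_eq_square)
  qed (use S in simp_all)
  also have "\<dots> \<le> ennreal (8 * (16 * sobolev_const DIM('a) + 1) * (L2sq g + L2sq u)\<^sup>2)"
  proof (rule ennreal_leI)
    have "(L2sq g)\<^sup>2 \<le> (L2sq g + L2sq u)\<^sup>2" "(L2sq u)\<^sup>2 \<le> (L2sq g + L2sq u)\<^sup>2"
      by (intro power_mono; simp)+
    then have "16 * sobolev_const DIM('a) * (L2sq g)\<^sup>2 + (L2sq u)\<^sup>2 \<le>
      16 * sobolev_const DIM('a) * (L2sq g + L2sq u)\<^sup>2 + (L2sq g + L2sq u)\<^sup>2"
      using S by (intro add_mono mult_left_mono) auto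
    then show "8 * (16 * sobolev_const DIM('a) * 1 * (L2sq g)\<^sup>2 + (L2sq u)\<^sup>2) \<le>
       8 * (16 * sobolev_const DIM('a) + 1) * (L2sq g + L2sq u)\<^sup>2"
      by (simp add: algebra_simps)
  qed
  finally show ?thesis by simp
qed

text \<open>Cauchy-Schwarz for the two pairs of factors, and again for the squares inside each
  pair.\<close>

lemma holder4:
  fixes f1 f2 f3 f4 :: "'a \<Rightarrow> real"
  assumes [measurable]: "f1 \<in> borel_measurable M" "f2 \<in> borel_measurable M"
      "f3 \<in> borel_measurable M" "f4 \<in> borel_measurable M"
    and f: "L4_bound M f1 (A1 ^ 4)"
      "L4_bound M f2 (A2 ^ 4)"
      "L4_bound M f3 (A3 ^ 4)"
      "L4_bound M f4 (A4 ^ 4)"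
    and A: "0 \<le> A1" "0 \<le> A2" "0 \<le> A3" "0 \<le> A4"
  shows "integrable M (\<lambda>x. f1 x * f2 x * f3 x * f4 x)"
    "\<bar>LINT x|M. f1 x * f2 x * f3 x * f4 x\<bar> \<le> A1 * A2 * A3 * A4"
proof -
  have two: "L2_bound M (\<lambda>x. f x * g x) ((A * B)\<^sup>2)"
    if [measurable]: "f \<in> borel_measurable M" "g \<in> borel_measurable M"
      and "L4_bound M f (A ^ 4)"
      "L4_bound M g (B ^ 4)" for f g :: "'a \<Rightarrow> real" and A B :: real
  proof -
    have "(\<integral>\<^sup>+x. ennreal \<bar>(f x)\<^sup>2 * (g x)\<^sup>2\<bar> \<partial>M) \<le> ennreal (A\<^sup>2 * B\<^sup>2)"
    proof (rule nn_integral_abs_mult_le_CS)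
      show "L2_bound M (\<lambda>x. (f x)\<^sup>2) ((A\<^sup>2)\<^sup>2)"
        "L2_bound M (\<lambda>x. (g x)\<^sup>2) ((B\<^sup>2)\<^sup>2)"
        unfolding power_mult[symmetric] using that(3,4) by simp_all
    qed simp_all
    then show ?thesis by (simp add: power_mult_distrib abs_mult)
  qed
  have "(\<integral>\<^sup>+x. ennreal \<bar>(f1 x * f2 x) * (f3 x * f4 x)\<bar> \<partial>M) \<le> ennreal ((A1 * A2) * (A3 * A4))"
    by (rule nn_integral_abs_mult_le_CS[OF _ _ two two]; (rule f)?) (use A in simp_all)
  then have n: "(\<integral>\<^sup>+x. ennreal \<bar>f1 x * f2 x * f3 x * f4 x\<bar> \<partial>M) \<le> ennreal (A1 * A2 * A3 * A4)"
    by (simp only: mult.assoc)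
  show "integrable M (\<lambda>x. f1 x * f2 x * f3 x * f4 x)"
    "\<bar>LINT x|M. f1 x * f2 x * f3 x * f4 x\<bar> \<le> A1 * A2 * A3 * A4"
    by (rule integrable_of_nn_integral_abs_le[OF _ n]; use A in simp)+
qed

lemma L2_Cauchy_Schwarz:
  fixes f g :: "'a::euclidean_space \<Rightarrow> real"
  assumes f: "square_integrable f" and g: "square_integrable g"
  shows "\<bar>LINT x|lborel. f x * g x\<bar> \<le> sqrt (L2sq f) * sqrt (L2sq g)"
proof -
  note [measurable] = square_integrable_measurable[OF f] square_integrable_measurable[OF g]
  show ?thesis
    by (rule integrable_of_nn_integral_abs_le(2)[OF _ nn_integral_abs_mult_le[OF f g]]) simp_all
qed

section \<open>Completeness of H1\<close>

lemma square_integrable_norm_scale: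
  fixes f :: "'a::euclidean_space \<Rightarrow> 'b::euclidean_space"
  assumes "square_integrable f"
  shows "(\<integral>\<^sup>+x. ennreal ((c * norm (f x))\<^sup>2) \<partial>lborel) = ennreal (c\<^sup>2 * L2sq f)"
proof -
  note [measurable] = square_integrable_measurable[OF assms]
  have "(\<integral>\<^sup>+x. ennreal ((c * norm (f x))\<^sup>2) \<partial>lborel) = (\<integral>\<^sup>+x. ennreal (c\<^sup>2) * ennreal ((norm (f x))\<^sup>2) \<partial>lborel)"
    by (simp add: power_mult_distrib ennreal_mult)
  also have "\<dots> = ennreal (c\<^sup>2 * L2sq f)"
    by (subst nn_integral_cmult) (auto simp: nn_integral_square[OF assms] ennreal_mult)
  finally show ?thesis .
qed

text \<open>Riesz-Fischer. The completeness of \<open>H1\<close> rests on it, and on that the weak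
  compactness.\<close>

lemma L2_complete:
  fixes f :: "nat \<Rightarrow> 'a::euclidean_space \<Rightarrow> 'b::euclidean_space"
  assumes f: "\<And>n. square_integrable (f n)"
    and C: "\<And>e. e > 0 \<Longrightarrow> \<exists>M. \<forall>m\<ge>M. \<forall>n\<ge>M. L2sq (\<lambda>x. f m x - f n x) \<le> e"
  obtains F where "square_integrable F" "(\<lambda>n. L2sq (\<lambda>x. f n x - F x)) \<longlonglongrightarrow> 0"
proof -
  note [measurable] = square_integrable_measurable[OF f]
  have "\<forall>k. \<exists>M. \<forall>m\<ge>M. \<forall>n\<ge>M. L2sq (\<lambda>x. f m x - f n x) \<le> (1/8) ^ k" by (intro allI C) simp
  then obtain M where M: "\<And>k m n. m \<ge> M k \<Longrightarrow> n \<ge> M k \<Longrightarrow> L2sq (\<lambda>x. f m x - f n x) \<le> (1/8) ^ k"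
    by metis
  \<comment> \<open>Partial sums of the thresholds dominate every earlier threshold, so both
    \<open>r k\<close> and \<open>r (Suc k)\<close> lie beyond \<open>M k\<close>.\<close>
  define r where "r = (\<lambda>k. (\<Sum>i\<le>k. M i) + k)"
  have rM: "M k \<le> r k" "M k \<le> r (Suc k)" "k \<le> r k" for k
    using member_le_sum[of k "{..k}" M] by (auto simp: r_def)
  define d where "d = (\<lambda>k x. f (r (Suc k)) x - f (r k) x)"
  have ds: "square_integrable (d k)" for k unfolding d_def by (intro square_integrable_diff f)
  \<comment> \<open>The weight \<open>2 ^ k\<close> is affordable, as \<open>4 ^ k / 8 ^ k\<close>
    is still summable, and it turns mere boundedness of the weighted terms into absolute summability
    of \<open>d k x\<close>.\<close>
  have "AE x in lborel. summable (\<lambda>k. (2 ^ k * norm (d k x))\<^sup>2)"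
  proof (rule AE_summable_square)
    show "L2_bound lborel (\<lambda>x. 2 ^ k * norm (d k x)) ((1/2) ^ k)" for k
    proof -
      have "(\<integral>\<^sup>+x. ennreal ((2 ^ k * norm (d k x))\<^sup>2) \<partial>lborel) = ennreal ((2 ^ k)\<^sup>2 * L2sq (d k))"
        by (rule square_integrable_norm_scale[OF ds])
      also have "\<dots> \<le> ennreal ((2 ^ k)\<^sup>2 * (1/8) ^ k)"
        unfolding d_def by (intro ennreal_leI mult_left_mono M rM) simp
      also have "(2 ^ k)\<^sup>2 * (1/8) ^ k = (1/2 :: real) ^ k"
        by (simp add: power2_eq_square flip: power_mult_distrib)
      finally show ?thesis .
    qed
    show "summable (\<lambda>k. (1/2 :: real) ^ k)" by (rule summable_geometric) simp
    show "(\<lambda>x. 2 ^ k * norm (d k x)) \<in> borel_measurable lborel" for k unfolding d_def by measurable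
  qed simp
  then have AEc: "AE x in lborel. convergent (\<lambda>k. f (r k) x)"
  proof eventually_elim
    fix x assume "summable (\<lambda>k. (2 ^ k * norm (d k x))\<^sup>2)"
    then have "(\<lambda>k. 2 ^ k * norm (d k x)) \<longlonglongrightarrow> 0"
      using summable_LIMSEQ_zero by fastforce
    then have "Bseq (\<lambda>k. 2 ^ k * norm (d k x))" by (intro convergent_imp_Bseq convergentI)
    then obtain B where B: "\<And>k. norm (2 ^ k * norm (d k x)) \<le> B" by (auto simp: Bseq_def)
    have "norm (d k x) \<le> B * (1/2) ^ k" for k
      using B[of k] by (simp add: field_simps)
    moreover have "summable (\<lambda>k. B * (1/2) ^ k)" by (intro summable_mult summable_geometric) simp
    ultimately have "summable (\<lambda>k. d k x)"
      using summable_comparison_test'[of "\<lambda>k. B * (1/2) ^ k" 0 "\<lambda>k. d k x"] by blast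
    then have "convergent (\<lambda>n. \<Sum>k<n. d k x)" by (simp add: summable_iff_convergent)
    then have "convergent (\<lambda>n. (f (r n) x - f (r 0) x) + f (r 0) x)"
      by (intro convergent_add) (simp_all add: d_def sum_lessThan_telescope[of "\<lambda>k. f (r k) x"] convergent_const)
    then show "convergent (\<lambda>k. f (r k) x)" by simp
  qed
  define F where "F = (\<lambda>x. lim (\<lambda>k. f (r k) x))"
  have [measurable]: "F \<in> borel_measurable borel" unfolding F_def by measurable
  have le: "L2_bound lborel (\<lambda>x. norm (f n x - F x)) ((1/8) ^ k)" if n: "n \<ge> M k" for n k
  proof (rule nn_integral_le_of_AE_tendsto)
    show "AE x in lborel. (\<lambda>i. (norm (f n x - f (r (i + k)) x))\<^sup>2) \<longlonglongrightarrow> (norm (f n x - F x))\<^sup>2"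
      using AEc
    proof eventually_elim
      fix x assume "convergent (\<lambda>k. f (r k) x)"
      then have "(\<lambda>k. f (r k) x) \<longlonglongrightarrow> F x" by (simp add: F_def convergent_LIMSEQ_iff)
      then have "(\<lambda>i. f (r (i + k)) x) \<longlonglongrightarrow> F x" by (rule LIMSEQ_ignore_initial_segment)
      then show "(\<lambda>i. (norm (f n x - f (r (i + k)) x))\<^sup>2) \<longlonglongrightarrow> (norm (f n x - F x))\<^sup>2"
        by (intro tendsto_intros)
    qed
    show "L2_bound lborel (\<lambda>x. norm (f n x - f (r (i + k)) x)) ((1/8) ^ k)" for i
    proof -
      have "M k \<le> r (i + k)"
        using member_le_sum[of k "{..i + k}" M] by (auto simp: r_def)
      then show ?thesis
        using M[OF n] by (simp add: nn_integral_square square_integrable_diff f ennreal_leI)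
    qed
  qed measurable
  have diff_s: "square_integrable (\<lambda>x. f (M k) x - F x)" for k
    by (rule square_integrableI_nn[OF _ le[OF order_refl]]) measurable
  have "square_integrable (\<lambda>x. f (M 0) x - (f (M 0) x - F x))"
    by (intro square_integrable_diff f diff_s)
  then have Fs: "square_integrable F" by simp
  have "(\<lambda>n. L2sq (\<lambda>x. f n x - F x)) \<longlonglongrightarrow> 0"
  proof (rule LIMSEQ_I)
    fix e :: real assume e: "e > 0"
    then obtain k where k: "(1/8 :: real) ^ k < e" using real_arch_pow_inv[of e "1/8"] by auto
    have "norm (L2sq (\<lambda>x. f n x - F x) - 0) < e" if "n \<ge> M k" for n
    proof -
      have "L2sq (\<lambda>x. f n x - F x) \<le> (1/8) ^ k" by (rule L2sq_le[OF _ le[OF that]]) simp_all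
      then show ?thesis using k by simp
    qed
    then show "\<exists>no. \<forall>n\<ge>no. norm (L2sq (\<lambda>x. f n x - F x) - 0) < e" by blast
  qed
  with Fs show thesis by (rule that)
qed

lemma H1_measurable [measurable]: "fun_of_H1 u \<in> borel_measurable borel" "grad_H1 u \<in> borel_measurable borel"
  using grad_H1(1) square_integrable_fun_of_H1 square_integrable_measurable by blast+

lemma norm_H1_sq: "(norm u)\<^sup>2 = L2sq (grad_H1 u) + L2sq (fun_of_H1 u)"
  for u :: "'a::euclidean_space H1"
proof -
  have "(norm u)\<^sup>2 = (LINT x|lborel. (norm (grad_H1 u x))\<^sup>2 + (norm (fun_of_H1 u x))\<^sup>2)"
    by (simp only: power2_norm_eq_inner inner_H1_def) (simp add: power2_eq_square)
  also have "\<dots> = L2sq (grad_H1 u) + L2sq (fun_of_H1 u)"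
    using grad_H1(1)[of u] square_integrable_fun_of_H1[of u]
    by (intro Bochner_Integration.integral_add) (auto simp: square_integrable_def)
  finally show ?thesis .
qed

lemma fun_of_H1_diff:
  "AE x in lborel. fun_of_H1 (u - v) x = fun_of_H1 u x - fun_of_H1 v x" for u v :: "'a::euclidean_space H1"
  using fun_of_H1_add[of u "(-1) *\<^sub>R v"] fun_of_H1_scaleR[of "-1" v]
  by (auto elim!: eventually_elim2)

lemma grad_H1_diff:
  "AE x in lborel. grad_H1 (u - v) x = grad_H1 u x - grad_H1 v x" for u v :: "'a::euclidean_space H1"
  using grad_H1_add[of u "(-1) *\<^sub>R v"] grad_H1_scaleR[of "-1" v]
  by (auto elim!: eventually_elim2)

lemma L2sq_cong_AE:
  fixes f g :: "'a::euclidean_space \<Rightarrow> 'b::euclidean_space"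
  assumes "AE x in lborel. f x = g x" "f \<in> borel_measurable borel" "g \<in> borel_measurable borel"
  shows "L2sq f = L2sq g"
  by (rule integral_cong_AE) (use assms in auto)

lemma norm_H1_diff_sq:
  "(norm (u - v))\<^sup>2 = L2sq (\<lambda>x. grad_H1 u x - grad_H1 v x) + L2sq (\<lambda>x. fun_of_H1 u x - fun_of_H1 v x)"
  for u v :: "'a::euclidean_space H1"
proof -
  have "L2sq (grad_H1 (u - v)) = L2sq (\<lambda>x. grad_H1 u x - grad_H1 v x)"
    by (rule L2sq_cong_AE[OF grad_H1_diff]) measurable
  moreover have "L2sq (fun_of_H1 (u - v)) = L2sq (\<lambda>x. fun_of_H1 u x - fun_of_H1 v x)"
    by (rule L2sq_cong_AE[OF fun_of_H1_diff]) measurable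
  ultimately show ?thesis unfolding norm_H1_sq by simp
qed

lemma tendsto_integral_mult_L2:
  fixes f :: "nat \<Rightarrow> 'a::euclidean_space \<Rightarrow> real"
  assumes f: "\<And>n. square_integrable (f n)" and F: "square_integrable F" and h: "square_integrable h"
    and lim: "(\<lambda>n. L2sq (\<lambda>x. f n x - F x)) \<longlonglongrightarrow> 0"
  shows "(\<lambda>n. LINT x|lborel. f n x * h x) \<longlonglongrightarrow> (LINT x|lborel. F x * h x)"
proof -
  have "(\<lambda>n. (LINT x|lborel. f n x * h x) - (LINT x|lborel. F x * h x)) \<longlonglongrightarrow> 0"
  proof (rule Lim_null_comparison[OF always_eventually], rule allI)
    fix n
    have "(LINT x|lborel. f n x * h x) - (LINT x|lborel. F x * h x) = (LINT x|lborel. (f n x - F x) * h x)"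
      unfolding left_diff_distrib
      by (intro Bochner_Integration.integral_diff[symmetric] square_integrable_mult f F h)
    also have "\<bar>\<dots>\<bar> \<le> sqrt (L2sq (\<lambda>x. f n x - F x)) * sqrt (L2sq h)"
      by (intro L2_Cauchy_Schwarz square_integrable_diff f F h)
    finally show "norm ((LINT x|lborel. f n x * h x) - (LINT x|lborel. F x * h x))
        \<le> sqrt (L2sq (\<lambda>x. f n x - F x)) * sqrt (L2sq h)" by simp
    next
    have "(\<lambda>n. sqrt (L2sq (\<lambda>x. f n x - F x)) * sqrt (L2sq h)) \<longlonglongrightarrow> sqrt 0 * sqrt (L2sq h)"
      by (intro tendsto_intros lim)
    then show "(\<lambda>n. sqrt (L2sq (\<lambda>x. f n x - F x)) * sqrt (L2sq h)) \<longlonglongrightarrow> 0" by simp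
  qed
  then show ?thesis using Lim_null by blast
qed

text \<open>The gradient is a closed operator: both sides of its definition are continuous in
  L2.\<close>

lemma weak_gradient_limit:
  fixes f :: "nat \<Rightarrow> 'a::euclidean_space \<Rightarrow> real"
  assumes f: "\<And>n. square_integrable (f n)" "square_integrable F" "(\<lambda>n. L2sq (\<lambda>x. f n x - F x)) \<longlonglongrightarrow> 0"
    and g: "\<And>n. square_integrable (g n)" "square_integrable G" "(\<lambda>n. L2sq (\<lambda>x. g n x - G x)) \<longlonglongrightarrow> 0"
    and w: "\<And>n. weak_gradient (f n) (g n)"
  shows "weak_gradient F G"
  unfolding weak_gradient_def
proof (intro allI impI ballI)
  fix \<phi> :: "'a \<Rightarrow> real" and e :: 'a assume \<phi>: "test_function \<phi>" and e: "e \<in> Basis"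
  have "(\<lambda>n. LINT x|lborel. f n x * frechet_derivative \<phi> (at x) e)
      \<longlonglongrightarrow> (LINT x|lborel. F x * frechet_derivative \<phi> (at x) e)"
    by (rule tendsto_integral_mult_L2[OF f(1,2) test_function_derivative_square_integrable[OF \<phi> e] f(3)])
  moreover have "(\<lambda>n. - (LINT x|lborel. (g n x \<bullet> e) * \<phi> x)) \<longlonglongrightarrow> - (LINT x|lborel. (G x \<bullet> e) * \<phi> x)"
  proof (intro tendsto_minus tendsto_integral_mult_L2)
    show "(\<lambda>n. L2sq (\<lambda>x. g n x \<bullet> e - G x \<bullet> e)) \<longlonglongrightarrow> 0"
    proof (rule Lim_null_comparison[OF always_eventually g(3)], rule allI)
      fix n
      have s: "square_integrable (\<lambda>x. g n x - G x)" by (intro square_integrable_diff g)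
      have "L2sq (\<lambda>x. (g n x - G x) \<bullet> e) \<le> L2sq (\<lambda>x. g n x - G x)"
      proof (rule integral_mono)
        show "integrable lborel (\<lambda>x. (norm ((g n x - G x) \<bullet> e))\<^sup>2)"
          using square_integrable_component[OF s e] by (simp add: square_integrable_def)
        show "integrable lborel (\<lambda>x. (norm (g n x - G x))\<^sup>2)"
          using s by (simp add: square_integrable_def)
        show "(norm ((g n x - G x) \<bullet> e))\<^sup>2 \<le> (norm (g n x - G x))\<^sup>2" for x
          using Basis_le_norm[OF e, of "g n x - G x"] by (intro power_mono) auto
      qed
      then show "norm (L2sq (\<lambda>x. g n x \<bullet> e - G x \<bullet> e)) \<le> L2sq (\<lambda>x. g n x - G x)"
        by (simp add: inner_diff_left)
    qed
  qed (intro square_integrable_component g e test_function_square_integrable \<phi>)+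
  moreover have "(LINT x|lborel. f n x * frechet_derivative \<phi> (at x) e) = - (LINT x|lborel. (g n x \<bullet> e) * \<phi> x)" for n
    using w[of n] \<phi> e by (simp add: weak_gradient_def)
  ultimately show "(LINT x|lborel. F x * frechet_derivative \<phi> (at x) e) = - (LINT x|lborel. (G x \<bullet> e) * \<phi> x)"
    using LIMSEQ_unique by fastforce
qed

lemma H1_of_fun:
  fixes F :: "'a::euclidean_space \<Rightarrow> real"
  assumes "square_integrable F" "square_integrable G" "weak_gradient F G"
  shows "AE x in lborel. fun_of_H1 (H1_of_fun F) x = F x" "AE x in lborel. grad_H1 (H1_of_fun F) x = G x"
proof -
  have "H1_function F" using assms by (auto simp: H1_function_def)
  then show 1: "AE x in lborel. fun_of_H1 (H1_of_fun F) x = F x" by (rule fun_of_H1_of_fun)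
  show "AE x in lborel. grad_H1 (H1_of_fun F) x = G x" by (rule grad_H1_unique[OF 1 assms])
qed

instance H1 :: (euclidean_space) complete_space
proof
  fix X :: "nat \<Rightarrow> 'a H1" assume X: "Cauchy X"
  have "\<exists>M. \<forall>m\<ge>M. \<forall>n\<ge>M. L2sq (\<lambda>x. grad_H1 (X m) x - grad_H1 (X n) x) +
      L2sq (\<lambda>x. fun_of_H1 (X m) x - fun_of_H1 (X n) x) \<le> e" if e: "e > 0" for e
  proof -
    obtain M where M: "\<forall>m\<ge>M. \<forall>n\<ge>M. norm (X m - X n) < sqrt e"
      using CauchyD[OF X, of "sqrt e"] e by auto
    have "(norm (X m - X n))\<^sup>2 \<le> e" if "m \<ge> M" "n \<ge> M" for m n
    proof -
      have "(norm (X m - X n))\<^sup>2 \<le> (sqrt e)\<^sup>2" using M that by (intro power_mono) (auto intro: less_imp_le)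
      then show ?thesis using e by simp
    qed
    then show ?thesis unfolding norm_H1_diff_sq by blast
  qed
  moreover have "a \<le> e" "b \<le> e" if "a + b \<le> e" "0 \<le> a" "0 \<le> b" for a b e :: real using that by auto
  ultimately have CG: "\<exists>M. \<forall>m\<ge>M. \<forall>n\<ge>M. L2sq (\<lambda>x. grad_H1 (X m) x - grad_H1 (X n) x) \<le> e"
    and CF: "\<exists>M. \<forall>m\<ge>M. \<forall>n\<ge>M. L2sq (\<lambda>x. fun_of_H1 (X m) x - fun_of_H1 (X n) x) \<le> e" if "e > 0" for e
    using that by (meson Bochner_Integration.integral_nonneg zero_le_power2)+
  obtain G where G: "square_integrable G" "(\<lambda>n. L2sq (\<lambda>x. grad_H1 (X n) x - G x)) \<longlonglongrightarrow> 0"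
    by (rule L2_complete[of "\<lambda>n. grad_H1 (X n)", OF grad_H1(1) CG])
  obtain F where F: "square_integrable F" "(\<lambda>n. L2sq (\<lambda>x. fun_of_H1 (X n) x - F x)) \<longlonglongrightarrow> 0"
    by (rule L2_complete[of "\<lambda>n. fun_of_H1 (X n)", OF square_integrable_fun_of_H1 CF])
  note [measurable] = square_integrable_measurable[OF F(1)] square_integrable_measurable[OF G(1)]
  have "weak_gradient F G"
    by (rule weak_gradient_limit[where f = "\<lambda>n. fun_of_H1 (X n)" and g = "\<lambda>n. grad_H1 (X n)"])
      (rule square_integrable_fun_of_H1 F G grad_H1)+
  note U = H1_of_fun[OF F(1) G(1) this]
  define U where "U = H1_of_fun F"
  have "(norm (X n - U))\<^sup>2 = L2sq (\<lambda>x. grad_H1 (X n) x - G x) + L2sq (\<lambda>x. fun_of_H1 (X n) x - F x)" for n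
  proof -
    have "L2sq (\<lambda>x. grad_H1 (X n) x - grad_H1 U x) = L2sq (\<lambda>x. grad_H1 (X n) x - G x)"
      by (rule L2sq_cong_AE) (use U(2) in \<open>auto simp: U_def\<close>)
    moreover have "L2sq (\<lambda>x. fun_of_H1 (X n) x - fun_of_H1 U x) = L2sq (\<lambda>x. fun_of_H1 (X n) x - F x)"
      by (rule L2sq_cong_AE) (use U(1) in \<open>auto simp: U_def\<close>)
    ultimately show ?thesis unfolding norm_H1_diff_sq by simp
  qed
  moreover have "(\<lambda>n. L2sq (\<lambda>x. grad_H1 (X n) x - G x) + L2sq (\<lambda>x. fun_of_H1 (X n) x - F x)) \<longlonglongrightarrow> 0"
    using tendsto_add[OF G(2) F(2)] by simp
  ultimately have "(\<lambda>n. (norm (X n - U))\<^sup>2) \<longlonglongrightarrow> 0" by simp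
  then have "X \<longlonglongrightarrow> U" by (simp add: LIM_zero_iff tendsto_norm_zero_iff)
  then show "convergent X" by (rule convergentI)
qed

section \<open>Weak compactness\<close>

text \<open>As in the projection theorem, the parallelogram law makes elements of almost minimal
  norm in nested convex sets a Cauchy sequence. The minimal norms increase with \<open>n\<close> and
  are bounded by \<open>K\<close>, hence converge.\<close>

lemma convex_hull_tails_converge:
  fixes u :: "nat \<Rightarrow> 'a::{real_inner, complete_space}"
  assumes K: "\<And>n. norm (u n) \<le> K"
  obtains v w where "\<And>n. w n \<in> convex hull (u ` {n..})" "w \<longlonglongrightarrow> v"
proof -
  define C where "C = (\<lambda>n. convex hull (u ` {n..}))"
  define d where "d = (\<lambda>n. Inf (norm ` C n))"
  have ne: "u n \<in> C n" for n unfolding C_def by (rule hull_inc) simp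
  have bdd: "bdd_below (norm ` C n)" for n by (intro bdd_belowI[of _ 0]) auto
  have sub: "C m \<subseteq> C n" if "n \<le> m" for m n
    unfolding C_def using that by (intro hull_mono image_mono) auto
  have dle: "d n \<le> norm x" if "x \<in> C n" for n x
    unfolding d_def using that bdd by (intro cInf_lower) auto
  have d0: "0 \<le> d n" for n unfolding d_def using ne by (intro cInf_greatest) auto
  have dmono: "d n \<le> d m" if "n \<le> m" for n m
    unfolding d_def using sub[OF that] bdd ne by (intro cInf_superset_mono) auto
  have dK: "\<forall>n. d n \<le> K" using dle[OF ne] K order_trans by blast
  have "incseq d" using dmono by (simp add: incseq_def)
  then obtain D where D: "d \<longlonglongrightarrow> D" "\<forall>n. d n \<le> D"
    using incseq_convergent[of d K] dK by blast
  have "\<exists>x\<in>C n. norm x < d n + 1 / Suc n" for n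
  proof -
    have "Inf (norm ` C n) < d n + 1 / Suc n" unfolding d_def by simp
    then show ?thesis using cInf_lessD[of "norm ` C n"] ne by blast
  qed
  then obtain w where w: "\<And>n. w n \<in> C n" "\<And>n. norm (w n) < d n + 1 / Suc n" by metis
  \<comment> \<open>From the parallelogram law: the midpoint of \<open>w n\<close> and
    \<open>w m\<close> lies in \<open>C n\<close>, so its norm is at least \<open>d n\<close>, while
    both norms are at most \<open>D + 1 / Suc n\<close>.\<close>
  define e where "e = (\<lambda>n. 4 * ((D + 1 / Suc n)\<^sup>2 - (d n)\<^sup>2))"
  have est: "(norm (w n - w m))\<^sup>2 \<le> e n" if "n \<le> m" for n m
  proof -
    have wn: "norm (w k) \<le> D + 1 / Suc n" if "n \<le> k" for k
    proof -
      have "1 / real (Suc k) \<le> 1 / Suc n" using that by (intro divide_left_mono) auto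
      then show ?thesis using w(2)[of k] D(2)[rule_format, of k] by linarith
    qed
    have "w n \<in> C n" "w m \<in> C n" using w(1) sub[OF that] by auto
    then have "(1/2) *\<^sub>R w n + (1/2) *\<^sub>R w m \<in> C n"
      unfolding C_def using convexD[OF convex_convex_hull, of "w n" _ "w m" "1/2" "1/2"] by auto
    then have "d n \<le> norm ((1/2) *\<^sub>R (w n + w m))" using dle by (simp add: scaleR_add_right)
    then have "2 * d n \<le> norm (w n + w m)" by simp
    then have "(2 * d n)\<^sup>2 \<le> (norm (w n + w m))\<^sup>2" using d0[of n] by (intro power_mono) auto
    moreover have "(norm (w n + w m))\<^sup>2 + (norm (w n - w m))\<^sup>2 = 2 * (norm (w n))\<^sup>2 + 2 * (norm (w m))\<^sup>2"
      by (simp add: power2_norm_eq_inner inner_add inner_diff inner_commute)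
    moreover have "(norm (w n))\<^sup>2 \<le> (D + 1 / Suc n)\<^sup>2" "(norm (w m))\<^sup>2 \<le> (D + 1 / Suc n)\<^sup>2"
      using wn[of n] wn[OF that] by (auto intro: power_mono)
    ultimately show ?thesis unfolding e_def by (simp add: power_mult_distrib)
  qed
  have "e \<longlonglongrightarrow> 4 * ((D + 0)\<^sup>2 - D\<^sup>2)"
    unfolding e_def by (intro tendsto_intros D LIMSEQ_Suc[OF lim_1_over_n])
  then have e0: "e \<longlonglongrightarrow> 0" by simp
  have "Cauchy w"
  proof (rule CauchyI')
    fix \<epsilon> :: real assume \<epsilon>: "\<epsilon> > 0"
    then have "eventually (\<lambda>n. e n < \<epsilon>\<^sup>2) sequentially" using order_tendstoD(2)[OF e0] by simp
    then obtain M where M: "\<And>n. n \<ge> M \<Longrightarrow> e n < \<epsilon>\<^sup>2" by (auto simp: eventually_sequentially)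
    have "norm (w m - w n) < \<epsilon>" if "m \<ge> M" "n > m" for m n
    proof -
      have "(norm (w m - w n))\<^sup>2 < \<epsilon>\<^sup>2" using est[of m n] M[of m] that by simp
      then show ?thesis using \<epsilon> by (simp add: power2_less_imp_less)
    qed
    then show "\<exists>M. \<forall>m\<ge>M. \<forall>n>m. dist (w m) (w n) < \<epsilon>" by (auto simp: dist_norm)
  qed
  then obtain v where "w \<longlonglongrightarrow> v" using Cauchy_convergent convergent_def by blast
  then show thesis using that[of w v] w(1) unfolding C_def by blast
qed

text \<open>A ball around \<open>c\<close> is convex, so its preimage contains the hull of some
  tail.\<close>

lemma convex_hull_tails_limit:
  fixes u :: "nat \<Rightarrow> 'a::real_normed_vector" and f :: "'a \<Rightarrow> real"
  assumes f: "bounded_linear f" and lim: "(\<lambda>n. f (u n)) \<longlonglongrightarrow> c"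
    and w: "\<And>n. w n \<in> convex hull (u ` {n..})" "w \<longlonglongrightarrow> v"
  shows "f v = c"
proof -
  interpret bounded_linear f by fact
  have "(\<lambda>n. f (w n)) \<longlonglongrightarrow> c"
  proof (rule metric_LIMSEQ_I)
    fix \<epsilon> :: real assume "\<epsilon> > 0"
    then obtain M where M: "\<And>n. n \<ge> M \<Longrightarrow> dist (f (u n)) c < \<epsilon>" using metric_LIMSEQ_D[OF lim] by blast
    have "dist (f (w n)) c < \<epsilon>" if "n \<ge> M" for n
    proof -
      have "convex (f -` ball c \<epsilon>)"
        by (rule convex_linear_vimage[OF linear_axioms convex_ball])
      moreover have "u ` {n..} \<subseteq> f -` ball c \<epsilon>" using M that by (auto simp: dist_commute)
      ultimately have "convex hull (u ` {n..}) \<subseteq> f -` ball c \<epsilon>" by (rule hull_minimal[rotated])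
      then show ?thesis using w(1)[of n] by (auto simp: dist_commute)
    qed
    then show "\<exists>no. \<forall>n\<ge>no. dist (f (w n)) c < \<epsilon>" by blast
  qed
  moreover have "(\<lambda>n. f (w n)) \<longlonglongrightarrow> f v" by (rule tendsto[OF w(2)])
  ultimately show ?thesis using LIMSEQ_unique by blast
qed

lemma bounded_linear_bounded_range:
  fixes f :: "'a::real_normed_vector \<Rightarrow> real"
  assumes "bounded_linear f" "\<And>n. norm (u n) \<le> K"
  shows "bounded (range (\<lambda>n. f (u n)))"
proof -
  obtain B where B: "\<And>x. norm (f x) \<le> norm x * B" "B \<ge> 0"
    using bounded_linear.nonneg_bounded[OF assms(1)] by blast
  have "norm (f (u n)) \<le> K * B" for n
    using B(1)[of "u n"] mult_right_mono[OF assms(2) B(2), of n] by linarith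
  then show ?thesis by (intro boundedI) auto
qed

text \<open>After a diagonal extraction the inner products with all members of the sequence converge. The
  strong limits of convex combinations of the tails, of the sequence or of a subsequence, all lie in
  the closed span of the sequence and have the same inner products with it, so they coincide.\<close>

theorem bounded_imp_weakly_convergent_subsequence:
  fixes u :: "nat \<Rightarrow> 'a::{real_inner, complete_space}"
  assumes K: "\<And>n. norm (u n) \<le> K"
  obtains r v where "strict_mono (r :: nat \<Rightarrow> nat)"
    "\<And>f :: 'a \<Rightarrow> real. bounded_linear f \<Longrightarrow> (\<lambda>n. f (u (r n))) \<longlonglongrightarrow> f v"
proof -
  interpret subseqs "\<lambda>m s. convergent (\<lambda>n. u (s n) \<bullet> u m)"
  proof
    fix m and s :: "nat \<Rightarrow> nat" assume "strict_mono s"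
    have "bounded (range (\<lambda>n. u (s n) \<bullet> u m))"
      by (rule bounded_linear_bounded_range[OF bounded_linear_inner_left K])
    then obtain l r where "strict_mono (r :: nat \<Rightarrow> nat)" "((\<lambda>n. u (s n) \<bullet> u m) \<circ> r) \<longlonglongrightarrow> l"
      using bounded_imp_convergent_subsequence by blast
    then show "\<exists>r'. strict_mono r' \<and> convergent (\<lambda>n. u ((s \<circ> r') n) \<bullet> u m)"
      by (auto simp: o_def convergent_def)
  qed
  define r where "r = diagseq"
  have r: "strict_mono r" unfolding r_def by (rule subseq_diagseq)
  have conv: "convergent (\<lambda>n. u (r n) \<bullet> u m)" for m
  proof -
    \<comment> \<open>The diagonal sequence is guaranteed to run inside the extraction made for
      \<open>m\<close> only from the index \<open>Suc m\<close> on.\<close>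
    have "convergent (\<lambda>n. u ((diagseq \<circ> (+) (Suc m)) n) \<bullet> u m)"
    proof (rule diagseq_holds)
      fix r s :: "nat \<Rightarrow> nat" and n assume "strict_mono r" "convergent (\<lambda>k. u (s k) \<bullet> u n)"
      then show "convergent (\<lambda>k. u ((s \<circ> r) k) \<bullet> u n)"
        using convergent_subseq_convergent[of "\<lambda>k. u (s k) \<bullet> u n" r] by (simp add: o_def)
    qed
    then have "convergent (\<lambda>n. u (r (n + Suc m)) \<bullet> u m)" by (simp add: r_def add.commute)
    then show ?thesis using convergent_ignore_initial_segment[of "\<lambda>n. u (r n) \<bullet> u m" "Suc m"] by simp
  qed
  define U where "U = (\<lambda>n. u (r n))"
  have UK: "norm (U n) \<le> K" for n using K by (simp add: U_def)
  obtain v w where w: "\<And>n. w n \<in> convex hull (U ` {n..})" "w \<longlonglongrightarrow> v"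
    by (rule convex_hull_tails_converge[of U K, OF UK]) blast
  have inspan: "x \<in> span (range u)" if "x \<in> convex hull ((\<lambda>n. U (s n)) ` {n..})" for x s n
  proof -
    have "(\<lambda>n. U (s n)) ` {n..} \<subseteq> span (range u)" by (auto simp: U_def intro: span_base)
    then have "convex hull ((\<lambda>n. U (s n)) ` {n..}) \<subseteq> span (range u)"
      by (rule hull_minimal) (simp add: subspace_imp_convex)
    then show ?thesis using that by blast
  qed
  have lim_v: "(\<lambda>n. U n \<bullet> u m) \<longlonglongrightarrow> v \<bullet> u m" for m
  proof -
    obtain c where c: "(\<lambda>n. U n \<bullet> u m) \<longlonglongrightarrow> c" using conv[of m] by (auto simp: convergent_def U_def)
    then have "v \<bullet> u m = c" by (rule convex_hull_tails_limit[OF bounded_linear_inner_left _ w])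
    then show ?thesis using c by simp
  qed
  have "(\<lambda>n. f (U n)) \<longlonglongrightarrow> f v" if f: "bounded_linear f" for f :: "'a \<Rightarrow> real"
  proof (rule ccontr)
    assume "\<not> (\<lambda>n. f (U n)) \<longlonglongrightarrow> f v"
    then obtain \<epsilon> where \<epsilon>: "\<epsilon> > 0" "\<exists>\<^sub>F n in sequentially. \<not> dist (f (U n)) (f v) < \<epsilon>"
      unfolding tendsto_iff frequently_def by auto
    then have "infinite {n. \<not> dist (f (U n)) (f v) < \<epsilon>}" by (simp add: frequently_cofinite flip: cofinite_eq_sequentially)
    then obtain s where s: "strict_mono (s :: nat \<Rightarrow> nat)" "\<And>n. \<not> dist (f (U (s n))) (f v) < \<epsilon>"
      using infinite_enumerate by blast
    have "bounded (range (\<lambda>n. f (U (s n))))" by (rule bounded_linear_bounded_range[OF f UK])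
    then obtain c t where t: "strict_mono (t :: nat \<Rightarrow> nat)" "((\<lambda>n. f (U (s n))) \<circ> t) \<longlonglongrightarrow> c"
      using bounded_imp_convergent_subsequence by blast
    define p where "p = s \<circ> t"
    have p: "strict_mono p" unfolding p_def by (rule strict_mono_o[OF s(1) t(1)])
    have fc: "(\<lambda>n. f (U (p n))) \<longlonglongrightarrow> c" using t(2) by (simp add: p_def o_def)
    obtain v' w' where w': "\<And>n. w' n \<in> convex hull ((\<lambda>n. U (p n)) ` {n..})" "w' \<longlonglongrightarrow> v'"
      by (rule convex_hull_tails_converge[of "\<lambda>n. U (p n)" K, OF UK]) blast
    have "(\<lambda>n. U (p n) \<bullet> u m) \<longlonglongrightarrow> v \<bullet> u m" for m
      using LIMSEQ_subseq_LIMSEQ[OF lim_v p] by (simp add: o_def)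
    then have "v' \<bullet> u m = v \<bullet> u m" for m
      by (rule convex_hull_tails_limit[OF bounded_linear_inner_left _ w'])
    then have "range u \<subseteq> {x. (v' - v) \<bullet> x = 0}" by (auto simp: inner_diff_left)
    moreover have "subspace {x. (v' - v) \<bullet> x = 0}" by (auto simp: subspace_def inner_add_right)
    ultimately have "span (range u) \<subseteq> {x. (v' - v) \<bullet> x = 0}" by (rule span_minimal)
    then have orth: "(v' - v) \<bullet> x = 0" if "x \<in> span (range u)" for x using that by blast
    \<comment> \<open>\<open>v' - v\<close> is orthogonal to the span, yet it is the limit of the
      elements \<open>w' n - w n\<close> of the span.\<close>
    have "(\<lambda>n. (v' - v) \<bullet> (w' n - w n)) \<longlonglongrightarrow> (v' - v) \<bullet> (v' - v)"
      by (intro tendsto_intros w(2) w'(2))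
    moreover have "(v' - v) \<bullet> (w' n - w n) = 0" for n
      using inspan[OF w'(1)] inspan[where s = id] w(1) by (intro orth span_diff) (auto simp: id_def)
    ultimately have "(v' - v) \<bullet> (v' - v) = 0" using LIMSEQ_unique[OF tendsto_const] by fastforce
    then have "v' = v" by simp
    then have "f v = c" using convex_hull_tails_limit[OF f fc w'] by simp
    then have "(\<lambda>n. f (U (p n))) \<longlonglongrightarrow> f v" using fc by simp
    then have "\<exists>n. dist (f (U (p n))) (f v) < \<epsilon>" using metric_LIMSEQ_D \<epsilon>(1) by blast
    then show False using s(2) by (simp add: p_def)
  qed
  with r show thesis using that unfolding U_def by blast
qed

section \<open>Translations in H1\<close>

lemma weak_gradient_translate:
  assumes u: "square_integrable u" and g: "square_integrable g" and w: "weak_gradient u g"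
  shows "weak_gradient (\<lambda>x. u (x + y)) (\<lambda>x. g (x + y))"
  unfolding weak_gradient_def
proof (intro allI impI ballI)
  fix \<phi> :: "'a \<Rightarrow> real" and e :: 'a assume \<phi>: "test_function \<phi>" and e: "e \<in> Basis"
  note [measurable] = square_integrable_measurable[OF u] square_integrable_measurable[OF g]
    square_integrable_measurable[OF test_function_square_integrable[OF \<phi>]]
    square_integrable_measurable[OF test_function_derivative_square_integrable[OF \<phi> e]]
  have "(LINT x|lborel. u (x + y) * frechet_derivative \<phi> (at (x + y + - y)) e) =
      (LINT x|lborel. u x * frechet_derivative \<phi> (at (x + - y)) e)"
    by (rule integral_lborel_translate) (auto intro!: borel_measurable_times measurable_compose[where f = "\<lambda>x. x + - y"])
  also have "\<dots> = (LINT x|lborel. u x * frechet_derivative (\<lambda>x. \<phi> (x + - y)) (at x) e)"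
    by (simp only: frechet_derivative_translate[OF test_function_differentiable[OF \<phi>]])
  also have "\<dots> = - (LINT x|lborel. (g x \<bullet> e) * \<phi> (x + - y))"
    using w test_function_translate[OF \<phi>] e unfolding weak_gradient_def by blast
  also have "(LINT x|lborel. (g x \<bullet> e) * \<phi> (x + - y)) = (LINT x|lborel. (g (x + y) \<bullet> e) * \<phi> (x + y + - y))"
    by (rule integral_lborel_translate[symmetric]) measurable
  finally show "(LINT x|lborel. u (x + y) * frechet_derivative \<phi> (at x) e) = - (LINT x|lborel. (g (x + y) \<bullet> e) * \<phi> x)"
    by simp
qed

definition translate_H1 :: "'a::euclidean_space \<Rightarrow> 'a H1 \<Rightarrow> 'a H1" where
  "translate_H1 y u = H1_of_fun (\<lambda>x. fun_of_H1 u (x + y))"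

lemma fun_of_translate_H1: "AE x in lborel. fun_of_H1 (translate_H1 y u) x = fun_of_H1 u (x + y)"
  and grad_translate_H1: "AE x in lborel. grad_H1 (translate_H1 y u) x = grad_H1 u (x + y)"
  unfolding translate_H1_def
  by (rule H1_of_fun[OF square_integrable_translate square_integrable_translate weak_gradient_translate];
      rule grad_H1 square_integrable_fun_of_H1)+

section \<open>Quartic variational problems\<close>

text \<open>\<open>M\<close> is a four-linear form behind the quartic part. Only the symmetries of
  \<open>\<beta> i j * u i * v i * w j * z j\<close>, summed over \<open>i\<close> and
  \<open>j\<close>, are required: exchange within a pair and exchange of the pairs. In general
  \<open>v\<close> and \<open>w\<close> cannot be exchanged.\<close>

locale quartic_problem =
  fixes B :: "'x::real_inner \<Rightarrow> 'x \<Rightarrow> real" and M :: "'x \<Rightarrow> 'x \<Rightarrow> 'x \<Rightarrow> 'x \<Rightarrow> real" and c K :: real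
  assumes B_bilinear: "bounded_bilinear B" and B_sym: "B u v = B v u"
    and c: "0 < c" and B_coercive: "c * (norm u)\<^sup>2 \<le> B u u"
    and M_linear: "linear (M u v w)"
    and M_sym: "M u v w z = M v u w z" "M u v w z = M w z u v"
    and K: "0 \<le> K" and M_bound: "\<bar>M u v w z\<bar> \<le> K * norm u * norm v * norm w * norm z"
begin

definition Q :: "'x \<Rightarrow> real" where "Q u = M u u u u"

definition E :: "'x \<Rightarrow> real" where "E u = 1/2 * B u u - 1/4 * Q u"

definition critical :: "'x \<Rightarrow> bool" where "critical u \<longleftrightarrow> (\<forall>h. B u h = M u u u h)"

text \<open>The terms of order at least two in \<open>Q (u + h)\<close>. Those of order two do not
  merge into one, since \<open>M u u h h\<close> and \<open>M u h u h\<close> differ in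
  general.\<close>

definition R :: "'x \<Rightarrow> 'x \<Rightarrow> real" where
  "R u h = 2 * M u u h h + 4 * M u h u h + 4 * M u h h h + Q h"

interpretation B: bounded_bilinear B by (rule B_bilinear)

lemma M_add: "M u v w (z + z') = M u v w z + M u v w z'"
    "M u v (w + w') z = M u v w z + M u v w' z"
    "M u (v + v') w z = M u v w z + M u v' w z"
    "M (u + u') v w z = M u v w z + M u' v w z"
proof -
  have 4: "M u v w (z + z') = M u v w z + M u v w z'" for u v w z z'
    by (rule linear_add[OF M_linear])
  have 3: "M u v (w + w') z = M u v w z + M u v w' z" for u v w w' z
    using 4[of u v z w w'] M_sym by metis
  show "M u v w (z + z') = M u v w z + M u v w z'" by (rule 4)
  show "M u v (w + w') z = M u v w z + M u v w' z" by (rule 3)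
  show "M u (v + v') w z = M u v w z + M u v' w z" using 4[of w z u v v'] M_sym(2) by metis
  show "M (u + u') v w z = M u v w z + M u' v w z" using 3[of w z u u' v] M_sym(2) by metis
qed

lemma M_scaleR: "M u v w (t *\<^sub>R z) = t * M u v w z"
    "M u v (t *\<^sub>R w) z = t * M u v w z"
    "M u (t *\<^sub>R v) w z = t * M u v w z"
    "M (t *\<^sub>R u) v w z = t * M u v w z"
proof -
  have 4: "M u v w (t *\<^sub>R z) = t * M u v w z" for u v w z
    using linear_cmul[OF M_linear] by simp
  have 3: "M u v (t *\<^sub>R w) z = t * M u v w z" for u v w z
    using 4[of u v z w] M_sym by metis
  show "M u v w (t *\<^sub>R z) = t * M u v w z" by (rule 4)
  show "M u v (t *\<^sub>R w) z = t * M u v w z" by (rule 3)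
  show "M u (t *\<^sub>R v) w z = t * M u v w z" using 4[of w z u v] M_sym(2) by metis
  show "M (t *\<^sub>R u) v w z = t * M u v w z" using 3[of w z u v] M_sym(2) by metis
qed

lemma Q_scaleR: "Q (t *\<^sub>R u) = t ^ 4 * Q u"
  by (simp add: Q_def M_scaleR power4_eq_xxxx)

lemma Q_add: "Q (u + h) = Q u + 4 * M u u u h + R u h"
proof -
  have first: "M u u h u = M u u u h" "M u h u u = M u u u h" "M h u u u = M u u u h"
    using M_sym by metis+
  have second: "M h h u u = M u u h h" "M u h h u = M u h u h" "M h u u h = M u h u h" "M h u h u = M u h u h"
    using M_sym by metis+
  have third: "M h u h h = M u h h h" "M h h u h = M u h h h" "M h h h u = M u h h h"
    using M_sym by metis+
  show ?thesis
    unfolding Q_def R_def M_add by (simp add: first second third)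
qed

lemma B_add_add: "B (u + h) (u + h) = B u u + 2 * B u h + B h h"
  by (simp add: B.add_left B.add_right B_sym[of h u])

lemma B_scaleR_scaleR: "B (t *\<^sub>R u) (t *\<^sub>R u) = t\<^sup>2 * B u u"
  by (simp add: B.scaleR_left B.scaleR_right power2_eq_square)

lemma B_nonneg: "0 \<le> B u u"
  using B_coercive[of u] c by (meson mult_nonneg_nonneg less_imp_le order_trans zero_le_power2)

lemma B_pos: "u \<noteq> 0 \<Longrightarrow> 0 < B u u"
  using B_coercive[of u] c by (smt (verit) mult_pos_pos zero_less_norm_iff zero_less_power)

lemma B_bound: obtains b where "0 \<le> b" "\<And>u v. \<bar>B u v\<bar> \<le> b * norm u * norm v"
proof -
  obtain b where "b \<ge> 0" "\<And>u v. norm (B u v) \<le> norm u * norm v * b"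
    using B.nonneg_bounded by blast
  then show thesis by (intro that[of b]) (simp_all add: mult_ac)
qed

text \<open>\<open>norm h \<le> 1\<close> lowers the cubic and the quartic terms to second
  order.\<close>

lemma R_bound: "norm h \<le> 1 \<Longrightarrow> norm u \<le> A \<Longrightarrow> \<bar>R u h\<bar> \<le> K * (6 * A\<^sup>2 + 4 * A + 1) * (norm h)\<^sup>2"
proof -
  assume h: "norm h \<le> 1" and u: "norm u \<le> A"
  have A: "0 \<le> A" using u norm_ge_zero order_trans by blast
  have hp: "norm h * norm h * norm h \<le> norm h * norm h"
    using h by (simp add: mult_left_le)
  have hp4: "norm h * norm h * norm h * norm h \<le> norm h * norm h"
    using mult_mono[OF hp h] by simp
  have 1: "\<bar>M u u h h\<bar> \<le> K * A\<^sup>2 * (norm h)\<^sup>2" 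
  proof -
    have "K * norm u * norm u * norm h * norm h \<le> K * A * A * norm h * norm h"
      using u A K by (intro mult_right_mono mult_mono) auto
    then show ?thesis using M_bound[of u u h h] by (simp add: power2_eq_square mult.assoc)
  qed
  have 2: "\<bar>M u h u h\<bar> \<le> K * A\<^sup>2 * (norm h)\<^sup>2" 
  proof -
    have "K * norm u * norm h * norm u * norm h \<le> K * A * norm h * A * norm h"
      using u A K by (intro mult_right_mono mult_mono) auto
    then show ?thesis using M_bound[of u h u h] by (simp add: power2_eq_square mult_ac)
  qed
  have 3: "\<bar>M u h h h\<bar> \<le> K * A * (norm h)\<^sup>2" 
  proof -
    have "(K * norm u) * (norm h * norm h * norm h) \<le> (K * A) * (norm h * norm h)"
      by (rule mult_mono[OF _ hp]) (use u A K in \<open>auto intro!: mult_left_mono\<close>)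
    then show ?thesis using M_bound[of u h h h] by (simp add: power2_eq_square mult.assoc)
  qed
  have 4: "\<bar>Q h\<bar> \<le> K * (norm h)\<^sup>2" 
  proof -
    have "K * (norm h * norm h * norm h * norm h) \<le> K * (norm h * norm h)"
      using K hp4 by (intro mult_left_mono) auto
    then show ?thesis using M_bound[of h h h h] by (simp add: Q_def power2_eq_square mult.assoc)
  qed
  have "\<bar>R u h\<bar> \<le> 2 * \<bar>M u u h h\<bar> + 4 * \<bar>M u h u h\<bar> + 4 * \<bar>M u h h h\<bar> + \<bar>Q h\<bar>"
    unfolding R_def by linarith
  also have "\<dots> \<le> 2 * (K * A\<^sup>2 * (norm h)\<^sup>2) + 4 * (K * A\<^sup>2 * (norm h)\<^sup>2) + 4 * (K * A * (norm h)\<^sup>2) + K * (norm h)\<^sup>2"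
    using 1 2 3 4 by linarith
  also have "\<dots> = K * (6 * A\<^sup>2 + 4 * A + 1) * (norm h)\<^sup>2" by (simp add: algebra_simps)
  finally show ?thesis .
qed

lemma E_add: "E (u + h) = E u + (B u h - M u u u h) + (1/2 * B h h - 1/4 * R u h)"
  unfolding E_def Q_add B_add_add by (simp add: algebra_simps)

lemma critical_imp_derivative_zero:
  assumes "critical u" shows "(E has_derivative (\<lambda>h. 0)) (at u)"
proof -
  obtain b where b: "0 \<le> b" "\<And>u v. \<bar>B u v\<bar> \<le> b * norm u * norm v" using B_bound by blast
  define C where "C = b + K * (6 * (norm u)\<^sup>2 + 4 * norm u + 1)"
  show ?thesis
  proof (rule has_derivativeI_sandwich[where e = 1 and H = "\<lambda>y. C * norm (y - u)"])
    fix y assume y: "y \<noteq> u" "dist y u < 1"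
    define h where "h = y - u"
    have h: "norm h \<le> 1" "h \<noteq> 0" "y = u + h" using y by (auto simp: h_def dist_norm)
    have "E y - E u = 1/2 * B h h - 1/4 * R u h"
      using assms unfolding h(3) E_add critical_def by simp
    moreover have "\<bar>B h h\<bar> \<le> b * (norm h)\<^sup>2" using b(2)[of h h] by (simp add: power2_eq_square mult.assoc)
    moreover have "\<bar>R u h\<bar> \<le> K * (6 * (norm u)\<^sup>2 + 4 * norm u + 1) * (norm h)\<^sup>2"
      by (rule R_bound[OF h(1) order_refl])
    ultimately have "\<bar>E y - E u\<bar> \<le> C * (norm h)\<^sup>2"
      unfolding C_def distrib_right by linarith
    then show "norm (E y - E u - 0) / norm (y - u) \<le> C * norm (y - u)"
      using h by (simp add: h_def[symmetric] power2_eq_square divide_le_eq mult.assoc)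
  next
    have "((\<lambda>y. C * norm (y - u)) \<longlongrightarrow> C * norm (u - u)) (at u)" by (intro tendsto_intros)
    then show "((\<lambda>y. C * norm (y - u)) \<longlongrightarrow> 0) (at u)" by simp
  qed simp_all
qed

text \<open>Along the line through \<open>u\<close> in direction \<open>h\<close> the energy is a
  polynomial, and its linear coefficient is the defect of the equation.\<close>

lemma derivative_zero_imp_critical:
  assumes "(E has_derivative (\<lambda>h. 0)) (at u)" shows "critical u"
  unfolding critical_def
proof
  fix h
  have "((\<lambda>t. E (u + t *\<^sub>R h)) has_derivative (\<lambda>t. 0)) (at 0)"
    by (rule has_derivative_compose[where f = "\<lambda>t. u + t *\<^sub>R h" and f' = "\<lambda>t. t *\<^sub>R h" and g' = "\<lambda>h. 0"])
      (use assms in \<open>auto intro!: derivative_eq_intros\<close>)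
  then have 1: "((\<lambda>t. E (u + t *\<^sub>R h)) has_real_derivative 0) (at 0)"
    by (rule has_derivative_imp_has_field_derivative) simp
  have "E (u + t *\<^sub>R h) = E u + t * (B u h - M u u u h) + (1/2 * t\<^sup>2 * B h h
      - 1/4 * (t\<^sup>2 * (2 * M u u h h + 4 * M u h u h) + t ^ 3 * (4 * M u h h h) + t ^ 4 * Q h))" for t
    unfolding E_add R_def Q_scaleR M_scaleR B.scaleR_left B.scaleR_right
    by (simp add: algebra_simps power2_eq_square power3_eq_cube)
  moreover have "((\<lambda>t. E u + t * (B u h - M u u u h) + (1/2 * t\<^sup>2 * B h h
      - 1/4 * (t\<^sup>2 * (2 * M u u h h + 4 * M u h u h) + t ^ 3 * (4 * M u h h h) + t ^ 4 * Q h)))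
      has_real_derivative (B u h - M u u u h)) (at 0)"
    by (auto intro!: derivative_eq_intros)
  ultimately have "((\<lambda>t. E (u + t *\<^sub>R h)) has_real_derivative (B u h - M u u u h)) (at 0)" by simp
  from DERIV_unique[OF this 1] show "B u h = M u u u h" by simp
qed

lemma critical_iff_derivative_zero: "critical u \<longleftrightarrow> (E has_derivative (\<lambda>h. 0)) (at u)"
  using critical_imp_derivative_zero derivative_zero_imp_critical by blast

lemma critical_imp_Q_eq: "critical u \<Longrightarrow> Q u = B u u"
  by (simp add: critical_def Q_def)

lemma critical_imp_E_eq: "critical u \<Longrightarrow> E u = 1/4 * B u u"
  by (simp add: E_def critical_imp_Q_eq)

section \<open>The best constant for the quartic part and its maximizing sequences\<close>

definition S :: real where "S = Sup (Q ` {v. B v v = 1})"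

lemma norm_sphere: "B v v = 1 \<Longrightarrow> norm v \<le> sqrt (1/c)"
proof -
  assume "B v v = 1"
  then have "c * (norm v)\<^sup>2 \<le> 1" using B_coercive[of v] by simp
  then have "(norm v)\<^sup>2 \<le> 1 / c" using c by (simp add: pos_le_divide_eq mult.commute)
  then show ?thesis by (rule real_le_rsqrt)
qed

lemma Q_bdd_above: "bdd_above (Q ` {v. B v v = 1})"
proof (rule bdd_aboveI2)
  fix v assume "v \<in> {v. B v v = 1}"
  then have n: "norm v \<le> sqrt (1/c)" using norm_sphere by simp
  have "Q v \<le> K * norm v * norm v * norm v * norm v" unfolding Q_def using M_bound[of v v v v] by linarith
  also have "\<dots> = K * norm v ^ 4" by (simp add: power4_eq_xxxx mult.assoc)
  also have "\<dots> \<le> K * sqrt (1/c) ^ 4" using n K by (intro mult_left_mono power_mono) auto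
  finally show "Q v \<le> K * sqrt (1/c) ^ 4" .
qed

lemma Q_le: "Q v \<le> S * (B v v)\<^sup>2"
proof (cases "v = 0")
  case True
  then show ?thesis using Q_scaleR[of 0 v] by (simp add: B.zero_left)
next
  case False
  define t where "t = 1 / sqrt (B v v)"
  have p: "0 < B v v" by (rule B_pos[OF False])
  have t2: "t\<^sup>2 = 1 / B v v" using p by (simp add: t_def power_divide)
  have t4: "t ^ 4 = 1 / (B v v)\<^sup>2"
  proof -
    have "t ^ 4 = (t\<^sup>2)\<^sup>2" by simp
    then show ?thesis unfolding t2 by (simp add: power_divide)
  qed
  have "B (t *\<^sub>R v) (t *\<^sub>R v) = 1" using p by (simp add: B_scaleR_scaleR t2)
  then have "Q (t *\<^sub>R v) \<le> S" unfolding S_def using Q_bdd_above by (intro cSup_upper) auto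
  then show ?thesis using p by (simp add: Q_scaleR t4 divide_le_eq mult.commute)
qed

text \<open>Comparing with the competitors \<open>v n + t h\<close>, for which the estimate of \<open>Q\<close> has a second order error,
  replaces Ekeland's variational principle.\<close>

lemma maximizing_sequence_almost_critical:
  assumes v: "\<And>n. B (v n) (v n) = 1" and lim: "(\<lambda>n. Q (v n)) \<longlonglongrightarrow> S"
  shows "(\<lambda>n. M (v n) (v n) (v n) h - S * B (v n) h) \<longlonglongrightarrow> 0"
proof (cases "h = 0")
  case True
  then show ?thesis using linear_0[OF M_linear] by (simp add: B.zero_right)
next
  case False
  define h' where "h' = (1 / norm h) *\<^sub>R h"
  have h': "norm h' = 1" using False by (simp add: h'_def)
  obtain b where b: "0 \<le> b" "\<And>u v. \<bar>B u v\<bar> \<le> b * norm u * norm v" using B_bound by blast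
  define A where "A = sqrt (1/c)"
  have A: "0 \<le> A" using c by (simp add: A_def)
  have vA: "norm (v n) \<le> A" for n unfolding A_def by (rule norm_sphere[OF v])
  define H where "H = B h' h'"
  have H: "0 \<le> H" unfolding H_def by (rule B_nonneg)
  \<comment> \<open>The coefficient of all second order terms: those of \<open>S\<close> times the
    squared quadratic part, with \<open>b * A\<close> bounding \<open>B (v n) h'\<close>, and those
    of \<open>R\<close>.\<close>
  define C where "C = \<bar>S\<bar> * (4 * (b * A)\<^sup>2 + 2 * H + 4 * (b * A) * H + H\<^sup>2) + K * (6 * A\<^sup>2 + 4 * A + 1)"
  have C: "0 \<le> C" unfolding C_def using b A H K by (intro add_nonneg_nonneg mult_nonneg_nonneg) auto
  define x where "x = (\<lambda>n. M (v n) (v n) (v n) h' - S * B (v n) h')"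
  \<comment> \<open>Expand both sides of \<open>Q \<le> S * B^2\<close> at
    \<open>v n + t *\<^sub>R h'\<close>. The terms of order zero differ by
    \<open>S - Q (v n)\<close>, those of order one by \<open>4 * t * x n\<close>.\<close>
  have key: "4 * t * x n \<le> (S - Q (v n)) + C * t\<^sup>2" if t: "\<bar>t\<bar> \<le> 1" for t n
  proof -
    define \<beta> where "\<beta> = B (v n) h'"
    have "\<bar>\<beta>\<bar> \<le> b * norm (v n)" using b(2)[of "v n" h'] h' by (simp add: \<beta>_def)
    also have "\<dots> \<le> b * A" using b(1) vA by (rule mult_left_mono[rotated])
    finally have \<beta>: "\<bar>\<beta>\<bar> \<le> b * A" .
    have "Q (v n + t *\<^sub>R h') \<le> S * (B (v n + t *\<^sub>R h') (v n + t *\<^sub>R h'))\<^sup>2" by (rule Q_le)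
    also have "B (v n + t *\<^sub>R h') (v n + t *\<^sub>R h') = 1 + 2 * t * \<beta> + t\<^sup>2 * H"
      by (simp add: B_add_add B.scaleR_left B.scaleR_right v \<beta>_def H_def power2_eq_square)
    also have "(1 + 2 * t * \<beta> + t\<^sup>2 * H)\<^sup>2 = 1 + 4 * t * \<beta> + t\<^sup>2 * (4 * \<beta>\<^sup>2 + 2 * H + 4 * t * \<beta> * H + t\<^sup>2 * H\<^sup>2)"
      by (simp add: power2_eq_square algebra_simps)
    finally have 1: "Q (v n + t *\<^sub>R h') \<le> S + 4 * t * (S * \<beta>) + S * (t\<^sup>2 * (4 * \<beta>\<^sup>2 + 2 * H + 4 * t * \<beta> * H + t\<^sup>2 * H\<^sup>2))"
      by (simp add: algebra_simps)
    have t2: "t\<^sup>2 \<le> 1" using t by (simp add: abs_square_le_1)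
    have "\<bar>4 * \<beta>\<^sup>2 + 2 * H + 4 * t * \<beta> * H + t\<^sup>2 * H\<^sup>2\<bar> \<le> 4 * (b * A)\<^sup>2 + 2 * H + 4 * (b * A) * H + H\<^sup>2"
    proof -
      have a1: "\<beta>\<^sup>2 \<le> (b * A)\<^sup>2" using \<beta> abs_le_square_iff by fastforce
      have "\<bar>t * \<beta>\<bar> \<le> 1 * (b * A)" unfolding abs_mult using t \<beta> by (intro mult_mono) auto
      then have a2: "\<bar>t * \<beta> * H\<bar> \<le> b * A * H" unfolding abs_mult[of "t * \<beta>"] using H by (intro mult_mono) auto
      have a3: "t\<^sup>2 * H\<^sup>2 \<le> 1 * H\<^sup>2" using t2 by (intro mult_right_mono) auto
      have a4: "0 \<le> t\<^sup>2 * H\<^sup>2" "0 \<le> \<beta>\<^sup>2" by simp_all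
      have eq: "4 * t * \<beta> * H = 4 * (t * \<beta> * H)" "4 * (b * A) * H = 4 * (b * A * H)" by simp_all
      show ?thesis using a1 a2 a3 a4 H unfolding eq by linarith
    qed
    then have "\<bar>S\<bar> * \<bar>4 * \<beta>\<^sup>2 + 2 * H + 4 * t * \<beta> * H + t\<^sup>2 * H\<^sup>2\<bar> \<le>
       \<bar>S\<bar> * (4 * (b * A)\<^sup>2 + 2 * H + 4 * (b * A) * H + H\<^sup>2)"
      by (rule mult_left_mono) simp
    then have "S * (4 * \<beta>\<^sup>2 + 2 * H + 4 * t * \<beta> * H + t\<^sup>2 * H\<^sup>2) \<le>
       \<bar>S\<bar> * (4 * (b * A)\<^sup>2 + 2 * H + 4 * (b * A) * H + H\<^sup>2)"
      unfolding abs_mult[symmetric] by (rule order_trans[OF abs_ge_self])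
    then have "t\<^sup>2 * (S * (4 * \<beta>\<^sup>2 + 2 * H + 4 * t * \<beta> * H + t\<^sup>2 * H\<^sup>2)) \<le>
       t\<^sup>2 * (\<bar>S\<bar> * (4 * (b * A)\<^sup>2 + 2 * H + 4 * (b * A) * H + H\<^sup>2))"
      by (rule mult_left_mono) simp
    then have 2: "S * (t\<^sup>2 * (4 * \<beta>\<^sup>2 + 2 * H + 4 * t * \<beta> * H + t\<^sup>2 * H\<^sup>2)) \<le>
       \<bar>S\<bar> * (4 * (b * A)\<^sup>2 + 2 * H + 4 * (b * A) * H + H\<^sup>2) * t\<^sup>2"
      by (simp only: mult_ac)
    have "\<bar>R (v n) (t *\<^sub>R h')\<bar> \<le> K * (6 * A\<^sup>2 + 4 * A + 1) * (norm (t *\<^sub>R h'))\<^sup>2"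
      by (rule R_bound[OF _ vA]) (use t h' in simp)
    then have 3: "- R (v n) (t *\<^sub>R h') \<le> K * (6 * A\<^sup>2 + 4 * A + 1) * t\<^sup>2" using h' by simp
    have "Q (v n + t *\<^sub>R h') = Q (v n) + 4 * t * M (v n) (v n) (v n) h' + R (v n) (t *\<^sub>R h')"
      by (simp add: Q_add M_scaleR)
    then have "4 * t * M (v n) (v n) (v n) h' - 4 * t * (S * \<beta>) \<le> (S - Q (v n)) + C * t\<^sup>2"
      using 1 2 3 unfolding C_def distrib_right by linarith
    then show ?thesis by (simp add: x_def \<beta>_def right_diff_distrib)
  qed
  have "x \<longlonglongrightarrow> 0"
  proof (rule LIMSEQ_I)
    fix e :: real assume e: "e > 0"
    \<comment> \<open>With the steps \<open>\<tau>\<close> and \<open>- \<tau>\<close> and a deficit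
      \<open>S - Q (v n)\<close> below the square of \<open>\<tau>\<close>, division by
      \<open>\<tau>\<close> leaves
      \<open>4 * \<bar>x n\<bar> \<le> \<tau> * (1 + C)\<close>.\<close>
    define \<tau> where "\<tau> = min 1 (e / (1 + C))"
    have \<tau>: "0 < \<tau>" "\<tau> \<le> 1" "\<tau> * (1 + C) \<le> e"
    proof -
      show "0 < \<tau>" "\<tau> \<le> 1" using e C by (auto simp: \<tau>_def)
      have "\<tau> \<le> e / (1 + C)" by (simp add: \<tau>_def)
      then show "\<tau> * (1 + C) \<le> e" using C by (simp add: pos_le_divide_eq)
    qed
    have "eventually (\<lambda>n. S - \<tau>\<^sup>2 < Q (v n)) sequentially"
      using \<tau>(1) by (intro order_tendstoD(1)[OF lim]) simp
    then obtain N where N: "\<And>n. n \<ge> N \<Longrightarrow> S - \<tau>\<^sup>2 < Q (v n)" by (auto simp: eventually_sequentially)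
    have "norm (x n - 0) < e" if "n \<ge> N" for n
    proof -
      have a: "S - Q (v n) < \<tau>\<^sup>2" using N[OF that] by simp
      have "4 * \<tau> * x n \<le> \<tau>\<^sup>2 + C * \<tau>\<^sup>2" "4 * (- \<tau>) * x n \<le> \<tau>\<^sup>2 + C * (- \<tau>)\<^sup>2"
        using key[of \<tau> n] key[of "- \<tau>" n] \<tau> a by simp_all
      then have "\<tau> * (4 * \<bar>x n\<bar>) \<le> \<tau> * (\<tau> * (1 + C))"
        by (cases "x n \<ge> 0") (simp_all add: power2_eq_square algebra_simps)
      then have "4 * \<bar>x n\<bar> \<le> \<tau> * (1 + C)" using \<tau>(1) by simp
      then show ?thesis using \<tau>(3) e by simp
    qed
    then show "\<exists>no. \<forall>n\<ge>no. norm (x n - 0) < e" by blast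
  qed
  then have "(\<lambda>n. norm h * x n) \<longlonglongrightarrow> norm h * 0" by (intro tendsto_intros)
  moreover have "norm h * x n = M (v n) (v n) (v n) h - S * B (v n) h" for n
    using False by (simp add: x_def h'_def M_scaleR B.scaleR_right right_diff_distrib)
  ultimately show ?thesis by simp
qed

text \<open>The sequence passes its approximate equation with the multiplier \<open>S\<close> on to
  \<open>w\<close>. The two sides have different homogeneity, so scaling removes the
  multiplier.\<close>

lemma weak_limit_critical:
  assumes v: "\<And>n. B (v n) (v n) = 1" and lim: "(\<lambda>n. Q (v n)) \<longlonglongrightarrow> S" and S: "0 < S"
    and w: "\<And>f :: 'x \<Rightarrow> real. bounded_linear f \<Longrightarrow> (\<lambda>n. f (v n)) \<longlonglongrightarrow> f w" "w \<noteq> 0"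
    and M: "\<And>h. (\<lambda>n. M (v n) (v n) (v n) h) \<longlonglongrightarrow> M w w w h"
  obtains z where "z \<noteq> 0" "critical z" "E z \<le> 1 / (4 * S)"
proof -
  have Bl: "(\<lambda>n. B (v n) h) \<longlonglongrightarrow> B w h" for h by (rule w(1)[OF B.bounded_linear_left])
  have eq: "M w w w h = S * B w h" for h
  proof -
    have "(\<lambda>n. M (v n) (v n) (v n) h - S * B (v n) h) \<longlonglongrightarrow> M w w w h - S * B w h"
      by (intro tendsto_intros M Bl)
    then have "M w w w h - S * B w h = 0"
      using maximizing_sequence_almost_critical[OF v lim] LIMSEQ_unique by blast
    then show ?thesis by simp
  qed
  \<comment> \<open>Weak lower semicontinuity of \<open>B\<close>, from positivity at
    \<open>v n - w\<close>. Only \<open>B w w \<le> 1\<close> can be expected, since mass may be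
    lost in the limit.\<close>
  have "2 * B (v n) w \<le> 1 + B w w" for n
  proof -
    have "0 \<le> B (v n - w) (v n - w)" by (rule B_nonneg)
    then show ?thesis by (simp add: B.diff_left B.diff_right v B_sym[of w "v n"])
  qed
  then have "2 * B w w \<le> 1 + B w w"
    by (intro LIMSEQ_le_const2[where X = "\<lambda>n. 2 * B (v n) w"] tendsto_intros Bl) auto
  then have Bw: "B w w \<le> 1" by simp
  \<comment> \<open>The cubic side gains \<open>s ^ 3\<close>, the linear side \<open>s\<close>, so
    \<open>s * s = 1 / S\<close> cancels the multiplier.\<close>
  define s where "s = 1 / sqrt S"
  have s: "s \<noteq> 0" "s * s = 1 / S" using S by (simp_all add: s_def)
  show thesis
  proof (rule that[of "s *\<^sub>R w"])
    show "s *\<^sub>R w \<noteq> 0" using s w(2) by simp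
    have "M (s *\<^sub>R w) (s *\<^sub>R w) (s *\<^sub>R w) h = s * ((s * s) * M w w w h)" for h
      by (simp add: M_scaleR mult_ac)
    then show c: "critical (s *\<^sub>R w)"
      unfolding critical_def using S by (simp add: eq s(2) B.scaleR_left)
    have "E (s *\<^sub>R w) = 1/4 * ((1 / S) * B w w)"
      unfolding critical_imp_E_eq[OF c] B_scaleR_scaleR power2_eq_square s(2) by simp
    also have "\<dots> \<le> 1/4 * ((1 / S) * 1)" using S Bw by (intro mult_left_mono) auto
    finally show "E (s *\<^sub>R w) \<le> 1 / (4 * S)" by simp
  qed
qed

lemma maximizing_sequence_exists:
  assumes "(u :: 'x) \<noteq> 0"
  obtains v where "\<And>n. B (v n) (v n) = 1" "(\<lambda>n. Q (v n)) \<longlonglongrightarrow> S"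
proof -
  define t where "t = 1 / sqrt (B u u)"
  have "B (t *\<^sub>R u) (t *\<^sub>R u) = 1" using B_pos[OF assms] by (simp add: B_scaleR_scaleR t_def power_divide)
  then have ne: "Q ` {v. B v v = 1} \<noteq> {}" by blast
  have "\<exists>v. B v v = 1 \<and> S - 1 / Suc n < Q v" for n
    using less_cSupD[OF ne, of "S - 1 / Suc n"] by (auto simp: S_def)
  then obtain v where v: "\<And>n. B (v n) (v n) = 1" "\<And>n. S - 1 / Suc n < Q (v n)" by metis
  have "Q (v n) \<le> S" for n using Q_le[of "v n"] v(1) by simp
  moreover have "(\<lambda>n. S - 1 / Suc n) \<longlonglongrightarrow> S - 0" by (intro tendsto_intros LIMSEQ_Suc[OF lim_1_over_n])
  ultimately have "(\<lambda>n. Q (v n)) \<longlonglongrightarrow> S"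
    using less_imp_le[OF v(2)]
    by (intro tendsto_sandwich[of "\<lambda>n. S - 1 / Suc n" "\<lambda>n. Q (v n)" sequentially "\<lambda>n. S" S])
      (simp_all add: always_eventually)
  with v(1) show thesis using that by blast
qed

text \<open>A nonzero solution has \<open>Q u = B u u > 0\<close>, and \<open>Q u\<close> is at most
  \<open>S * (B u u)^2\<close>. Thus the existence argument can start from a hypothetical ground
  state.\<close>

lemma critical_S_pos:
  assumes "u \<noteq> 0" "critical u" shows "0 < S"
proof (rule ccontr)
  assume "\<not> 0 < S"
  then have "S * (B u u)\<^sup>2 \<le> 0" by (intro mult_nonpos_nonneg) auto
  then show False using Q_le[of u] critical_imp_Q_eq[OF assms(2)] B_pos[OF assms(1)] by simp
qed

text \<open>For a solution the energy bound reads \<open>S * B u u \<le> 1\<close>, so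
  \<open>S * (B u u)^2 \<le> B u u = Q u\<close>, and the left side bounds
  \<open>Q v\<close>.\<close>

lemma least_energy_imp_maximizer:
  assumes u: "u \<noteq> 0" "critical u" and E: "E u \<le> 1 / (4 * S)" and v: "B v v = B u u"
  shows "Q v \<le> Q u"
proof -
  have S: "0 < S" by (rule critical_S_pos[OF u])
  have "S * B u u \<le> 1" using E S by (simp add: critical_imp_E_eq[OF u(2)] field_simps)
  then have "(S * B u u) * B u u \<le> 1 * B u u" by (rule mult_right_mono[OF _ B_nonneg])
  then show ?thesis using Q_le[of v] unfolding v critical_imp_Q_eq[OF u(2)]
    by (simp add: power2_eq_square mult.assoc)
qed

end

section \<open>Forms on H1\<close>

lemma L2sq_le_norm_H1: "L2sq (grad_H1 u) \<le> (norm u)\<^sup>2" "L2sq (fun_of_H1 u) \<le> (norm u)\<^sup>2"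
  for u :: "'a::euclidean_space H1"
proof -
  have "0 \<le> L2sq (grad_H1 u)" "0 \<le> L2sq (fun_of_H1 u)" by (auto intro!: Bochner_Integration.integral_nonneg)
  then show "L2sq (grad_H1 u) \<le> (norm u)\<^sup>2" "L2sq (fun_of_H1 u) \<le> (norm u)\<^sup>2"
    unfolding norm_H1_sq by linarith+
qed

definition L2_inner :: "'a::euclidean_space H1 \<Rightarrow> 'a H1 \<Rightarrow> real" where
  "L2_inner u v = (LINT x|lborel. fun_of_H1 u x * fun_of_H1 v x)"

lemma L2_inner_sym: "L2_inner u v = L2_inner v u"
  by (simp add: L2_inner_def mult.commute)

lemma L2_inner_self: "L2_inner u u = L2sq (fun_of_H1 u)"
  by (simp add: L2_inner_def power2_eq_square)

lemma L2_inner_add: "L2_inner (u + u') v = L2_inner u v + L2_inner u' v"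
proof -
  have "L2_inner (u + u') v = (LINT x|lborel. fun_of_H1 u x * fun_of_H1 v x + fun_of_H1 u' x * fun_of_H1 v x)"
    unfolding L2_inner_def
  proof (rule integral_cong_AE)
    show "AE x in lborel. fun_of_H1 (u + u') x * fun_of_H1 v x =
        fun_of_H1 u x * fun_of_H1 v x + fun_of_H1 u' x * fun_of_H1 v x"
      using fun_of_H1_add[of u u'] by eventually_elim (simp add: distrib_right)
  qed measurable
  also have "\<dots> = L2_inner u v + L2_inner u' v"
    unfolding L2_inner_def
    by (intro Bochner_Integration.integral_add square_integrable_mult square_integrable_fun_of_H1)
  finally show ?thesis .
qed

lemma L2_inner_scaleR: "L2_inner (t *\<^sub>R u) v = t * L2_inner u v"
proof -
  have "L2_inner (t *\<^sub>R u) v = (LINT x|lborel. t * (fun_of_H1 u x * fun_of_H1 v x))"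
    unfolding L2_inner_def
  proof (rule integral_cong_AE)
    show "AE x in lborel. fun_of_H1 (t *\<^sub>R u) x * fun_of_H1 v x = t * (fun_of_H1 u x * fun_of_H1 v x)"
      using fun_of_H1_scaleR[of t u] by eventually_elim simp
  qed measurable
  then show ?thesis by (simp add: L2_inner_def)
qed

lemma L2_inner_le: "\<bar>L2_inner u v\<bar> \<le> norm u * norm v"
proof -
  have "\<bar>L2_inner u v\<bar> \<le> sqrt (L2sq (fun_of_H1 u)) * sqrt (L2sq (fun_of_H1 v))"
    unfolding L2_inner_def by (intro L2_Cauchy_Schwarz square_integrable_fun_of_H1)
  also have "\<dots> \<le> norm u * norm v"
    by (intro mult_mono real_le_lsqrt L2sq_le_norm_H1) (auto intro!: Bochner_Integration.integral_nonneg)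
  finally show ?thesis .
qed

text \<open>In this form only the \<open>L2\<close> inner product has to be shown to be bilinear and bounded.\<close>

definition form_H1 :: "real \<Rightarrow> 'a::euclidean_space H1 \<Rightarrow> 'a H1 \<Rightarrow> real" where
  "form_H1 l u v = u \<bullet> v + (l - 1) * L2_inner u v"

lemma form_H1_self:
  "form_H1 l u u = (LINT x|lborel. (norm (grad_H1 u x))\<^sup>2 + l * (fun_of_H1 u x)\<^sup>2)"
proof -
  have "(LINT x|lborel. (norm (grad_H1 u x))\<^sup>2 + l * (fun_of_H1 u x)\<^sup>2) =
      L2sq (grad_H1 u) + l * (LINT x|lborel. (fun_of_H1 u x)\<^sup>2)"
    using grad_H1(1)[of u] square_integrable_fun_of_H1[of u]
    by (subst Bochner_Integration.integral_add) (auto simp: square_integrable_def)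
  also have "\<dots> = (norm u)\<^sup>2 + (l - 1) * L2_inner u u"
    unfolding norm_H1_sq L2_inner_self by (simp add: algebra_simps)
  finally show ?thesis by (simp add: form_H1_def power2_norm_eq_inner)
qed

text \<open>The L2 part lies between 0 and the full squared norm, so a negative coefficient
  \<open>l - 1\<close> costs at most \<open>1 - l\<close>.\<close>

lemma form_H1_coercive: "min 1 l * (norm u)\<^sup>2 \<le> form_H1 l u u"
proof -
  have "0 \<le> L2_inner u u" by (simp add: L2_inner_self)
  moreover have "L2_inner u u \<le> (norm u)\<^sup>2" unfolding L2_inner_self by (rule L2sq_le_norm_H1)
  ultimately have "(if l \<ge> 1 then 0 else (l - 1) * (norm u)\<^sup>2) \<le> (l - 1) * L2_inner u u"
    by (auto intro: mult_left_mono_neg)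
  then show ?thesis
    by (cases "l \<ge> 1") (simp_all add: form_H1_def power2_norm_eq_inner[symmetric] min_def algebra_simps)
qed

definition form_vec :: "('d::finite \<Rightarrow> real) \<Rightarrow> 'a::euclidean_space H1 ^ 'd \<Rightarrow> 'a H1 ^ 'd \<Rightarrow> real" where
  "form_vec lam u v = (\<Sum>i\<in>UNIV. form_H1 (lam i) (u $ i) (v $ i))"

lemma form_H1_sym: "form_H1 l u v = form_H1 l v u"
  by (simp add: form_H1_def inner_commute L2_inner_sym)

lemma form_H1_add: "form_H1 l (u + u') v = form_H1 l u v + form_H1 l u' v"
  by (simp add: form_H1_def L2_inner_add inner_add_left algebra_simps)

lemma form_H1_scaleR: "form_H1 l (t *\<^sub>R u) v = t * form_H1 l u v"
  by (simp add: form_H1_def L2_inner_scaleR algebra_simps)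

lemma form_H1_le: "\<bar>form_H1 l u v\<bar> \<le> (1 + \<bar>l - 1\<bar>) * (norm u * norm v)"
proof -
  have "\<bar>form_H1 l u v\<bar> \<le> \<bar>u \<bullet> v\<bar> + \<bar>l - 1\<bar> * \<bar>L2_inner u v\<bar>"
    unfolding form_H1_def abs_mult[symmetric] by (rule abs_triangle_ineq)
  also have "\<dots> \<le> norm u * norm v + \<bar>l - 1\<bar> * (norm u * norm v)"
    by (intro add_mono mult_left_mono Cauchy_Schwarz_ineq2 L2_inner_le) simp
  finally show ?thesis by (simp add: algebra_simps)
qed

lemma form_vec_sym: "form_vec lam u v = form_vec lam v u"
  unfolding form_vec_def by (intro sum.cong refl form_H1_sym)

lemma norm_vec_sq: "(norm u)\<^sup>2 = (\<Sum>i\<in>UNIV. (norm (u $ i))\<^sup>2)"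
  for u :: "'b::real_inner ^ 'd::finite"
  by (simp add: norm_vec_def L2_set_def sum_nonneg)

lemma norm_vec_nth_le: "norm (u $ i) \<le> norm u"
  for u :: "'b::real_inner ^ 'd::finite"
proof -
  have "(norm (u $ i))\<^sup>2 \<le> (norm u)\<^sup>2"
    unfolding norm_vec_sq by (intro member_le_sum) auto
  then show ?thesis by (rule power2_le_imp_le) simp
qed

lemma form_vec_bilinear: "bounded_bilinear (form_vec lam :: 'a::euclidean_space H1 ^ 'd::finite \<Rightarrow> _)"
proof
  fix u u' v v' :: "'a H1 ^ 'd" and t :: real
  have add: "form_vec lam (u + u') v = form_vec lam u v + form_vec lam u' v" for u u' v :: "'a H1 ^ 'd"
    by (simp add: form_vec_def form_H1_add sum.distrib)
  have scale: "form_vec lam (t *\<^sub>R u) v = t *\<^sub>R form_vec lam u v" for u v :: "'a H1 ^ 'd"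
    by (simp add: form_vec_def form_H1_scaleR sum_distrib_left)
  show "form_vec lam (u + u') v = form_vec lam u v + form_vec lam u' v" by (rule add)
  show "form_vec lam u (v + v') = form_vec lam u v + form_vec lam u v'"
    unfolding form_vec_sym[of lam u] by (rule add)
  show "form_vec lam (t *\<^sub>R u) v = t *\<^sub>R form_vec lam u v" by (rule scale)
  show "form_vec lam u (t *\<^sub>R v) = t *\<^sub>R form_vec lam u v"
    unfolding form_vec_sym[of lam u] by (rule scale)
  have "norm (form_vec lam u v) \<le> norm u * norm v * (\<Sum>i\<in>UNIV. 1 + \<bar>lam i - 1\<bar>)" for u v :: "'a H1 ^ 'd"
  proof -
    have "norm (form_vec lam u v) \<le> (\<Sum>i\<in>UNIV. \<bar>form_H1 (lam i) (u $ i) (v $ i)\<bar>)"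
      unfolding form_vec_def real_norm_def by (rule sum_abs)
    also have "\<dots> \<le> (\<Sum>i\<in>UNIV. (1 + \<bar>lam i - 1\<bar>) * (norm u * norm v))"
    proof (rule sum_mono)
      fix i
      have "\<bar>form_H1 (lam i) (u $ i) (v $ i)\<bar> \<le> (1 + \<bar>lam i - 1\<bar>) * (norm (u $ i) * norm (v $ i))"
        by (rule form_H1_le)
      also have "\<dots> \<le> (1 + \<bar>lam i - 1\<bar>) * (norm u * norm v)"
        by (intro mult_left_mono mult_mono norm_vec_nth_le) auto
      finally show "\<bar>form_H1 (lam i) (u $ i) (v $ i)\<bar> \<le> (1 + \<bar>lam i - 1\<bar>) * (norm u * norm v)" .
    qed
    finally show ?thesis by (simp add: sum_distrib_left sum_distrib_right mult.commute)
  qed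
  then show "\<exists>K. \<forall>u v. norm (form_vec lam u v :: real) \<le> norm (u :: 'a H1 ^ 'd) * norm v * K" by blast
qed

lemma form_vec_coercive:
  assumes "\<And>i. c \<le> min 1 (lam i)"
  shows "c * (norm u)\<^sup>2 \<le> form_vec lam u u"
  unfolding norm_vec_sq sum_distrib_left form_vec_def
proof (rule sum_mono)
  fix i
  have "c * (norm (u $ i))\<^sup>2 \<le> min 1 (lam i) * (norm (u $ i))\<^sup>2"
    by (intro mult_right_mono assms) simp
  also note form_H1_coercive
  finally show "c * (norm (u $ i))\<^sup>2 \<le> form_H1 (lam i) (u $ i) (u $ i)" .
qed

section \<open>The Sobolev bound and the quartic form on vector states\<close>

text \<open>The fourth root brings the Sobolev bound into the shape that \<open>holder4\<close>
  expects.\<close>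

definition sobolev_root :: "nat \<Rightarrow> real" where
  "sobolev_root N = root 4 (8 * (16 * sobolev_const N + 1))"

lemma sobolev_const_nonneg: "0 \<le> sobolev_const N"
  by (simp add: sobolev_const_def)

lemma sobolev_root_nonneg: "0 \<le> sobolev_root N"
  using sobolev_const_nonneg[of N] by (simp add: sobolev_root_def)

lemma sobolev_root_power4: "sobolev_root N ^ 4 = 8 * (16 * sobolev_const N + 1)"
  using sobolev_const_nonneg[of N] unfolding sobolev_root_def by (intro real_root_pow_pos2) auto

lemma sobolev_H1:
  fixes u :: "'a::euclidean_space H1"
  assumes N: "DIM('a) \<le> 3"
  shows "L4_bound lborel (fun_of_H1 u) ((sobolev_root DIM('a) * norm u) ^ 4)"
proof -
  have "L4_bound lborel (fun_of_H1 u) (8 * (16 * sobolev_const DIM('a) + 1) * (L2sq (grad_H1 u) + L2sq (fun_of_H1 u))\<^sup>2)"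
    by (rule sobolev_L4[OF square_integrable_fun_of_H1 grad_H1 N])
  then show ?thesis
    unfolding norm_H1_sq[symmetric] sobolev_root_power4[symmetric]
    by (simp add: power_mult_distrib flip: power_mult)
qed

definition quad_H1 :: "'a::euclidean_space H1 \<Rightarrow> 'a H1 \<Rightarrow> 'a H1 \<Rightarrow> 'a H1 \<Rightarrow> real" where
  "quad_H1 u v w z = (LINT x|lborel. fun_of_H1 u x * fun_of_H1 v x * fun_of_H1 w x * fun_of_H1 z x)"

lemma quad_H1_bound:
  fixes u v w z :: "'a::euclidean_space H1"
  assumes N: "DIM('a) \<le> 3"
  shows "integrable lborel (\<lambda>x. fun_of_H1 u x * fun_of_H1 v x * fun_of_H1 w x * fun_of_H1 z x)"
    "\<bar>quad_H1 u v w z\<bar> \<le> sobolev_root DIM('a) ^ 4 * (norm u * norm v * norm w * norm z)"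
proof -
  let ?k = "sobolev_root DIM('a)"
  note h = holder4[OF _ _ _ _ sobolev_H1[OF N] sobolev_H1[OF N] sobolev_H1[OF N] sobolev_H1[OF N], of u v w z]
  show "integrable lborel (\<lambda>x. fun_of_H1 u x * fun_of_H1 v x * fun_of_H1 w x * fun_of_H1 z x)"
    by (rule h(1)) (simp_all add: sobolev_root_nonneg)
  have "\<bar>quad_H1 u v w z\<bar> \<le> ?k * norm u * (?k * norm v) * (?k * norm w) * (?k * norm z)"
    unfolding quad_H1_def by (rule h(2)) (simp_all add: sobolev_root_nonneg)
  then show "\<bar>quad_H1 u v w z\<bar> \<le> ?k ^ 4 * (norm u * norm v * norm w * norm z)"
    by (simp add: power4_eq_xxxx mult_ac)
qed

lemma quad_H1_sym: "quad_H1 u v w z = quad_H1 v u w z" "quad_H1 u v w z = quad_H1 w z u v"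
  by (simp_all add: quad_H1_def mult_ac)

lemma quad_H1_linear:
  fixes u v w :: "'a::euclidean_space H1"
  assumes N: "DIM('a) \<le> 3"
  shows "linear (quad_H1 u v w)"
proof
  fix z z' :: "'a H1" and t :: real
  let ?f = "\<lambda>z x. fun_of_H1 u x * fun_of_H1 v x * fun_of_H1 w x * fun_of_H1 z x"
  have "quad_H1 u v w (z + z') = (LINT x|lborel. ?f z x + ?f z' x)"
    unfolding quad_H1_def
  proof (rule integral_cong_AE)
    show "AE x in lborel. ?f (z + z') x = ?f z x + ?f z' x"
      using fun_of_H1_add[of z z'] by eventually_elim (simp add: distrib_left)
  qed measurable
  also have "\<dots> = quad_H1 u v w z + quad_H1 u v w z'"
    unfolding quad_H1_def by (intro Bochner_Integration.integral_add quad_H1_bound N)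
  finally show "quad_H1 u v w (z + z') = quad_H1 u v w z + quad_H1 u v w z'" .
  have "quad_H1 u v w (t *\<^sub>R z) = (LINT x|lborel. t * ?f z x)"
    unfolding quad_H1_def
  proof (rule integral_cong_AE)
    show "AE x in lborel. ?f (t *\<^sub>R z) x = t * ?f z x"
      using fun_of_H1_scaleR[of t z] by eventually_elim simp
  qed measurable
  then show "quad_H1 u v w (t *\<^sub>R z) = t *\<^sub>R quad_H1 u v w z" by (simp add: quad_H1_def)
qed

definition quad_vec :: "('d::finite \<Rightarrow> 'd \<Rightarrow> real) \<Rightarrow> 'a::euclidean_space H1 ^ 'd \<Rightarrow> 'a H1 ^ 'd \<Rightarrow>
    'a H1 ^ 'd \<Rightarrow> 'a H1 ^ 'd \<Rightarrow> real" where
  "quad_vec \<beta> u v w z = (\<Sum>i\<in>UNIV. \<Sum>j\<in>UNIV. \<beta> i j * quad_H1 (u $ i) (v $ i) (w $ j) (z $ j))"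

lemma quartic_problem_vec:
  fixes \<beta> :: "'d::finite \<Rightarrow> 'd \<Rightarrow> real"
  assumes N: "DIM('a::euclidean_space) \<le> 3" and sym: "\<And>i j. \<beta> i j = \<beta> j i" and lam: "\<And>i. 0 < lam i"
  shows "quartic_problem (form_vec lam :: 'a H1 ^ 'd \<Rightarrow> _) (quad_vec \<beta>) (Min (range (\<lambda>i. min 1 (lam i))))
    (\<Sum>i\<in>UNIV. \<Sum>j\<in>UNIV. \<bar>\<beta> i j\<bar> * sobolev_root DIM('a) ^ 4)"
proof (rule quartic_problem.intro)
  show "bounded_bilinear (form_vec lam :: 'a H1 ^ 'd \<Rightarrow> _)" by (rule form_vec_bilinear)
  show "0 < Min (range (\<lambda>i. min 1 (lam i)))" using lam by simp
  show "0 \<le> (\<Sum>i\<in>UNIV. \<Sum>j\<in>UNIV. \<bar>\<beta> i j\<bar> * sobolev_root DIM('a) ^ 4)"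
    by (intro sum_nonneg mult_nonneg_nonneg) auto
  fix u v w z :: "'a H1 ^ 'd"
  show "form_vec lam u v = form_vec lam v u" by (rule form_vec_sym)
  show "Min (range (\<lambda>i. min 1 (lam i))) * (norm u)\<^sup>2 \<le> form_vec lam u u"
    by (rule form_vec_coercive, rule Min_le) simp_all
  show "linear (quad_vec \<beta> u v w)"
  proof (rule linearI)
    fix z z' :: "'a H1 ^ 'd" and t :: real
    show "quad_vec \<beta> u v w (z + z') = quad_vec \<beta> u v w z + quad_vec \<beta> u v w z'"
      by (simp add: quad_vec_def linear_add[OF quad_H1_linear[OF N]] distrib_left sum.distrib)
    show "quad_vec \<beta> u v w (t *\<^sub>R z) = t *\<^sub>R quad_vec \<beta> u v w z"
      by (simp add: quad_vec_def linear_cmul[OF quad_H1_linear[OF N]] sum_distrib_left mult_ac)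
  qed
  show "quad_vec \<beta> u v w z = quad_vec \<beta> v u w z"
    unfolding quad_vec_def by (simp add: quad_H1_sym(1))
  have "quad_vec \<beta> u v w z = (\<Sum>j\<in>UNIV. \<Sum>i\<in>UNIV. \<beta> i j * quad_H1 (u $ i) (v $ i) (w $ j) (z $ j))"
    unfolding quad_vec_def by (rule sum.swap)
  also have "\<dots> = quad_vec \<beta> w z u v"
    unfolding quad_vec_def
  proof (intro sum.cong refl arg_cong2[where f = "(*)"])
    show "\<beta> i j = \<beta> j i" for i j by (rule sym)
    show "quad_H1 (u $ i) (v $ i) (w $ j) (z $ j) = quad_H1 (w $ j) (z $ j) (u $ i) (v $ i)" for i j
      by (rule quad_H1_sym(2))
  qed
  finally show "quad_vec \<beta> u v w z = quad_vec \<beta> w z u v" .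
  let ?n = "norm u * norm v * norm w * norm z"
  have "\<bar>quad_vec \<beta> u v w z\<bar> \<le> (\<Sum>i\<in>UNIV. \<Sum>j\<in>UNIV. \<bar>\<beta> i j * quad_H1 (u $ i) (v $ i) (w $ j) (z $ j)\<bar>)"
    unfolding quad_vec_def by (intro order_trans[OF sum_abs] sum_mono sum_abs)
  also have "\<dots> \<le> (\<Sum>i\<in>UNIV. \<Sum>j\<in>UNIV. \<bar>\<beta> i j\<bar> * sobolev_root DIM('a) ^ 4 * ?n)"
  proof (intro sum_mono)
    fix i j
    have "\<bar>quad_H1 (u $ i) (v $ i) (w $ j) (z $ j)\<bar> \<le>
        sobolev_root DIM('a) ^ 4 * (norm (u $ i) * norm (v $ i) * norm (w $ j) * norm (z $ j))"
      by (rule quad_H1_bound(2)[OF N])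
    also have "\<dots> \<le> sobolev_root DIM('a) ^ 4 * ?n"
      by (intro mult_left_mono mult_mono norm_vec_nth_le) (auto intro: sobolev_root_nonneg)
    finally have "\<bar>\<beta> i j\<bar> * \<bar>quad_H1 (u $ i) (v $ i) (w $ j) (z $ j)\<bar> \<le> \<bar>\<beta> i j\<bar> * (sobolev_root DIM('a) ^ 4 * ?n)"
      by (rule mult_left_mono) simp
    then show "\<bar>\<beta> i j * quad_H1 (u $ i) (v $ i) (w $ j) (z $ j)\<bar> \<le> \<bar>\<beta> i j\<bar> * sobolev_root DIM('a) ^ 4 * ?n"
      by (simp add: abs_mult mult.assoc)
  qed
  also have "\<dots> = (\<Sum>i\<in>UNIV. \<Sum>j\<in>UNIV. \<bar>\<beta> i j\<bar> * sobolev_root DIM('a) ^ 4) * norm u * norm v * norm w * norm z"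
    by (simp add: sum_distrib_right mult.assoc)
  finally show "\<bar>quad_vec \<beta> u v w z\<bar> \<le>
    (\<Sum>i\<in>UNIV. \<Sum>j\<in>UNIV. \<bar>\<beta> i j\<bar> * sobolev_root DIM('a) ^ 4) * norm u * norm v * norm w * norm z" .
qed

section \<open>Translation invariance, and averages as functionals on \<open>H1\<close>\<close>

lemma integral_translate_H1_cong:
  fixes f g :: "'a::euclidean_space \<Rightarrow> real"
  assumes "AE x in lborel. f x = g (x + y)" and [measurable]: "f \<in> borel_measurable borel" "g \<in> borel_measurable borel"
  shows "(LINT x|lborel. f x) = (LINT x|lborel. g x)"
proof -
  have "(LINT x|lborel. f x) = (LINT x|lborel. g (x + y))"
    by (rule integral_cong_AE) (use assms(1) in simp_all)
  then show ?thesis by (simp add: integral_lborel_translate)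
qed

lemma form_H1_translate: "form_H1 l (translate_H1 y u) (translate_H1 y u) = form_H1 l u u"
  unfolding form_H1_self
proof (rule integral_translate_H1_cong[where y = y])
  show "AE x in lborel. (norm (grad_H1 (translate_H1 y u) x))\<^sup>2 + l * (fun_of_H1 (translate_H1 y u) x)\<^sup>2 =
      (norm (grad_H1 u (x + y)))\<^sup>2 + l * (fun_of_H1 u (x + y))\<^sup>2"
    using fun_of_translate_H1[of y u] grad_translate_H1[of y u] by eventually_elim simp
qed measurable

lemma quad_H1_translate:
  "quad_H1 (translate_H1 y u) (translate_H1 y v) (translate_H1 y w) (translate_H1 y z) = quad_H1 u v w z"
  unfolding quad_H1_def
proof (rule integral_translate_H1_cong[where y = y])
  show "AE x in lborel. fun_of_H1 (translate_H1 y u) x * fun_of_H1 (translate_H1 y v) x *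
        fun_of_H1 (translate_H1 y w) x * fun_of_H1 (translate_H1 y z) x =
      fun_of_H1 u (x + y) * fun_of_H1 v (x + y) * fun_of_H1 w (x + y) * fun_of_H1 z (x + y)"
    using fun_of_translate_H1[of y u] fun_of_translate_H1[of y v] fun_of_translate_H1[of y w]
      fun_of_translate_H1[of y z] by eventually_elim simp
qed measurable

text \<open>The sup bound for \<open>u - v\<close> has a vanishing right-hand side, so the averages
  agree at every point. This makes them well defined on \<open>H1\<close>.\<close>

lemma cube_avg_cong_AE:
  fixes u v :: "'a::euclidean_space \<Rightarrow> real"
  assumes u: "square_integrable u" and v: "square_integrable v" and l: "0 < l"
    and eq: "AE x in lborel. u x = v x"
  shows "cube_avg l u x = cube_avg l v x"
proof -
  note [measurable] = square_integrable_measurable[OF u] square_integrable_measurable[OF v]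
  have "L2sq (\<lambda>x. u x - v x) = L2sq (\<lambda>x::'a. 0::real)"
    by (rule L2sq_cong_AE) (use eq in auto)
  then have "(cube_avg l (\<lambda>x. u x - v x) x)\<^sup>2 \<le> 0"
    using cube_avg_sup_bound[OF square_integrable_diff[OF u v] l, of x] by simp
  then show ?thesis by (simp add: cube_avg_diff[OF u v l])
qed

lemma cube_avg_translate_H1:
  assumes l: "0 < l"
  shows "cube_avg l (fun_of_H1 (translate_H1 y u)) x = cube_avg l (fun_of_H1 u) (x + y)"
proof -
  have "cube_avg l (fun_of_H1 (translate_H1 y u)) x = cube_avg l (\<lambda>x. fun_of_H1 u (x + y)) x"
    by (intro cube_avg_cong_AE square_integrable_translate square_integrable_fun_of_H1 l fun_of_translate_H1)
  then show ?thesis by (simp add: cube_avg_def add_ac)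
qed

lemma cube_avg_H1_bound:
  fixes u :: "'a::euclidean_space H1"
  assumes l: "0 < l"
  shows "(cube_avg l (fun_of_H1 u) x)\<^sup>2 \<le> (norm u)\<^sup>2 / l ^ DIM('a)"
proof -
  have "(cube_avg l (fun_of_H1 u) x)\<^sup>2 \<le> L2sq (fun_of_H1 u) / l ^ DIM('a)"
    by (rule cube_avg_sup_bound[OF square_integrable_fun_of_H1 l])
  also have "\<dots> \<le> (norm u)\<^sup>2 / l ^ DIM('a)"
    using l by (intro divide_right_mono L2sq_le_norm_H1) auto
  finally show ?thesis .
qed

text \<open>Point evaluation is not continuous on \<open>H1\<close> in general, but evaluation of an
  average is; so weak convergence gives pointwise convergence of the averages.\<close>

lemma cube_avg_bounded_linear:
  assumes l: "0 < l"
  shows "bounded_linear (\<lambda>u :: 'a::euclidean_space H1. cube_avg l (fun_of_H1 u) x)"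
proof (rule bounded_linear_intro[where K = "sqrt (1 / l ^ DIM('a))"])
  fix u v :: "'a H1" and t :: real
  note s = square_integrable_fun_of_H1
  have "cube_avg l (fun_of_H1 (u + v)) x = cube_avg l (\<lambda>x. fun_of_H1 u x + fun_of_H1 v x) x"
    by (intro cube_avg_cong_AE s square_integrable_add l fun_of_H1_add)
  then show "cube_avg l (fun_of_H1 (u + v)) x = cube_avg l (fun_of_H1 u) x + cube_avg l (fun_of_H1 v) x"
    by (simp add: cube_avg_add[OF s s l])
  have "cube_avg l (fun_of_H1 (t *\<^sub>R u)) x = cube_avg l (\<lambda>x. t * fun_of_H1 u x) x"
    using square_integrable_scaleR[OF s[of u], of t]
    by (intro cube_avg_cong_AE s l fun_of_H1_scaleR) simp
  then show "cube_avg l (fun_of_H1 (t *\<^sub>R u)) x = t *\<^sub>R cube_avg l (fun_of_H1 u) x"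
    by (simp add: cube_avg_def)
  have "\<bar>cube_avg l (fun_of_H1 u) x\<bar> \<le> sqrt ((norm u)\<^sup>2 / l ^ DIM('a))"
    using cube_avg_H1_bound[OF l, of u x] by (intro real_le_rsqrt) simp
  also have "\<dots> = norm u * sqrt (1 / l ^ DIM('a))" by (simp add: real_sqrt_divide)
  finally show "norm (cube_avg l (fun_of_H1 u) x) \<le> norm u * sqrt (1 / l ^ DIM('a))" by simp
qed

section \<open>Weak continuity of the quartic form\<close>

lemma tendsto_of_approximations:
  fixes x :: "nat \<Rightarrow> real"
  assumes "\<And>e. e > 0 \<Longrightarrow> \<exists>y l. y \<longlonglongrightarrow> l \<and> (\<forall>n. \<bar>x n - y n\<bar> \<le> e) \<and> \<bar>L - l\<bar> \<le> e"
  shows "x \<longlonglongrightarrow> L"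
proof (rule LIMSEQ_I)
  fix e :: real assume e: "e > 0"
  then obtain y l where y: "y \<longlonglongrightarrow> l" "\<And>n. \<bar>x n - y n\<bar> \<le> e/4" "\<bar>L - l\<bar> \<le> e/4"
    using assms[of "e/4"] by auto
  obtain N where N: "\<And>n. n \<ge> N \<Longrightarrow> norm (y n - l) < e/4" using LIMSEQ_D[OF y(1), of "e/4"] e by auto
  have "norm (x n - L) < e" if "n \<ge> N" for n
    using y(2)[of n] y(3) N[OF that] unfolding real_norm_def by linarith
  then show "\<exists>no. \<forall>n\<ge>no. norm (x n - L) < e" by blast
qed

text \<open>Replace one factor at a time; each of the three resulting terms has one small
  factor.\<close>

lemma holder4_difference:
  fixes f1 f2 f3 g1 g2 g3 h :: "'a \<Rightarrow> real"
  assumes [measurable]: "f1 \<in> borel_measurable M" "f2 \<in> borel_measurable M" "f3 \<in> borel_measurable M"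
      "g1 \<in> borel_measurable M" "g2 \<in> borel_measurable M" "g3 \<in> borel_measurable M" "h \<in> borel_measurable M"
    and f: "L4_bound M f1 (D ^ 4)"
      "L4_bound M f2 (D ^ 4)"
      "L4_bound M f3 (D ^ 4)"
    and g: "L4_bound M g1 (D ^ 4)"
      "L4_bound M g2 (D ^ 4)"
      "L4_bound M g3 (D ^ 4)"
    and d: "L4_bound M (\<lambda>x. f1 x - g1 x) (\<eta> ^ 4)"
      "L4_bound M (\<lambda>x. f2 x - g2 x) (\<eta> ^ 4)"
      "L4_bound M (\<lambda>x. f3 x - g3 x) (\<eta> ^ 4)"
    and h: "L4_bound M h (P ^ 4)"
    and nn: "0 \<le> D" "0 \<le> \<eta>" "0 \<le> P"
  shows "\<bar>(LINT x|M. f1 x * f2 x * f3 x * h x) - (LINT x|M. g1 x * g2 x * g3 x * h x)\<bar> \<le> 3 * (\<eta> * D * D * P)"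
proof -
  let ?a = "\<lambda>x. (f1 x - g1 x) * f2 x * f3 x * h x"
  let ?b = "\<lambda>x. g1 x * (f2 x - g2 x) * f3 x * h x"
  let ?c = "\<lambda>x. g1 x * g2 x * (f3 x - g3 x) * h x"
  have i: "integrable M ?a" "integrable M ?b" "integrable M ?c"
     "integrable M (\<lambda>x. f1 x * f2 x * f3 x * h x)" "integrable M (\<lambda>x. g1 x * g2 x * g3 x * h x)"
    by (rule holder4(1)[OF _ _ _ _ d(1) f(2) f(3) h] holder4(1)[OF _ _ _ _ g(1) d(2) f(3) h]
        holder4(1)[OF _ _ _ _ g(1) g(2) d(3) h] holder4(1)[OF _ _ _ _ f h] holder4(1)[OF _ _ _ _ g h];
      use nn in simp)+
  have "(LINT x|M. f1 x * f2 x * f3 x * h x) - (LINT x|M. g1 x * g2 x * g3 x * h x)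
      = (LINT x|M. f1 x * f2 x * f3 x * h x - g1 x * g2 x * g3 x * h x)"
    by (rule Bochner_Integration.integral_diff[symmetric]) (rule i)+
  also have "\<dots> = (LINT x|M. ?a x + ?b x + ?c x)"
    by (intro Bochner_Integration.integral_cong refl) (simp add: algebra_simps)
  also have "\<dots> = (LINT x|M. ?a x) + (LINT x|M. ?b x) + (LINT x|M. ?c x)"
    using i by simp
  finally have eq: "(LINT x|M. f1 x * f2 x * f3 x * h x) - (LINT x|M. g1 x * g2 x * g3 x * h x) =
    (LINT x|M. ?a x) + (LINT x|M. ?b x) + (LINT x|M. ?c x)" .
  have "\<bar>LINT x|M. ?a x\<bar> \<le> \<eta> * D * D * P"
    by (rule holder4(2)[OF _ _ _ _ d(1) f(2) f(3) h]) (use nn in simp_all)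
  moreover have "\<bar>LINT x|M. ?b x\<bar> \<le> D * \<eta> * D * P"
    by (rule holder4(2)[OF _ _ _ _ g(1) d(2) f(3) h]) (use nn in simp_all)
  moreover have "\<bar>LINT x|M. ?c x\<bar> \<le> D * D * \<eta> * P"
    by (rule holder4(2)[OF _ _ _ _ g(1) g(2) d(3) h]) (use nn in simp_all)
  ultimately show ?thesis unfolding eq by (simp add: mult_ac abs_le_iff)
qed

lemma measurable_ball [measurable]:
  "Measurable.pred borel (\<lambda>x. x \<in> ball (a :: 'a::euclidean_space) r)"
  by (simp add: pred_def)

lemma L4_tail:
  fixes h :: "'a::euclidean_space \<Rightarrow> real"
  assumes [measurable]: "h \<in> borel_measurable borel"
    and h: "(\<integral>\<^sup>+x. ennreal ((h x) ^ 4) \<partial>lborel) < \<infinity>" and \<rho>: "0 < \<rho>"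
  obtains R where "L4_bound lborel (\<lambda>x. h x - indicator (ball 0 R) x * h x) \<rho>"
proof -
  have ih: "integrable lborel (\<lambda>x. (h x) ^ 4)" by (rule integrableI_bounded) (use h in auto)
  let ?t = "\<lambda>(n::nat) x. (h x - indicator (ball 0 (real n)) x * h x) ^ 4"
  have le: "?t n x \<le> (h x) ^ 4" for n x by (simp add: indicator_def)
  have "(\<lambda>n. LINT x|lborel. ?t n x) \<longlonglongrightarrow> (LINT x|(lborel :: 'a measure). (0::real))"
  proof (rule integral_dominated_convergence[where w = "\<lambda>x. (h x) ^ 4"])
    show "integrable lborel (\<lambda>x. (h x) ^ 4)" by (rule ih)
    show "AE x in lborel. (\<lambda>n. ?t n x) \<longlonglongrightarrow> 0"
    proof (rule AE_I2)
      fix x :: 'a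
      obtain N where N: "norm x < real N" using reals_Archimedean2 by blast
      have "eventually (\<lambda>n. ?t n x = 0) sequentially"
        using eventually_ge_at_top[of N] by eventually_elim (use N in \<open>auto simp: indicator_def dist_norm\<close>)
      then show "(\<lambda>n. ?t n x) \<longlonglongrightarrow> 0" by (rule tendsto_eventually)
    qed
    show "AE x in lborel. norm (?t n x) \<le> (h x) ^ 4" for n using le by simp
  qed simp_all
  then have "eventually (\<lambda>n. (LINT x|lborel. ?t n x) < \<rho>) sequentially"
    using \<rho> by (intro order_tendstoD(2)) simp_all
  then obtain n where n: "(LINT x|lborel. ?t n x) < \<rho>" by (auto simp: eventually_sequentially)
  have "integrable lborel (?t n)"
    by (rule Bochner_Integration.integrable_bound[OF ih]) (auto intro!: AE_I2 simp: le)
  then have "(\<integral>\<^sup>+x. ennreal (?t n x) \<partial>lborel) = ennreal (LINT x|lborel. ?t n x)"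
    by (intro nn_integral_eq_integral) auto
  also have "\<dots> \<le> ennreal \<rho>" using n by (intro ennreal_leI) simp
  finally show thesis by (rule that)
qed

text \<open>Outside a large ball \<open>h\<close> is small in L4, so by the Hoelder inequality that
  part is small uniformly in \<open>n\<close>. Inside the ball \<open>h\<close> is integrable and
  the other factors are bounded by \<open>m\<close>, so dominated convergence applies.\<close>

lemma tendsto_integral_locally_bounded:
  fixes f1 f2 f3 :: "nat \<Rightarrow> 'a::euclidean_space \<Rightarrow> real" and g1 g2 g3 h :: "'a \<Rightarrow> real"
  assumes m [measurable]: "\<And>n. f1 n \<in> borel_measurable borel" "\<And>n. f2 n \<in> borel_measurable borel"
      "\<And>n. f3 n \<in> borel_measurable borel"
      "g1 \<in> borel_measurable borel" "g2 \<in> borel_measurable borel" "g3 \<in> borel_measurable borel"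
    and f: "\<And>n. L4_bound lborel (f1 n) (D ^ 4)"
      "\<And>n. L4_bound lborel (f2 n) (D ^ 4)"
      "\<And>n. L4_bound lborel (f3 n) (D ^ 4)"
    and g: "L4_bound lborel g1 (D ^ 4)"
      "L4_bound lborel g2 (D ^ 4)"
      "L4_bound lborel g3 (D ^ 4)"
    and lim: "\<And>x. (\<lambda>n. f1 n x) \<longlonglongrightarrow> g1 x" "\<And>x. (\<lambda>n. f2 n x) \<longlonglongrightarrow> g2 x" "\<And>x. (\<lambda>n. f3 n x) \<longlonglongrightarrow> g3 x"
    and bd: "\<And>n x. \<bar>f1 n x\<bar> \<le> m" "\<And>n x. \<bar>f2 n x\<bar> \<le> m" "\<And>n x. \<bar>f3 n x\<bar> \<le> m"
    and h: "square_integrable h" "L4_bound lborel h (P ^ 4)"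
    and nn: "0 \<le> D" "0 \<le> P"
  shows "(\<lambda>n. LINT x|lborel. f1 n x * f2 n x * f3 n x * h x) \<longlonglongrightarrow> (LINT x|lborel. g1 x * g2 x * g3 x * h x)"
proof (rule tendsto_of_approximations)
  fix e :: real assume e: "e > 0"
  note [measurable] = square_integrable_measurable[OF h(1)]
  \<comment> \<open>The summand 1 keeps the denominator positive if \<open>D = 0\<close>.\<close>
  define \<rho> where "\<rho> = e / (D * D * D + 1)"
  have D3: "0 \<le> D * D * D" using nn by simp
  have \<rho>: "0 < \<rho>" "D * D * D * \<rho> \<le> e"
  proof -
    show "0 < \<rho>" using e D3 by (simp add: \<rho>_def)
    have "D * D * D * \<rho> = e * (D * D * D / (D * D * D + 1))" by (simp add: \<rho>_def)
    also have "\<dots> \<le> e * 1" using e D3 by (intro mult_left_mono) auto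
    finally show "D * D * D * \<rho> \<le> e" by simp
  qed
  have fin: "(\<integral>\<^sup>+x. ennreal ((h x) ^ 4) \<partial>lborel) < \<infinity>" using h(2) by (rule le_less_trans) simp
  obtain R where R: "L4_bound lborel (\<lambda>x. h x - indicator (ball 0 R) x * h x) (\<rho> ^ 4)"
    by (rule L4_tail[OF _ fin, of "\<rho> ^ 4"]) (use \<rho> in auto)
  define k where "k = (\<lambda>x. indicator (ball 0 R) x * h x)"
  have [measurable]: "k \<in> borel_measurable borel"
    unfolding k_def by (intro borel_measurable_times borel_measurable_indicator) auto
  have k4: "L4_bound lborel k (P ^ 4)"
    by (rule order_trans[OF _ h(2)]) (auto intro!: nn_integral_mono simp: k_def indicator_def)
  have ik: "integrable lborel k"
  proof -
    have "square_integrable (indicator (ball 0 R) :: 'a \<Rightarrow> real)"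
      using emeasure_bounded_finite[of "ball (0::'a) R"]
      by (auto simp: square_integrable_def power2_eq_square intro!: integrable_real_indicator borel_measurable_indicator simp flip: indicator_inter_arith)
    then show ?thesis unfolding k_def using square_integrable_mult h(1) by blast
  qed
  have est: "\<bar>(LINT x|lborel. p1 x * p2 x * p3 x * h x) - (LINT x|lborel. p1 x * p2 x * p3 x * k x)\<bar> \<le> e"
    if [measurable]: "p1 \<in> borel_measurable borel" "p2 \<in> borel_measurable borel" "p3 \<in> borel_measurable borel"
     and p: "L4_bound lborel p1 (D ^ 4)"
      "L4_bound lborel p2 (D ^ 4)"
      "L4_bound lborel p3 (D ^ 4)" for p1 p2 p3 :: "'a \<Rightarrow> real"
  proof -
    have "(LINT x|lborel. p1 x * p2 x * p3 x * h x) - (LINT x|lborel. p1 x * p2 x * p3 x * k x) =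
       (LINT x|lborel. p1 x * p2 x * p3 x * h x - p1 x * p2 x * p3 x * k x)"
      by (intro Bochner_Integration.integral_diff[symmetric] holder4(1)[OF _ _ _ _ p h(2)] holder4(1)[OF _ _ _ _ p k4])
        (use nn in simp_all)
    also have "\<dots> = (LINT x|lborel. p1 x * p2 x * p3 x * (h x - indicator (ball 0 R) x * h x))"
      by (simp add: k_def right_diff_distrib)
    also have "\<bar>\<dots>\<bar> \<le> D * D * D * \<rho>"
      by (rule holder4(2)[OF _ _ _ _ p R]) (use nn \<rho> in simp_all)
    finally show ?thesis using \<rho>(2) by linarith
  qed
  have "(\<lambda>n. LINT x|lborel. f1 n x * f2 n x * f3 n x * k x) \<longlonglongrightarrow> (LINT x|lborel. g1 x * g2 x * g3 x * k x)"
  proof (rule integral_dominated_convergence[where w = "\<lambda>x. m * m * m * \<bar>k x\<bar>"])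
    show "integrable lborel (\<lambda>x. m * m * m * \<bar>k x\<bar>)" using ik by simp
    show "AE x in lborel. (\<lambda>n. f1 n x * f2 n x * f3 n x * k x) \<longlonglongrightarrow> g1 x * g2 x * g3 x * k x"
      by (intro AE_I2 tendsto_mult tendsto_const lim)
    show "AE x in lborel. norm (f1 n x * f2 n x * f3 n x * k x) \<le> m * m * m * \<bar>k x\<bar>" for n
    proof (rule AE_I2)
      fix x
      have "0 \<le> m" using bd(1)[of n x] by linarith
      then show "norm (f1 n x * f2 n x * f3 n x * k x) \<le> m * m * m * \<bar>k x\<bar>"
        unfolding real_norm_def abs_mult using bd by (intro mult_mono mult_nonneg_nonneg) auto
    qed
  qed measurable
  then show "\<exists>y l. y \<longlonglongrightarrow> l \<and> (\<forall>n. \<bar>(LINT x|lborel. f1 n x * f2 n x * f3 n x * h x) - y n\<bar> \<le> e) \<and>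
      \<bar>(LINT x|lborel. g1 x * g2 x * g3 x * h x) - l\<bar> \<le> e"
    using est[OF m(1-3) f] est[OF m(4-6) g] by blast
qed

text \<open>Test with the functional given by \<open>a'\<close> itself.\<close>

lemma weak_limit_norm_le:
  fixes a :: "nat \<Rightarrow> 'a::real_inner"
  assumes "\<And>n. norm (a n) \<le> A" and w: "\<And>f :: 'a \<Rightarrow> real. bounded_linear f \<Longrightarrow> (\<lambda>n. f (a n)) \<longlonglongrightarrow> f a'"
  shows "norm a' \<le> A"
proof (cases "a' = 0")
  case True
  then show ?thesis using order_trans[OF norm_ge_zero assms(1)[of 0]] by simp
next
  case False
  have "a n \<bullet> a' \<le> A * norm a'" for n
    using norm_cauchy_schwarz[of "a n" a'] mult_right_mono[OF assms(1)[of n], of "norm a'"] by simp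
  then have "a' \<bullet> a' \<le> A * norm a'"
    by (intro LIMSEQ_le_const2[OF w[OF bounded_linear_inner_left]]) auto
  then have "norm a' * norm a' \<le> A * norm a'" by (simp add: power2_norm_eq_inner[symmetric] power2_eq_square)
  then show ?thesis using False by simp
qed

lemma cube_avg_H1_L4:
  fixes u :: "'a::euclidean_space H1"
  assumes N: "DIM('a) \<le> 3" and l: "0 < l" "l \<le> 1" and u: "norm u \<le> A"
  shows "L4_bound lborel (\<lambda>x. fun_of_H1 u x - cube_avg l (fun_of_H1 u) x) (16 * sobolev_const DIM('a) * l * A ^ 4)"
proof -
  have A: "0 \<le> A" using u norm_ge_zero order_trans by blast
  have "L2sq (grad_H1 u) \<le> A\<^sup>2"
    using L2sq_le_norm_H1(1)[of u] power_mono[OF u norm_ge_zero, of 2] by linarith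
  then have "(L2sq (grad_H1 u))\<^sup>2 \<le> (A\<^sup>2)\<^sup>2" by (rule power_mono) simp
  then have "16 * sobolev_const DIM('a) * l * (L2sq (grad_H1 u))\<^sup>2 \<le> 16 * sobolev_const DIM('a) * l * A ^ 4"
    using l sobolev_const_nonneg[of "DIM('a)"] by (intro mult_left_mono) auto
  then show ?thesis
    using cube_avg_L4_error[OF square_integrable_fun_of_H1 grad_H1 N l, of u] ennreal_leI order_trans by blast
qed

text \<open>Replacing the three varying slots by averages costs an error uniform in
  \<open>n\<close>, and the averages are bounded and converge pointwise. The slot of
  \<open>h\<close> has to stay fixed: otherwise mass escaping to infinity could break the
  convergence.\<close>

lemma quad_H1_weakly_continuous:
  fixes a b c :: "nat \<Rightarrow> 'a::euclidean_space H1"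
  assumes N: "DIM('a) \<le> 3"
    and bd: "\<And>n. norm (a n) \<le> A" "\<And>n. norm (b n) \<le> A" "\<And>n. norm (c n) \<le> A"
    and wa: "\<And>f :: 'a H1 \<Rightarrow> real. bounded_linear f \<Longrightarrow> (\<lambda>n. f (a n)) \<longlonglongrightarrow> f a'"
    and wb: "\<And>f :: 'a H1 \<Rightarrow> real. bounded_linear f \<Longrightarrow> (\<lambda>n. f (b n)) \<longlonglongrightarrow> f b'"
    and wc: "\<And>f :: 'a H1 \<Rightarrow> real. bounded_linear f \<Longrightarrow> (\<lambda>n. f (c n)) \<longlonglongrightarrow> f c'"
  shows "(\<lambda>n. quad_H1 (a n) (b n) (c n) h) \<longlonglongrightarrow> quad_H1 a' b' c' h"
proof (rule tendsto_of_approximations)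
  fix e :: real assume e: "e > 0"
  have bd': "norm a' \<le> A" "norm b' \<le> A" "norm c' \<le> A"
    using weak_limit_norm_le[of a A a', OF bd(1) wa] weak_limit_norm_le[of b A b', OF bd(2) wb]
      weak_limit_norm_le[of c A c', OF bd(3) wc] by auto
  have A: "0 \<le> A" using bd'(1) norm_ge_zero order_trans by blast
  define s where "s = 16 * sobolev_const DIM('a) * A ^ 4"
  have s: "0 \<le> s" using sobolev_const_nonneg[of "DIM('a)"] A by (simp add: s_def)
  define \<kappa> where "\<kappa> = sobolev_root DIM('a)"
  have \<kappa>: "0 \<le> \<kappa>" by (simp add: \<kappa>_def sobolev_root_nonneg)
  \<comment> \<open>A common L4 bound for the functions and their averages: an average is the
    function plus an error whose fourth power has integral at most \<open>s\<close>, hence the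
    factor 8.\<close>
  define D where "D = root 4 (8 * ((\<kappa> * A) ^ 4 + s))"
  have D: "0 \<le> D" "D ^ 4 = 8 * ((\<kappa> * A) ^ 4 + s)"
    using s by (simp_all add: D_def real_root_pow_pos2)
  define P where "P = \<kappa> * norm h"
  have P: "0 \<le> P" "L4_bound lborel (fun_of_H1 h) (P ^ 4)"
    using \<kappa> sobolev_H1[OF N, of h] by (simp_all add: P_def \<kappa>_def)
  have u4: "L4_bound lborel (fun_of_H1 u) ((\<kappa> * A) ^ 4)" if "norm u \<le> A" for u :: "'a H1"
  proof -
    have "(\<kappa> * norm u) ^ 4 \<le> (\<kappa> * A) ^ 4" using that \<kappa> by (intro power_mono mult_left_mono) auto
    then show ?thesis using sobolev_H1[OF N, of u] ennreal_leI order_trans unfolding \<kappa>_def by blast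
  qed
  have uD: "L4_bound lborel (fun_of_H1 u) (D ^ 4)" if "norm u \<le> A" for u :: "'a H1"
  proof -
    have "(\<kappa> * A) ^ 4 \<le> D ^ 4" unfolding D(2) using s by simp
    then show ?thesis using u4[OF that] ennreal_leI order_trans by blast
  qed
  \<comment> \<open>\<open>q\<close> is the L4 error that keeps the total below \<open>e\<close>;
    \<open>l\<close> is then chosen so small that the averages reach it.\<close>
  define q where "q = e / (3 * (D * D * P) + 1)"
  have DP: "0 \<le> 3 * (D * D * P)" using D P by simp
  have q: "0 < q" "3 * (q * D * D * P) \<le> e"
  proof -
    show "0 < q" using e DP by (simp add: q_def)
    have "3 * (q * D * D * P) = e * (3 * (D * D * P) / (3 * (D * D * P) + 1))"
      by (simp add: q_def mult_ac)
    also have "\<dots> \<le> e * 1" using e DP by (intro mult_left_mono) auto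
    finally show "3 * (q * D * D * P) \<le> e" by simp
  qed
  define l where "l = min 1 (q ^ 4 / (s + 1))"
  have l: "0 < l" "l \<le> 1" "s * l \<le> q ^ 4" "s * l \<le> s"
  proof -
    show "0 < l" "l \<le> 1" using q s by (auto simp: l_def)
    then show "s * l \<le> s" using s by (simp add: mult_left_le)
    have "s * l \<le> (s + 1) * (q ^ 4 / (s + 1))" using s q by (intro mult_mono) (auto simp: l_def)
    then show "s * l \<le> q ^ 4" using s by simp
  qed
  define av where "av = (\<lambda>u. cube_avg l (fun_of_H1 (u :: 'a H1)))"
  have [measurable]: "av u \<in> borel_measurable borel" for u unfolding av_def by measurable
  have err: "L4_bound lborel (\<lambda>x. fun_of_H1 u x - av u x) (s * l)" if "norm u \<le> A" for u
    using cube_avg_H1_L4[OF N l(1,2) that] by (simp add: av_def s_def mult_ac)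
  have err_q: "L4_bound lborel (\<lambda>x. fun_of_H1 u x - av u x) (q ^ 4)" if "norm u \<le> A" for u
    using err[OF that] ennreal_leI[OF l(3)] by (rule order_trans)
  have avD: "L4_bound lborel (av u) (D ^ 4)" if "norm u \<le> A" for u
  proof -
    have "L4_bound lborel (\<lambda>x. fun_of_H1 u x + (av u x - fun_of_H1 u x)) (8 * ((\<kappa> * A) ^ 4 + s))"
    proof (rule nn_integral_power4_add_le[OF _ _ u4[OF that]])
      have "(av u x - fun_of_H1 u x) ^ 4 = (fun_of_H1 u x - av u x) ^ 4" for x
        by (rule power4_eq_xxxx[THEN trans]) (simp add: power4_eq_xxxx algebra_simps)
      then show "L4_bound lborel (\<lambda>x. av u x - fun_of_H1 u x) s"
        using order_trans[OF err[OF that] ennreal_leI[OF l(4)]] by simp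
    qed (use s in simp_all)
    then show ?thesis by (simp add: D(2))
  qed
  let ?y = "\<lambda>u v w. LINT x|lborel. av u x * av v x * av w x * fun_of_H1 h x"
  have approx: "\<bar>quad_H1 u v w h - ?y u v w\<bar> \<le> e" if "norm u \<le> A" "norm v \<le> A" "norm w \<le> A" for u v w
  proof -
    have "\<bar>quad_H1 u v w h - ?y u v w\<bar> \<le> 3 * (q * D * D * P)"
      unfolding quad_H1_def
      by (rule holder4_difference) (use that D P q uD avD err_q in simp_all)
    then show ?thesis using q(2) by linarith
  qed
  have "(\<lambda>n. ?y (a n) (b n) (c n)) \<longlonglongrightarrow> ?y a' b' c'"
  proof (rule tendsto_integral_locally_bounded[where m = "sqrt (A\<^sup>2 / l ^ DIM('a))" and D = D and P = P])
    have "\<bar>av u x\<bar> \<le> sqrt (A\<^sup>2 / l ^ DIM('a))" if "norm u \<le> A" for u x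
    proof (rule real_le_rsqrt)
      have "(av u x)\<^sup>2 \<le> (norm u)\<^sup>2 / l ^ DIM('a)" unfolding av_def by (rule cube_avg_H1_bound[OF l(1)])
      also have "\<dots> \<le> A\<^sup>2 / l ^ DIM('a)" using that l by (intro divide_right_mono power_mono) auto
      finally show "\<bar>av u x\<bar>\<^sup>2 \<le> A\<^sup>2 / l ^ DIM('a)" by simp
    qed
    then show "\<bar>av (a n) x\<bar> \<le> sqrt (A\<^sup>2 / l ^ DIM('a))" "\<bar>av (b n) x\<bar> \<le> sqrt (A\<^sup>2 / l ^ DIM('a))"
      "\<bar>av (c n) x\<bar> \<le> sqrt (A\<^sup>2 / l ^ DIM('a))" for n x using bd by auto
    show "(\<lambda>n. av (a n) x) \<longlonglongrightarrow> av a' x" "(\<lambda>n. av (b n) x) \<longlonglongrightarrow> av b' x" "(\<lambda>n. av (c n) x) \<longlonglongrightarrow> av c' x" for x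
      unfolding av_def by (rule wa[OF cube_avg_bounded_linear[OF l(1)]] wb[OF cube_avg_bounded_linear[OF l(1)]]
          wc[OF cube_avg_bounded_linear[OF l(1)]])+
  qed (simp_all add: avD bd bd' D(1) P square_integrable_fun_of_H1)
  then show "\<exists>y l. y \<longlonglongrightarrow> l \<and> (\<forall>n. \<bar>quad_H1 (a n) (b n) (c n) h - y n\<bar> \<le> e) \<and> \<bar>quad_H1 a' b' c' h - l\<bar> \<le> e"
    using approx[OF bd] approx[OF bd'] by blast
qed

lemma quad_vec_weakly_continuous:
  fixes v :: "nat \<Rightarrow> 'a::euclidean_space H1 ^ 'd::finite"
  assumes N: "DIM('a) \<le> 3" and bd: "\<And>n. norm (v n) \<le> A"
    and w: "\<And>f :: 'a H1 ^ 'd \<Rightarrow> real. bounded_linear f \<Longrightarrow> (\<lambda>n. f (v n)) \<longlonglongrightarrow> f w"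
  shows "(\<lambda>n. quad_vec \<beta> (v n) (v n) (v n) h) \<longlonglongrightarrow> quad_vec \<beta> w w w h"
  unfolding quad_vec_def
proof (intro tendsto_sum tendsto_mult tendsto_const quad_H1_weakly_continuous N)
  show "norm (v n $ i) \<le> A" for n i using norm_vec_nth_le[of "v n" i] bd[of n] by linarith
  then show "norm (v n $ i) \<le> A" "norm (v n $ i) \<le> A" for n i by auto
  show "(\<lambda>n. f (v n $ i)) \<longlonglongrightarrow> f (w $ i)" if "bounded_linear f" for f :: "'a H1 \<Rightarrow> real" and i
    by (rule w[OF bounded_linear_compose[OF that bounded_linear_vec_nth]])
  then show "(\<lambda>n. f (v n $ i)) \<longlonglongrightarrow> f (w $ i)" "(\<lambda>n. f (v n $ i)) \<longlonglongrightarrow> f (w $ i)"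
    if "bounded_linear f" for f :: "'a H1 \<Rightarrow> real" and i using that by auto
qed

section \<open>Existence of a solution of least energy\<close>

text \<open>This takes the place of Lions' vanishing lemma: if all averages at the scale
  \<open>l\<close> are small, so are the L4 norms, because the error is small by the choice of
  \<open>l\<close> and the average by its sup bound. The quartic part would then fall below
  \<open>S\<close>.\<close>

lemma quad_vec_nonvanishing:
  fixes \<beta> :: "'d::finite \<Rightarrow> 'd \<Rightarrow> real"
  assumes N: "DIM('a::euclidean_space) \<le> 3" and A: "0 \<le> A" and S: "0 < S"
  obtains l \<delta> where "0 < l" "0 < \<delta>"
    "\<And>v :: 'a H1 ^ 'd. norm v \<le> A \<Longrightarrow> S \<le> quad_vec \<beta> v v v v \<Longrightarrow>
      \<exists>i x. \<delta> \<le> (cube_avg l (fun_of_H1 (v $ i)) x)\<^sup>2"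
proof -
  define P where "P = (\<Sum>i\<in>UNIV. \<Sum>j\<in>UNIV. \<bar>\<beta> i j\<bar>)"
  have P: "0 \<le> P" unfolding P_def by (intro sum_nonneg) auto
  \<comment> \<open>Error and average contribute \<open>\<tau>\<close> each to a component, and the
    fourth power of their sum is bounded by \<open>8 * (\<tau> + \<tau>)\<close>, that is
    \<open>16 * \<tau>\<close>; \<open>P\<close> sums the coefficients.\<close>
  define \<tau> where "\<tau> = S / (16 * (P + 1))"
  have \<tau>: "0 < \<tau>" "P * (16 * \<tau>) < S"
  proof -
    show "0 < \<tau>" using S P by (simp add: \<tau>_def)
    have "P * (16 * \<tau>) = S * (P / (P + 1))" using P by (simp add: \<tau>_def field_simps)
    also have "\<dots> < S * 1" using S P by (intro mult_strict_left_mono) auto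
    finally show "P * (16 * \<tau>) < S" by simp
  qed
  define s where "s = 16 * sobolev_const DIM('a) * A ^ 4"
  have s: "0 \<le> s" using sobolev_const_nonneg[of "DIM('a)"] A by (simp add: s_def)
  define l where "l = min 1 (\<tau> / (s + 1))"
  have l: "0 < l" "l \<le> 1" using \<tau>(1) s by (auto simp: l_def)
  have sl: "s * l \<le> \<tau>"
  proof -
    have "s * l \<le> (s + 1) * (\<tau> / (s + 1))" using s \<tau> by (intro mult_mono) (auto simp: l_def)
    then show ?thesis using s by simp
  qed
  define \<delta> where "\<delta> = \<tau> / (A\<^sup>2 + 1)"
  have A2: "0 < A\<^sup>2 + 1" by (simp add: add_nonneg_pos)
  have \<delta>: "0 < \<delta>" "\<delta> * A\<^sup>2 \<le> \<tau>"
  proof -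
    show "0 < \<delta>" using \<tau> A2 by (simp add: \<delta>_def)
    then have "\<delta> * A\<^sup>2 \<le> \<delta> * (A\<^sup>2 + 1)" by (intro mult_left_mono) auto
    also have "\<dots> = \<tau>" using A2 by (simp add: \<delta>_def)
    finally show "\<delta> * A\<^sup>2 \<le> \<tau>" .
  qed
  define \<rho> where "\<rho> = root 4 (16 * \<tau>)"
  have \<rho>: "0 \<le> \<rho>" "\<rho> ^ 4 = 16 * \<tau>" using \<tau> by (simp_all add: \<rho>_def real_root_pow_pos2)
  have "\<exists>i x. \<delta> \<le> (cube_avg l (fun_of_H1 (v $ i)) x)\<^sup>2"
    if v: "norm v \<le> A" and Q: "S \<le> quad_vec \<beta> v v v v" for v :: "'a H1 ^ 'd"
  proof (rule ccontr)
    assume "\<not> ?thesis"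
    then have small: "(cube_avg l (fun_of_H1 (v $ i)) x)\<^sup>2 \<le> \<delta>" for i x by (meson less_imp_le not_le)
    have vi: "norm (v $ i) \<le> A" for i using norm_vec_nth_le[of v i] v by linarith
    have L4: "L4_bound lborel (fun_of_H1 (v $ i)) (\<rho> ^ 4)" for i
    proof -
      let ?f = "fun_of_H1 (v $ i)"
      have "L4_bound lborel (\<lambda>x. (?f x - cube_avg l ?f x) + cube_avg l ?f x) (8 * (\<tau> + \<tau>))"
      proof (rule nn_integral_power4_add_le)
        have "L4_bound lborel (\<lambda>x. ?f x - cube_avg l ?f x) (s * l)"
          using cube_avg_H1_L4[OF N l vi, of i] by (simp add: s_def mult_ac)
        then show "L4_bound lborel (\<lambda>x. ?f x - cube_avg l ?f x) \<tau>"
          using ennreal_leI[OF sl] by (rule order_trans)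
        have "\<delta> * L2sq ?f \<le> \<delta> * A\<^sup>2"
          using \<delta> L2sq_le_norm_H1(2)[of "v $ i"] power_mono[OF vi norm_ge_zero, of i 2] by (intro mult_left_mono) auto
        then have "\<delta> * L2sq ?f \<le> \<tau>" using \<delta>(2) by linarith
        then show "L4_bound lborel (cube_avg l ?f) \<tau>"
          using order_trans[OF nn_integral_cube_avg_power4_le[OF square_integrable_fun_of_H1 small] ennreal_leI] by blast
      qed (use \<tau> in simp_all)
      then show ?thesis by (simp add: \<rho>(2))
    qed
    have "quad_vec \<beta> v v v v \<le> (\<Sum>i\<in>UNIV. \<Sum>j\<in>UNIV. \<bar>\<beta> i j\<bar> * (16 * \<tau>))"
      unfolding quad_vec_def
    proof (intro sum_mono)
      fix i j
      have "\<bar>quad_H1 (v $ i) (v $ i) (v $ j) (v $ j)\<bar> \<le> \<rho> * \<rho> * \<rho> * \<rho>"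
        unfolding quad_H1_def by (rule holder4(2)[OF _ _ _ _ L4 L4 L4 L4]) (simp_all add: \<rho>(1))
      then have "\<bar>quad_H1 (v $ i) (v $ i) (v $ j) (v $ j)\<bar> \<le> 16 * \<tau>"
        by (simp add: \<rho>(2) flip: power4_eq_xxxx)
      then have "\<bar>\<beta> i j\<bar> * \<bar>quad_H1 (v $ i) (v $ i) (v $ j) (v $ j)\<bar> \<le> \<bar>\<beta> i j\<bar> * (16 * \<tau>)"
        by (rule mult_left_mono) simp
      then show "\<beta> i j * quad_H1 (v $ i) (v $ i) (v $ j) (v $ j) \<le> \<bar>\<beta> i j\<bar> * (16 * \<tau>)"
        unfolding abs_mult[symmetric] by linarith
    qed
    also have "\<dots> = P * (16 * \<tau>)" by (simp add: P_def sum_distrib_right)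
    also have "\<dots> < S" by (rule \<tau>(2))
    finally show False using Q by simp
  qed
  with l(1) \<delta>(1) show thesis by (rule that)
qed

text \<open>Translations bring the points where the averages do not vanish to the origin. There the
  average is one fixed functional, so the weak limit cannot be 0. The given solution
  \<open>u\<close> makes \<open>S\<close> positive.\<close>

lemma least_energy_solution_exists:
  fixes \<beta> :: "'d::finite \<Rightarrow> 'd \<Rightarrow> real" and u :: "'a::euclidean_space H1 ^ 'd"
  assumes N: "DIM('a) \<le> 3"
    and P: "quartic_problem (form_vec lam :: 'a H1 ^ 'd \<Rightarrow> _) (quad_vec \<beta>) c K"
    and u: "u \<noteq> 0" "quartic_problem.critical (form_vec lam) (quad_vec \<beta>) u"
  obtains z :: "'a::euclidean_space H1 ^ 'd::finite" where "z \<noteq> 0" "quartic_problem.critical (form_vec lam) (quad_vec \<beta>) z"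
    "quartic_problem.E (form_vec lam) (quad_vec \<beta>) z \<le>
      1 / (4 * quartic_problem.S (form_vec lam :: 'a H1 ^ 'd \<Rightarrow> _) (quad_vec \<beta>))"
proof -
  interpret P: quartic_problem "form_vec lam :: 'a H1 ^ 'd \<Rightarrow> _" "quad_vec \<beta>" c K by (rule P)
  have S: "0 < P.S" by (rule P.critical_S_pos[OF u])
  obtain v where v: "\<And>n. form_vec lam (v n) (v n :: 'a H1 ^ 'd) = 1" "(\<lambda>n. P.Q (v n)) \<longlonglongrightarrow> P.S"
    using P.maximizing_sequence_exists[OF u(1)] by blast
  define A where "A = sqrt (1 / c)"
  have A: "0 \<le> A" using P.c by (simp add: A_def)
  \<comment> \<open>The threshold is half of \<open>S\<close>, because \<open>Q (v n)\<close> is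
    close to \<open>S\<close> only eventually; the index shift \<open>n0\<close> below discards the
    terms under it.\<close>
  obtain l \<delta> where l: "0 < l" "0 < \<delta>"
    and nv: "\<And>v :: 'a H1 ^ 'd. norm v \<le> A \<Longrightarrow> P.S / 2 \<le> quad_vec \<beta> v v v v \<Longrightarrow>
      \<exists>i x. \<delta> \<le> (cube_avg l (fun_of_H1 (v $ i)) x)\<^sup>2"
    using quad_vec_nonvanishing[OF N A, of "P.S / 2" \<beta>] S by (metis half_gt_zero)
  have "eventually (\<lambda>n. P.S / 2 < P.Q (v n)) sequentially"
    using S by (intro order_tendstoD(1)[OF v(2)]) simp
  then obtain n0 where n0: "\<And>n. n \<ge> n0 \<Longrightarrow> P.S / 2 < P.Q (v n)" by (auto simp: eventually_sequentially)
  have "\<exists>i x. \<delta> \<le> (cube_avg l (fun_of_H1 (v (n + n0) $ i)) x)\<^sup>2" for n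
  proof (rule nv)
    show "norm (v (n + n0)) \<le> A" unfolding A_def by (rule P.norm_sphere[OF v(1)])
    show "P.S / 2 \<le> quad_vec \<beta> (v (n + n0)) (v (n + n0)) (v (n + n0)) (v (n + n0))"
      using n0[of "n + n0"] by (simp add: P.Q_def)
  qed
  then obtain i x where ix: "\<And>n. \<delta> \<le> (cube_avg l (fun_of_H1 (v (n + n0) $ i n)) (x n))\<^sup>2" by metis
  \<comment> \<open>All components are translated by the same vector, which keeps the coupling
    terms.\<close>
  define V where "V = (\<lambda>n. (\<chi> j. translate_H1 (x n) (v (n + n0) $ j)) :: 'a H1 ^ 'd)"
  have V1: "form_vec lam (V n) (V n) = 1" for n
    using v(1)[of "n + n0"] by (simp add: V_def form_vec_def form_H1_translate)
  have VQ: "P.Q (V n) = P.Q (v (n + n0))" for n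
    by (simp add: V_def P.Q_def quad_vec_def quad_H1_translate)
  have Vn: "norm (V n) \<le> A" for n unfolding A_def by (rule P.norm_sphere[OF V1])
  \<comment> \<open>The component \<open>i n\<close> may change with \<open>n\<close>; the sum over
    all components is one expression that can be passed to the limit.\<close>
  have Vd: "\<delta> \<le> (\<Sum>j\<in>UNIV. (cube_avg l (fun_of_H1 (V n $ j)) 0)\<^sup>2)" for n
  proof -
    have "\<delta> \<le> (cube_avg l (fun_of_H1 (V n $ i n)) 0)\<^sup>2"
      using ix[of n] by (simp add: V_def cube_avg_translate_H1[OF l(1)])
    also have "\<dots> \<le> (\<Sum>j\<in>UNIV. (cube_avg l (fun_of_H1 (V n $ j)) 0)\<^sup>2)"
      by (rule member_le_sum) auto
    finally show ?thesis .
  qed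
  obtain r w where r: "strict_mono (r :: nat \<Rightarrow> nat)"
    and w: "\<And>f :: 'a H1 ^ 'd \<Rightarrow> real. bounded_linear f \<Longrightarrow> (\<lambda>n. f (V (r n))) \<longlonglongrightarrow> f w"
    using bounded_imp_weakly_convergent_subsequence[of V A, OF Vn] by blast
  have "(\<lambda>n. P.Q (V n)) \<longlonglongrightarrow> P.S" unfolding VQ by (rule LIMSEQ_ignore_initial_segment[OF v(2)])
  then have Q: "(\<lambda>n. P.Q (V (r n))) \<longlonglongrightarrow> P.S"
    using LIMSEQ_subseq_LIMSEQ[OF _ r] by (simp add: o_def)
  have w0: "w \<noteq> 0"
  proof
    assume w0: "w = 0"
    have "(\<lambda>n. \<Sum>j\<in>UNIV. (cube_avg l (fun_of_H1 (V (r n) $ j)) 0)\<^sup>2) \<longlonglongrightarrow> (\<Sum>j\<in>(UNIV :: 'd set). 0\<^sup>2)"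
    proof (intro tendsto_sum tendsto_power)
      fix j
      have b: "bounded_linear (\<lambda>v :: 'a H1 ^ 'd. cube_avg l (fun_of_H1 (v $ j)) 0)"
        by (rule bounded_linear_compose[OF cube_avg_bounded_linear[OF l(1)] bounded_linear_vec_nth])
      show "(\<lambda>n. cube_avg l (fun_of_H1 (V (r n) $ j)) 0) \<longlonglongrightarrow> 0"
        using w[OF b] linear_0[OF bounded_linear.linear[OF b]] by (simp add: w0)
    qed
    then have "\<delta> \<le> (\<Sum>j\<in>(UNIV :: 'd set). 0\<^sup>2)"
      by (rule LIMSEQ_le_const) (use Vd in auto)
    then show False using l(2) by simp
  qed
  have M: "(\<lambda>n. quad_vec \<beta> (V (r n)) (V (r n)) (V (r n)) h) \<longlonglongrightarrow> quad_vec \<beta> w w w h" for h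
    by (rule quad_vec_weakly_continuous[where v = "\<lambda>n. V (r n)" and A = A and w = w, OF N Vn w])
  show thesis
    by (rule P.weak_limit_critical[of "\<lambda>n. V (r n)" w, OF V1 Q S w w0 M]) (use that in blast)+
qed

section \<open>Comparison with semitrivial states\<close>

definition coupling :: "('d \<Rightarrow> real) \<Rightarrow> real \<Rightarrow> 'd \<Rightarrow> 'd \<Rightarrow> real" where
  "coupling \<mu> b i j = (if i = j then \<mu> i else b)"

text \<open>Each pair with \<open>i < j\<close> occurs twice in the double sum; this is how
  \<open>1/4\<close> of the full quartic form matches the factor \<open>1/2\<close> of the coupling
  terms in \<open>energy\<close>.\<close>

lemma sum_symmetric_off_diagonal:
  fixes f :: "'d::{finite, linorder} \<Rightarrow> 'd \<Rightarrow> real"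
  assumes sym: "\<And>i j. f i j = f j i"
  shows "(\<Sum>i\<in>UNIV. \<Sum>j\<in>UNIV. f i j) = (\<Sum>i\<in>UNIV. f i i) + 2 * (\<Sum>i\<in>UNIV. \<Sum>j\<in>{i<..}. f i j)"
proof -
  let ?U = "\<lambda>i j. if i < j then f i j else 0"
  have upper: "(\<Sum>j\<in>UNIV. ?U i j) = (\<Sum>j\<in>{i<..}. f i j)" for i
    by (simp add: sum.If_cases greaterThan_def)
  have "f i j = (if i = j then f i j else 0) + ?U i j + (if j < i then f i j else 0)" for i j
    by (cases i j rule: linorder_cases) auto
  then have "(\<Sum>i\<in>UNIV. \<Sum>j\<in>UNIV. f i j) =
      (\<Sum>i\<in>UNIV. \<Sum>j\<in>UNIV. (if i = j then f i j else 0) + ?U i j + (if j < i then f i j else 0))"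
    by (intro sum.cong refl)
  also have "\<dots> = (\<Sum>i\<in>UNIV. f i i) + (\<Sum>i\<in>UNIV. \<Sum>j\<in>UNIV. ?U i j)
      + (\<Sum>i\<in>UNIV. \<Sum>j\<in>UNIV. if j < i then f i j else 0)"
    by (simp add: sum.distrib)
  also have "(\<Sum>i\<in>UNIV. \<Sum>j\<in>UNIV. if j < i then f i j else 0) = (\<Sum>j\<in>UNIV. \<Sum>i\<in>UNIV. if j < i then f i j else 0)"
    by (rule sum.swap)
  also have "\<dots> = (\<Sum>i\<in>UNIV. \<Sum>j\<in>UNIV. ?U i j)"
    by (intro sum.cong refl) (simp add: sym)
  finally show ?thesis by (simp add: upper)
qed

lemma quad_H1_diagonal: "quad_H1 u u v v = (LINT x|lborel. (fun_of_H1 u x)\<^sup>2 * (fun_of_H1 v x)\<^sup>2)"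
  by (simp add: quad_H1_def power2_eq_square mult.assoc)

lemma energy_eq:
  "energy lam \<mu> (\<lambda>i j. b) u = 1/2 * form_vec lam u u - 1/4 * quad_vec (coupling \<mu> b) u u u u"
proof -
  let ?g = "\<lambda>i j. quad_H1 (u $ i) (u $ i) (u $ j) (u $ j)"
  have c: "coupling \<mu> b i i = \<mu> i" for i by (simp add: coupling_def)
  have "quad_vec (coupling \<mu> b) u u u u = (\<Sum>i\<in>UNIV. coupling \<mu> b i i * ?g i i) +
      2 * (\<Sum>i\<in>UNIV. \<Sum>j\<in>{i<..}. coupling \<mu> b i j * ?g i j)"
    unfolding quad_vec_def
    by (rule sum_symmetric_off_diagonal) (simp add: coupling_def quad_H1_sym(2)[of "u $ _" "u $ _" "u $ _" "u $ _"])
  also have "(\<Sum>i\<in>UNIV. \<Sum>j\<in>{i<..}. coupling \<mu> b i j * ?g i j) = (\<Sum>i\<in>UNIV. \<Sum>j\<in>{i<..}. b * ?g i j)"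
    by (intro sum.cong refl) (auto simp: coupling_def)
  finally have q: "quad_vec (coupling \<mu> b) u u u u = (\<Sum>i\<in>UNIV. \<mu> i * ?g i i) +
      2 * (\<Sum>i\<in>UNIV. \<Sum>j\<in>{i<..}. b * ?g i j)" by (simp only: c)
  have d: "?g i i = (LINT x|lborel. (fun_of_H1 (u $ i) x) ^ 4)" for i
    by (simp add: quad_H1_def power4_eq_xxxx mult.assoc)
  show ?thesis
    unfolding energy_def q form_vec_def form_H1_self d[symmetric] quad_H1_diagonal[symmetric]
    by (simp add: algebra_simps)
qed

lemma quad_H1_self_pos:
  fixes u :: "'a::euclidean_space H1"
  assumes N: "DIM('a) \<le> 3" and u: "u \<noteq> 0"
  shows "0 < quad_H1 u u u u"
proof -
  have i: "integrable lborel (\<lambda>x. fun_of_H1 u x * fun_of_H1 u x * fun_of_H1 u x * fun_of_H1 u x)"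
    by (rule quad_H1_bound(1)[OF N])
  have nn: "0 \<le> t * t * t * t" for t :: real
    using zero_le_power2[of "t * t"] by (simp add: power2_eq_square mult.assoc)
  have "quad_H1 u u u u \<noteq> 0"
  proof
    assume "quad_H1 u u u u = 0"
    then have "AE x in lborel. fun_of_H1 u x * fun_of_H1 u x * fun_of_H1 u x * fun_of_H1 u x = 0"
      unfolding quad_H1_def using integral_nonneg_eq_0_iff_AE[OF i] nn by simp
    then have "AE x in lborel. fun_of_H1 u x = fun_of_H1 0 x"
      using fun_of_H1_zero by eventually_elim auto
    then show False using u by (simp add: H1_eq_iff)
  qed
  moreover have "0 \<le> quad_H1 u u u u"
    unfolding quad_H1_def using nn by (intro Bochner_Integration.integral_nonneg) auto
  ultimately show ?thesis by simp
qed

lemma quad_H1_Cauchy_Schwarz: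
  fixes u v :: "'a::euclidean_space H1"
  assumes N: "DIM('a) \<le> 3"
  shows "\<bar>quad_H1 u u v v\<bar> \<le> sqrt (quad_H1 u u u u) * sqrt (quad_H1 v v v v)"
proof -
  have sq: "(\<integral>\<^sup>+x. ennreal (((fun_of_H1 u x)\<^sup>2)\<^sup>2) \<partial>lborel) = ennreal ((sqrt (quad_H1 u u u u))\<^sup>2)" for u :: "'a H1"
  proof -
    have e: "((fun_of_H1 u x)\<^sup>2)\<^sup>2 = fun_of_H1 u x * fun_of_H1 u x * fun_of_H1 u x * fun_of_H1 u x" for x
      by (simp add: power2_eq_square mult.assoc)
    have "(\<integral>\<^sup>+x. ennreal (((fun_of_H1 u x)\<^sup>2)\<^sup>2) \<partial>lborel) = ennreal (quad_H1 u u u u)"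
      unfolding quad_H1_def e[symmetric]
      by (rule nn_integral_eq_integral) (use quad_H1_bound(1)[OF N, of u u u u] in \<open>simp_all only: e AE_I2\<close>, simp flip: e)
    moreover have "0 \<le> quad_H1 u u u u"
      unfolding quad_H1_def e[symmetric] by (intro Bochner_Integration.integral_nonneg) simp
    ultimately show ?thesis by simp
  qed
  show ?thesis
    unfolding quad_H1_diagonal[of u v]
  proof (rule integrable_of_nn_integral_abs_le(2))
    show "(\<integral>\<^sup>+x. ennreal \<bar>(fun_of_H1 u x)\<^sup>2 * (fun_of_H1 v x)\<^sup>2\<bar> \<partial>lborel)
        \<le> ennreal (sqrt (quad_H1 u u u u) * sqrt (quad_H1 v v v v))"
      by (rule nn_integral_abs_mult_le_CS) (simp_all only: sq order_refl, simp_all add: quad_H1_diagonal Bochner_Integration.integral_nonneg)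
  qed (simp_all add: quad_H1_diagonal Bochner_Integration.integral_nonneg)
qed

lemma form_H1_pos: "0 < l \<Longrightarrow> u \<noteq> 0 \<Longrightarrow> 0 < form_H1 l u u"
  using form_H1_coercive[of l u] by (smt (verit) mult_pos_pos zero_less_norm_iff zero_less_power)

lemma quad_H1_scaleR:
  fixes u v :: "'a::euclidean_space H1"
  assumes N: "DIM('a) \<le> 3"
  shows "quad_H1 (s *\<^sub>R u) (s *\<^sub>R u) (t *\<^sub>R v) (t *\<^sub>R v) = s\<^sup>2 * t\<^sup>2 * quad_H1 u u v v"
proof -
  have 4: "quad_H1 u v w (t *\<^sub>R z) = t * quad_H1 u v w z" for u v w z :: "'a H1" and t
    using linear_cmul[OF quad_H1_linear[OF N]] by simp
  have 2: "quad_H1 u v (t *\<^sub>R z) (t *\<^sub>R z) = t\<^sup>2 * quad_H1 u v z z" for u v z :: "'a H1" and t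
  proof -
    have "quad_H1 u v (t *\<^sub>R z) (t *\<^sub>R z) = t * quad_H1 u v (t *\<^sub>R z) z" by (rule 4)
    also have "quad_H1 u v (t *\<^sub>R z) z = quad_H1 u v z (t *\<^sub>R z)" by (metis quad_H1_sym)
    finally show ?thesis by (simp add: 4 power2_eq_square)
  qed
  have "quad_H1 (s *\<^sub>R u) (s *\<^sub>R u) (t *\<^sub>R v) (t *\<^sub>R v) = t\<^sup>2 * quad_H1 v v (s *\<^sub>R u) (s *\<^sub>R u)"
    by (metis 2 quad_H1_sym(2))
  also have "\<dots> = s\<^sup>2 * t\<^sup>2 * quad_H1 u u v v" by (simp add: 2 quad_H1_sym(2)[of v v u u])
  finally show ?thesis .
qed

text \<open>On the family \<open>\<chi> i. sqrt (1 + t z i) u i\<close> with \<open>\<Sum> z i B(u i) = 0\<close> the quadratic part is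
  constant and the quartic part is a quadratic polynomial in \<open>t\<close>. For \<open>z\<close> supported on \<open>p\<close> and \<open>q\<close> this
  polynomial is strictly convex, so \<open>t = 0\<close> is not a maximum.\<close>

lemma fully_nontrivial_not_maximizer:
  fixes u :: "'a::euclidean_space H1 ^ 'd::finite"
  assumes N: "DIM('a) \<le> 3" and lam: "\<And>i. 0 < lam i" and \<mu>: "0 < \<mu> p" "0 < \<mu> q" and pq: "p \<noteq> q"
    and b: "0 < b" "b < sqrt (\<mu> p * \<mu> q)" and u: "u $ p \<noteq> 0" "u $ q \<noteq> 0"
  obtains v :: "'a::euclidean_space H1 ^ 'd::finite" where "form_vec lam v v = form_vec lam u u"
    "quad_vec (coupling \<mu> b) u u u u < quad_vec (coupling \<mu> b) v v v v"
proof -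
  define s where "s = (\<lambda>i. form_H1 (lam i) (u $ i) (u $ i))"
  define G where "G = (\<lambda>i j. coupling \<mu> b i j * quad_H1 (u $ i) (u $ i) (u $ j) (u $ j))"
  have s: "0 < s p" "0 < s q" unfolding s_def using form_H1_pos lam u by blast+
  \<comment> \<open>Mass moves between \<open>q\<close> and \<open>p\<close> only:
    \<open>z p * s p = 1\<close> and \<open>z q * s q = - 1\<close>, so the changes of the quadratic
    part cancel.\<close>
  define z where "z = (\<lambda>i. (if i = p then 1 / s p else 0) - (if i = q then 1 / s q else 0))"
  have sumz: "(\<Sum>i\<in>UNIV. z i * f i) = f p / s p - f q / s q" for f :: "'d \<Rightarrow> real"
  proof -
    have "z i * f i = (if i = p then f p / s p else 0) - (if i = q then f q / s q else 0)" for i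
      by (simp add: z_def)
    then show ?thesis by (simp add: sum_subtractf)
  qed
  define V where "V = (\<lambda>t. (\<chi> i. sqrt (1 + t * z i) *\<^sub>R u $ i))"
  have V_form: "form_vec lam (V t) (V t) = form_vec lam u u" if "\<And>i. 0 \<le> 1 + t * z i" for t
  proof -
    have "form_H1 (lam i) (V t $ i) (V t $ i) = s i + t * (z i * s i)" for i
    proof -
      have "form_H1 (lam i) (V t $ i) (V t $ i) = (sqrt (1 + t * z i) * sqrt (1 + t * z i)) * s i"
        by (simp add: V_def s_def form_H1_scaleR form_H1_sym[of _ "u $ i" "_ *\<^sub>R _"])
      then show ?thesis using that[of i] by (simp add: distrib_right)
    qed
    then have "form_vec lam (V t) (V t) = (\<Sum>i\<in>UNIV. s i) + t * (\<Sum>i\<in>UNIV. z i * s i)"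
      unfolding form_vec_def by (simp add: sum.distrib sum_distrib_left)
    then show ?thesis using s unfolding sumz by (simp add: form_vec_def s_def)
  qed
  define X where "X = (\<Sum>i\<in>UNIV. \<Sum>j\<in>UNIV. G i j)"
  define Y where "Y = (\<Sum>i\<in>UNIV. \<Sum>j\<in>UNIV. (z i + z j) * G i j)"
  define Z where "Z = (\<Sum>i\<in>UNIV. \<Sum>j\<in>UNIV. z i * (z j * G i j))"
  have V_quad: "quad_vec (coupling \<mu> b) (V t) (V t) (V t) (V t) = X + t * Y + t\<^sup>2 * Z"
    if "\<And>i. 0 \<le> 1 + t * z i" for t
  proof -
    have "coupling \<mu> b i j * quad_H1 (V t $ i) (V t $ i) (V t $ j) (V t $ j) =
        G i j + t * ((z i + z j) * G i j) + t\<^sup>2 * (z i * (z j * G i j))" for i j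
    proof -
      have "quad_H1 (V t $ i) (V t $ i) (V t $ j) (V t $ j) =
          (1 + t * z i) * (1 + t * z j) * quad_H1 (u $ i) (u $ i) (u $ j) (u $ j)"
        using that by (simp add: V_def quad_H1_scaleR[OF N])
      then show ?thesis by (simp add: G_def power2_eq_square algebra_simps)
    qed
    then show ?thesis
      by (simp add: quad_vec_def X_def Y_def Z_def sum.distrib sum_distrib_left)
  qed
  have X: "quad_vec (coupling \<mu> b) u u u u = X" by (simp add: quad_vec_def X_def G_def)
  \<comment> \<open>\<open>Z\<close> is the quadratic form of the 2 by 2 block of \<open>G\<close>
    at \<open>p\<close> and \<open>q\<close>. Cauchy-Schwarz for the squared components bounds the
    mixed term, and \<open>b < sqrt (\<mu> p * \<mu> q)\<close> makes the inequality of arithmetic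
    and geometric means strict.\<close>
  have Zpos: "0 < Z"
  proof -
    define m n P R where "m = sqrt (\<mu> p)" and "n = sqrt (\<mu> q)"
      and "P = sqrt (quad_H1 (u $ p) (u $ p) (u $ p) (u $ p)) / s p"
      and "R = sqrt (quad_H1 (u $ q) (u $ q) (u $ q) (u $ q)) / s q"
    have pos: "0 < P" "0 < R" unfolding P_def R_def using s quad_H1_self_pos[OF N] u by simp_all
    have "Z = (\<Sum>i\<in>UNIV. z i * (\<Sum>j\<in>UNIV. z j * G i j))" by (simp add: Z_def sum_distrib_left)
    also have "\<dots> = (G p p / s p - G p q / s q) / s p - (G q p / s p - G q q / s q) / s q"
      by (simp only: sumz)
    also have "\<dots> = G p p / (s p)\<^sup>2 + G q q / (s q)\<^sup>2 - 2 * (G p q / (s p * s q))"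
    proof -
      have "G q p = G p q" using pq quad_H1_sym(2)[of "u $ q" "u $ q" "u $ p" "u $ p"]
        by (simp add: G_def coupling_def)
      then show ?thesis by (simp add: diff_divide_distrib power2_eq_square mult.commute)
    qed
    finally have Z: "Z = G p p / (s p)\<^sup>2 + G q q / (s q)\<^sup>2 - 2 * (G p q / (s p * s q))" .
    have pp: "G p p / (s p)\<^sup>2 = (m * P)\<^sup>2" "G q q / (s q)\<^sup>2 = (n * R)\<^sup>2"
      using \<mu> quad_H1_self_pos[OF N u(1)] quad_H1_self_pos[OF N u(2)]
      by (simp_all add: m_def n_def P_def R_def G_def coupling_def power_mult_distrib power_divide)
    have "G p q / (s p * s q) \<le> b * (sqrt (quad_H1 (u $ p) (u $ p) (u $ p) (u $ p)) *
        sqrt (quad_H1 (u $ q) (u $ q) (u $ q) (u $ q))) / (s p * s q)"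
      using quad_H1_Cauchy_Schwarz[OF N, of "u $ p" "u $ q"] b s pq unfolding G_def coupling_def
      by (intro divide_right_mono) auto
    also have "\<dots> = b * (P * R)" by (simp add: P_def R_def)
    also have "\<dots> < sqrt (\<mu> p * \<mu> q) * (P * R)" using b pos by (intro mult_strict_right_mono) auto
    also have "\<dots> = (m * P) * (n * R)" by (simp add: m_def n_def real_sqrt_mult)
    finally have "G p q / (s p * s q) < (m * P) * (n * R)" .
    moreover have "2 * (m * P) * (n * R) \<le> (m * P)\<^sup>2 + (n * R)\<^sup>2" by (rule sum_squares_bound)
    ultimately show ?thesis unfolding Z pp by linarith
  qed
  \<comment> \<open>The largest step for which \<open>1 + t * z i\<close> and
    \<open>1 - t * z i\<close> stay nonnegative for all \<open>i\<close>.\<close>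
  define t where "t = min (s p) (s q)"
  have t: "0 < t" using s by (simp add: t_def)
  have tz: "\<bar>t * z i\<bar> \<le> 1" for i
    using s pq by (auto simp: z_def t_def divide_le_eq)
  have nn: "0 \<le> 1 + t * z i" "0 \<le> 1 + (- t) * z i" for i using tz[of i] by auto
  have "0 < t\<^sup>2 * Z" using t Zpos by simp
  \<comment> \<open>The sign of the step is chosen so that the linear term does not
    decrease.\<close>
  then have "X < X + t * Y + t\<^sup>2 * Z \<or> X < X + (- t) * Y + (- t)\<^sup>2 * Z"
    by (cases "0 \<le> t * Y") auto
  then show thesis
    using that[OF V_form[of t, OF nn(1)]] that[OF V_form[of "- t", OF nn(2)]]
    unfolding X V_quad[of t, OF nn(1)] V_quad[of "- t", OF nn(2)] by blast
qed

section \<open>The energy of the system as a quartic problem, and the contradiction\<close>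

theorem theorem1p7:
  fixes lam \<mu> :: "'d::{finite,linorder} \<Rightarrow> real" and b :: real
  assumes "CARD('n::finite) \<in> {1, 2, 3}"
    and "CARD('d) \<ge> 2"
    and "\<forall>i. lam i > 0"
    and "\<forall>i. \<mu> i > 0"
    and "mono \<mu>"
    and "b > 0"
    and "b < 2 powr (1 - real CARD('d) / 2) * sqrt (\<mu> (Min UNIV) * \<mu> (Max UNIV))"
  shows "(fully_nontrivial_ground_states lam \<mu> (\<lambda>i j. b) :: ((real ^ 'n) H1 ^ 'd::{finite,linorder}) set) = {}"
proof -
  define \<beta> where "\<beta> = coupling \<mu> b"
  define p q :: 'd where "p = Min UNIV" and "q = Max UNIV"
  have N: "DIM(real ^ 'n) \<le> 3" using assms(1) by auto
  have lam: "0 < lam i" for i using assms(3) by blast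
  define c where "c = Min (range (\<lambda>i. min 1 (lam i)))"
  define K where "K = (\<Sum>i\<in>UNIV. \<Sum>j\<in>UNIV. \<bar>\<beta> i j\<bar> * sobolev_root DIM(real ^ 'n) ^ 4)"
  have P: "quartic_problem (form_vec lam :: ((real ^ 'n) H1, 'd) vec \<Rightarrow> _) (quad_vec \<beta>) c K"
    unfolding c_def K_def by (rule quartic_problem_vec[OF N _ lam]) (auto simp: \<beta>_def coupling_def)
  interpret P: quartic_problem "form_vec lam :: ((real ^ 'n) H1, 'd) vec \<Rightarrow> _" "quad_vec \<beta>" c K by (rule P)
  have energy: "energy lam \<mu> (\<lambda>i j. b) = P.E"
    by (rule ext) (simp add: energy_eq P.E_def P.Q_def flip: \<beta>_def)
  have sol: "u \<in> nontrivial_solutions lam \<mu> (\<lambda>i j. b) \<longleftrightarrow> u \<noteq> 0 \<and> P.critical u" for u :: "((real ^ 'n) H1, 'd) vec"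
    unfolding nontrivial_solutions_def energy P.critical_iff_derivative_zero by simp
  have pq: "p \<noteq> q"
  proof
    assume eq: "p = q"
    have "i = p" for i
    proof -
      have "p \<le> i" "i \<le> q" by (simp_all add: p_def q_def)
      then show ?thesis using eq by simp
    qed
    then have "(UNIV :: 'd set) = {p}" by blast
    then have "CARD('d) = card {p}" by (rule arg_cong)
    then show False using assms(2) by simp
  qed
  have small: "b < sqrt (\<mu> p * \<mu> q)"
  proof -
    have "2 powr (1 - real CARD('d) / 2) \<le> 2 powr 0" using assms(2) by (intro powr_mono) auto
    then have "2 powr (1 - real CARD('d) / 2) * sqrt (\<mu> p * \<mu> q) \<le> 1 * sqrt (\<mu> p * \<mu> q)"
      using assms(4) by (intro mult_right_mono) (auto intro: less_imp_le)
    then show ?thesis using assms(7) unfolding p_def q_def by linarith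
  qed
  show ?thesis
  proof (rule equals0I)
    fix u :: "((real ^ 'n) H1, 'd) vec"
    assume "u \<in> fully_nontrivial_ground_states lam \<mu> (\<lambda>i j. b)"
    then have u: "u \<noteq> 0" "P.critical u" and full: "\<And>i. u $ i \<noteq> 0"
      and level: "P.E u = Inf (P.E ` (nontrivial_solutions lam \<mu> (\<lambda>i j. b)))"
      unfolding fully_nontrivial_ground_states_def ground_states_def ground_state_level_def
      by (simp_all add: sol energy)
    \<comment> \<open>Existence is invoked only under the assumption that \<open>u\<close> is a
      ground state, which also covers the case of an empty set of solutions.\<close>
    obtain z where z: "z \<noteq> 0" "P.critical z" "P.E z \<le> 1 / (4 * P.S)"
      by (rule least_energy_solution_exists[OF N P u])
    have "P.E u \<le> P.E z"
      unfolding level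
    proof (rule cInf_lower)
      show "P.E z \<in> P.E ` nontrivial_solutions lam \<mu> (\<lambda>i j. b)" using z by (simp add: sol)
      \<comment> \<open>\<open>Inf\<close> on the reals is a lower bound only of sets that are
        bounded below; the energy of a solution is a quarter of its nonnegative quadratic
        part.\<close>
      show "bdd_below (P.E ` nontrivial_solutions lam \<mu> (\<lambda>i j. b))"
      proof (rule bdd_belowI2)
        show "0 \<le> P.E v" if "v \<in> nontrivial_solutions lam \<mu> (\<lambda>i j. b)" for v
          using that P.B_nonneg[of v] by (simp add: sol P.critical_imp_E_eq)
      qed
    qed
    with z(3) have E: "P.E u \<le> 1 / (4 * P.S)" by linarith
    have \<mu>: "0 < \<mu> p" "0 < \<mu> q" using assms(4) by auto
    obtain v :: "((real ^ 'n) H1, 'd) vec" where v: "form_vec lam v v = form_vec lam u u" "quad_vec \<beta> u u u u < quad_vec \<beta> v v v v"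
      unfolding \<beta>_def
      by (rule fully_nontrivial_not_maximizer[where lam = lam, OF N lam \<mu> pq assms(6) small full full])
    show False using P.least_energy_imp_maximizer[OF u E v(1)] v(2) by (simp add: P.Q_def)
  qed
qed


end
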